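(* Let $n\ge 1$ and let $\mu^1$ be a Hodge point of $GL_n$. Then there is a constant $C'$, depending only on $\mu^1$, such that for every integer $N > C'$ and every $N$-tuple of Hodge points $\underline{\mu} = (\mu^1, \mu^2, \ldots, \mu^N)$ whose first entry is $\mu^1$, all elements of $H_{\underline{\mu}, N}(GL_n)$ have the same Newton point (i.e. $H_{\underline{\mu}, N}(GL_n)$ is contained in a single Newton stratum).
   Context: Let $k$ be an algebraically closed field of characteristic $p>0$, $K = \mathrm{Frac}(W(k))$, $F$ a finite extension of $\mathbb{Q}_p$ inside a fixed algebraic closure of $K$, $L = K\cdot F$ with ring of integers $O_L$ and normalized valuation $\mathrm{val}_L$ (value group $\mathbb{Z}$), and $\sigma$ the Frobenius automorphism of $L/F$. For $b \in GL_n(L)$ its Hodge point $\mu(b)$ is the tuple of elementary divisors of $b$ (the valuations $\mathrm{val}_L(t_1),\ldots,\mathrm{val}_L(t_n)$ when $b \in GL_n(O_L)\,\mathrm{diag}(t_1,\ldots,t_n)\,GL_n(O_L)$), taken up to permutation; its Newton point $\nu(b)$ is the tuple of slopes of the isocrystal $(L^n, b\sigma)$ (Dieudonné–Manin classification), up to permutation. For $i\ge1$ put $(b\sigma)^i = b\,\sigma(b)\,\sigma^2(b)\cdots\sigma^{i-1}(b)$. For $N \ge 1$ and an $N$-tuple $\underline{\mu}=(\mu^1,\ldots,\mu^N)$ of Hodge points, $H_{\underline{\mu},N}(GL_n) = \{ b \in GL_n(L) : \mu((b\sigma)^i) = \mu^i \text{ for } i = 1, \ldots, N\}$. *)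

theory Defs
  imports
    "Jordan_Normal_Form.Matrix"
    "HOL-Computational_Algebra.Computational_Algebra"
    "HOL-Library.Multiset"
begin

section \<open>The fields\<close>

definition subring_of :: "'l::field set \<Rightarrow> bool" where
  "subring_of R \<longleftrightarrow> 0 \<in> R \<and> 1 \<in> R \<and> (\<forall>x\<in>R. \<forall>y\<in>R. x - y \<in> R \<and> x * y \<in> R)"

definition subfield_of :: "'l::field set \<Rightarrow> bool" where
  "subfield_of E \<longleftrightarrow> subring_of E \<and> (\<forall>x\<in>E. inverse x \<in> E)"

definition fractions :: "'l::field set \<Rightarrow> 'l set" where
  "fractions R = {a / b | a b. a \<in> R \<and> b \<in> R \<and> b \<noteq> 0}"

text \<open>
  \<open>x\<close> and \<open>y\<close> are congruent modulo \<open>p\<^sup>m R\<close>, for a subring \<open>R\<close> of the field.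
\<close>
definition pcong :: "nat \<Rightarrow> 'l::field set \<Rightarrow> nat \<Rightarrow> 'l \<Rightarrow> 'l \<Rightarrow> bool" where
  "pcong p R m x y \<longleftrightarrow> (\<exists>w\<in>R. x - y = of_nat p ^ m * w)"

text \<open>
  For a perfect field \<open>k\<close> of characteristic \<open>p > 0\<close>, the ring of Witt vectors \<open>W(k)\<close> is, up to
  unique isomorphism, the strict \<open>p\<close>-ring with residue ring \<open>k\<close>: the \<open>p\<close>-torsion-free,
  \<open>p\<close>-adically separated and complete ring with \<open>W/pW \<cong> k\<close>. Here it is a subring of a field of
  characteristic 0 (so \<open>p\<close>-torsion-freeness is automatic), and \<open>red\<close> is the reduction map
  \<open>W \<rightarrow> k\<close>; its values outside \<open>W\<close> play no role.
\<close>
locale witt_ring =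
  fixes W :: "'l::field_char_0 set"
    and red :: "'l \<Rightarrow> 'k::{alg_closed_field, field_prime_char}"
  assumes subring: "subring_of W"
    and red_1: "red 1 = 1"
    and red_add: "\<And>x y. x \<in> W \<Longrightarrow> y \<in> W \<Longrightarrow> red (x + y) = red x + red y"
    and red_mult: "\<And>x y. x \<in> W \<Longrightarrow> y \<in> W \<Longrightarrow> red (x * y) = red x * red y"
    and red_surj: "red ` W = UNIV"
    and red_kernel: "\<And>x. x \<in> W \<Longrightarrow> red x = 0 \<longleftrightarrow> pcong CHAR('k) W 1 x 0"
    and separated: "\<And>x. x \<in> W \<Longrightarrow> (\<And>m. pcong CHAR('k) W m x 0) \<Longrightarrow> x = 0"
    and complete: "\<And>a :: nat \<Rightarrow> 'l. (\<And>m. a m \<in> W) \<Longrightarrow>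
      (\<And>m. pcong CHAR('k) W m (a (Suc m)) (a m)) \<Longrightarrow>
      \<exists>x\<in>W. \<forall>m. pcong CHAR('k) W m x (a m)"

text \<open>
  \<open>\<rat>\<^sub>p\<close> as a subfield of \<open>K = Frac W\<close>: the \<open>p\<close>-adic closure of the rationals.
\<close>
definition padic_field :: "nat \<Rightarrow> 'l::field_char_0 set \<Rightarrow> 'l set" where
  "padic_field p W = {x \<in> fractions W. \<forall>m. \<exists>r\<in>\<rat>. pcong p W m x r}"

definition finite_extension :: "'l::field set \<Rightarrow> 'l set \<Rightarrow> bool" where
  "finite_extension E F \<longleftrightarrow> subfield_of E \<and> subfield_of F \<and> E \<subseteq> F \<and>
     (\<exists>B. finite B \<and> B \<subseteq> F \<and> (\<forall>x\<in>F. \<exists>c. c ` B \<subseteq> E \<and> x = (\<Sum>b\<in>B. c b * b)))"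

text \<open>
  Normalized discrete valuations with value group the integers. The valuation of 0 is infinite;
  since \<open>val\<close> is integer-valued, \<open>val 0\<close> is a junk value that is never used.
\<close>
definition normalized_valuation :: "('l::field \<Rightarrow> int) \<Rightarrow> bool" where
  "normalized_valuation val \<longleftrightarrow>
     (\<forall>x y. x \<noteq> 0 \<longrightarrow> y \<noteq> 0 \<longrightarrow> val (x * y) = val x + val y) \<and>
     (\<forall>x y. x \<noteq> 0 \<longrightarrow> y \<noteq> 0 \<longrightarrow> x + y \<noteq> 0 \<longrightarrow> min (val x) (val y) \<le> val (x + y)) \<and>
     (\<exists>x. x \<noteq> 0 \<and> val x = 1)"

definition val_ring :: "('l::field \<Rightarrow> int) \<Rightarrow> 'l set" where
  "val_ring val = {x. x = 0 \<or> val x \<ge> 0}"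

definition max_ideal :: "('l::field \<Rightarrow> int) \<Rightarrow> 'l set" where
  "max_ideal val = {x. x = 0 \<or> val x > 0}"

definition residue_card :: "('l::field \<Rightarrow> int) \<Rightarrow> 'l set \<Rightarrow> nat" where
  "residue_card val F =
     card ((F \<inter> val_ring val) //
       {(x, y). x \<in> F \<inter> val_ring val \<and> y \<in> F \<inter> val_ring val \<and> x - y \<in> max_ideal val})"

text \<open>
  The field \<open>L = K \<sqdot> F\<close> is the whole type \<open>'l\<close>; \<open>K\<close>, \<open>F\<close> and \<open>\<rat>\<^sub>p\<close> are subsets of it. As \<open>F\<close> is
  finite over \<open>\<rat>\<^sub>p\<close>, \<open>L\<close> is algebraic over \<open>K\<close>, so it may be thought of as lying inside an algebraic
  closure of \<open>K\<close>. The condition \<open>val_ring\<close> says that \<open>val\<close> induces on \<open>K\<close> the valuation with ring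
  \<open>W(k)\<close>. The Frobenius of \<open>L/F\<close> is the automorphism over \<open>F\<close> that induces the \<open>q\<close>-th power
  map on the residue field of \<open>L\<close>, where \<open>q\<close> is the cardinality of the residue field of \<open>F\<close>.
\<close>
locale frobenius_field = witt_ring W red
  for W :: "'l::field_char_0 set"
    and red :: "'l \<Rightarrow> 'k::{alg_closed_field, field_prime_char}" +
  fixes F :: "'l set"
    and val :: "'l \<Rightarrow> int"
    and \<sigma> :: "'l \<Rightarrow> 'l"
  assumes F_finite: "finite_extension (padic_field CHAR('k) W) F"
    and compositum: "\<And>E. subfield_of E \<Longrightarrow> fractions W \<subseteq> E \<Longrightarrow> F \<subseteq> E \<Longrightarrow> E = UNIV"
    and normalized: "normalized_valuation val"
    and val_ring: "fractions W \<inter> val_ring val = W"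
    and sigma_bij: "bij \<sigma>"
    and sigma_add: "\<And>x y. \<sigma> (x + y) = \<sigma> x + \<sigma> y"
    and sigma_mult: "\<And>x y. \<sigma> (x * y) = \<sigma> x * \<sigma> y"
    and sigma_F: "\<And>x. x \<in> F \<Longrightarrow> \<sigma> x = x"
    and sigma_frob: "\<And>x. x \<in> val_ring val \<Longrightarrow>
      \<sigma> x - x ^ residue_card val F \<in> max_ideal val"

section \<open>Hodge points\<close>

definition GL :: "nat \<Rightarrow> 'l::field set \<Rightarrow> 'l mat set" where
  "GL n R = {A \<in> carrier_mat n n. elements_mat A \<subseteq> R \<and>
     (\<exists>B \<in> carrier_mat n n. elements_mat B \<subseteq> R \<and> A * B = 1\<^sub>m n \<and> B * A = 1\<^sub>m n)}"

text \<open>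
  Tuples taken up to permutation are multisets.
\<close>
definition hodge_points :: "nat \<Rightarrow> int multiset set" where
  "hodge_points n = {\<mu>. size \<mu> = n}"

definition is_hodge_point :: "('l::field \<Rightarrow> int) \<Rightarrow> 'l mat \<Rightarrow> int multiset \<Rightarrow> bool" where
  "is_hodge_point val b \<mu> \<longleftrightarrow>
     (let n = dim_row b in
      \<exists>U \<in> GL n (val_ring val). \<exists>V \<in> GL n (val_ring val). \<exists>t.
        (\<forall>i<n. t i \<noteq> 0) \<and> b = U * mat_diag n t * V \<and> \<mu> = mset (map (\<lambda>i. val (t i)) [0..<n]))"

definition hodge_point :: "('l::field \<Rightarrow> int) \<Rightarrow> 'l mat \<Rightarrow> int multiset" where
  "hodge_point val b = (THE \<mu>. is_hodge_point val b \<mu>)"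

section \<open>Newton points\<close>

text \<open>
  The simple isocrystal of slope \<open>s/r\<close> (with \<open>s\<close>, \<open>r\<close> coprime) has a basis
  \<open>e\<^sub>0, \<dots>, e\<^sub>r\<^sub>-\<^sub>1\<close> with \<open>e\<^sub>j \<mapsto> e\<^sub>j\<^sub>+\<^sub>1\<close> for \<open>j < r - 1\<close> and \<open>e\<^sub>r\<^sub>-\<^sub>1 \<mapsto> \<pi>\<^sup>s e\<^sub>0\<close>; this is the matrix of its
  Frobenius (column \<open>j\<close> is the image of \<open>e\<^sub>j\<close>).
\<close>
definition simple_isocrystal :: "'l::field \<Rightarrow> int \<Rightarrow> nat \<Rightarrow> 'l mat" where
  "simple_isocrystal \<pi> s r = mat r r (\<lambda>(i, j).
     if j + 1 < r then (if i = j + 1 then 1 else 0)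
     else (if i = 0 then \<pi> powi s else 0))"

text \<open>
  The Dieudonne-Manin classification: \<open>(L\<^sup>n, b\<sigma>)\<close> is isomorphic to a direct sum of simple
  isocrystals of slopes \<open>s/r\<close>, and each such summand contributes its slope with multiplicity
  \<open>r\<close>. An isomorphism \<open>(L\<^sup>n, D\<sigma>) \<cong> (L\<^sup>n, b\<sigma>)\<close> is a matrix \<open>g \<in> GL\<^sub>n(L)\<close> with
  \<open>g D = b \<sigma>(g)\<close>. The uniformizer \<open>\<pi>\<close> of \<open>L\<close> may be chosen arbitrarily, since the isomorphism
  class of the simple isocrystal of slope \<open>s/r\<close> does not depend on it.
\<close>
definition is_newton_point ::
    "('l::field \<Rightarrow> int) \<Rightarrow> ('l \<Rightarrow> 'l) \<Rightarrow> 'l mat \<Rightarrow> rat multiset \<Rightarrow> bool" where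
  "is_newton_point val \<sigma> b \<nu> \<longleftrightarrow>
     (\<exists>\<pi> (srs :: (int \<times> nat) list). \<exists>g \<in> GL (dim_row b) UNIV.
        \<pi> \<noteq> 0 \<and> val \<pi> = 1 \<and>
        (\<forall>(s, r) \<in> set srs. r > 0 \<and> coprime s (int r)) \<and>
        g * diag_block_mat (map (\<lambda>(s, r). simple_isocrystal \<pi> s r) srs) = b * map_mat \<sigma> g \<and>
        \<nu> = mset (concat (map (\<lambda>(s, r). replicate r (of_int s / of_nat r)) srs)))"

definition newton_point ::
    "('l::field \<Rightarrow> int) \<Rightarrow> ('l \<Rightarrow> 'l) \<Rightarrow> 'l mat \<Rightarrow> rat multiset" where
  "newton_point val \<sigma> b = (THE \<nu>. is_newton_point val \<sigma> b \<nu>)"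

section \<open>The sets \<open>H\<^sub>\<mu>\<^sub>,\<^sub>N\<close>\<close>

text \<open>
  \<open>b \<sigma>(b) \<dots> \<sigma>\<^sup>i\<^sup>-\<^sup>1(b)\<close>
\<close>
fun frob_power :: "('l::field \<Rightarrow> 'l) \<Rightarrow> 'l mat \<Rightarrow> nat \<Rightarrow> 'l mat" where
  "frob_power \<sigma> b 0 = 1\<^sub>m (dim_row b)"
| "frob_power \<sigma> b (Suc i) = frob_power \<sigma> b i * map_mat (\<sigma> ^^ i) b"

text \<open>
  A tuple \<open>(\<mu>\<^sup>1, \<dots>, \<mu>\<^sup>N)\<close> is a function of which only the values at \<open>1, \<dots>, N\<close> are used.
\<close>
definition H_set ::
    "('l::field \<Rightarrow> int) \<Rightarrow> ('l \<Rightarrow> 'l) \<Rightarrow> nat \<Rightarrow> (nat \<Rightarrow> int multiset) \<Rightarrow> nat \<Rightarrow> 'l mat set" where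
  "H_set val \<sigma> n \<mu> N =
     {b \<in> GL n UNIV. \<forall>i\<in>{1..N}. hodge_point val (frob_power \<sigma> b i) = \<mu> i}"

end

theory Submission
  imports Defs "HOL-Library.Function_Algebras" "HOL-Combinatorics.Transposition"
    "Jordan_Normal_Form.Determinant"
begin

text \<open>
  The Newton point of \<open>b\<close> is determined by the Hodge points of \<open>b\<close> and of \<open>(b\<sigma>)\<^sup>N\<close> alone. Let \<open>c\<close> bound the
  absolute values of the entries of the Hodge point of \<open>b\<close>. On the part of the isocrystal of slopes at
  least \<open>\<lambda>\<close>, every vector \<open>u\<close> satisfies a monic relation of degree at most \<open>n\<close> in which the coefficient of
  \<open>F\<^sup>i u\<close> has valuation at least \<open>(d - i) \<lambda>\<close>, where \<open>d\<close> is the degree. Hence \<open>F\<^sup>N u\<close> is divisible by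
  \<open>\<pi>\<close> to the power \<open>N \<lambda> - 2nc\<close> if \<open>u\<close> is integral. By the min-max principle for elementary
  divisors, the \<open>i\<close>-th Hodge slope of \<open>(b\<sigma>)\<^sup>N\<close> is at least \<open>N \<lambda>\<^sub>i - 2nc\<close>, for both tuples in increasing order.
  As the determinant forces the sums of both sides to differ by the error terms only, the Hodge slopes
  determine each \<open>N \<lambda>\<^sub>i\<close> up to a constant depending on \<open>n\<close> and \<open>c\<close>; since the slopes have denominators
  at most \<open>n\<close>, they are determined for large \<open>N\<close>.

  That every \<open>b\<close> has a Newton point is the existence part of the theorem of Dieudonne and Manin. A minimal
  relation modulo an invariant subspace has a slope \<open>s/r\<close>; the corresponding operator on the simple
  isocrystal of that slope has a nonzero kernel, by solving polynomial equations over the residue field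
  and successive approximation. This gives a copy of the simple isocrystal in the quotient, which lifts because
  the operators \<open>F\<^sup>r - \<pi>\<^sup>s\<close> are surjective.
\<close>

section \<open>Linear dependence over a subfield\<close>

text \<open>The matrix \<open>g\<close> that decomposes an isocrystal can be arbitrarily far from
  the standard lattice, so an estimate in a basis adapted to the slopes would carry a constant
  depending on \<open>b\<close>. The monic relations avoid this: the valuations of their
  coefficients are bounded by the slopes alone, whatever the lattice. The lattice enters only when
  the relation is evaluated at an integral vector. The coefficient of the \<open>i\<close>-th
  iterate loses at most \<open>i * c\<close>, as no slope exceeds \<open>c\<close> in absolute
  value, and the iterate itself loses at most \<open>i * c\<close>; since \<open>i < n\<close>, the
  total error is at most \<open>2 * n * c\<close>. Equality of the sums makes this one-sided bound
  two-sided, at the price of a factor \<open>n\<close>, and distinct fractions with denominators at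
  most \<open>n\<close> differ by at least \<open>1 / n ^ 2\<close>. Hence the threshold
  \<open>n * (2 * n * c) * n ^ 2 = 2 * c * n ^ 4\<close>. The Newton point is a definite
  description. The classification is needed only for existence; uniqueness comes from the same
  comparison of slopes, with both matrices equal.\<close>

lemma subfield_ofD:
  assumes "subfield_of E"
  shows "0 \<in> E" "1 \<in> E" "x \<in> E \<Longrightarrow> y \<in> E \<Longrightarrow> x - y \<in> E" "x \<in> E \<Longrightarrow> y \<in> E \<Longrightarrow> x * y \<in> E"
    "x \<in> E \<Longrightarrow> - x \<in> E" "x \<in> E \<Longrightarrow> y \<in> E \<Longrightarrow> x + y \<in> E" "x \<in> E \<Longrightarrow> inverse x \<in> E"
    "x \<in> E \<Longrightarrow> y \<in> E \<Longrightarrow> x / y \<in> E"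
proof -
  show z: "0 \<in> E" and "1 \<in> E" and d: "\<And>x y. x \<in> E \<Longrightarrow> y \<in> E \<Longrightarrow> x - y \<in> E"
    and m: "\<And>x y. x \<in> E \<Longrightarrow> y \<in> E \<Longrightarrow> x * y \<in> E" and i: "\<And>x. x \<in> E \<Longrightarrow> inverse x \<in> E"
    using assms by (auto simp: subfield_of_def subring_of_def)
  show n: "\<And>x. x \<in> E \<Longrightarrow> - x \<in> E" using d[OF z] by simp
  show "x \<in> E \<Longrightarrow> y \<in> E \<Longrightarrow> x + y \<in> E" using d[of x "- y"] n by simp
  show "x \<in> E \<Longrightarrow> y \<in> E \<Longrightarrow> x / y \<in> E" using m[of x "inverse y"] i by (simp add: divide_inverse)
qed

lemma subfield_sum:
  assumes "subfield_of E" "\<And>i. i \<in> I \<Longrightarrow> f i \<in> E"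
  shows "sum f I \<in> E"
  using assms(2) by (induction I rule: infinite_finite_induct) (auto simp: subfield_ofD[OF assms(1)])

lemma subfield_UNIV: "subfield_of UNIV"
  by (auto simp: subfield_of_def subring_of_def)

text \<open>Elimination: a pivot \<open>a i0 j0\<close> removes one unknown and one equation. The
  solution stays in the subfield \<open>E\<close>, because relations over \<open>fractions W\<close>
  inside the larger field are needed as well as relations over the whole field.\<close>

lemma homogeneous_system:
  fixes a :: "'i \<Rightarrow> 'j \<Rightarrow> 'l::field"
  assumes E: "subfield_of E" and "finite J" "finite I" "card J < card I"
    and "\<And>i j. i \<in> I \<Longrightarrow> j \<in> J \<Longrightarrow> a i j \<in> E"
  shows "\<exists>c. c ` I \<subseteq> E \<and> (\<exists>i\<in>I. c i \<noteq> 0) \<and> (\<forall>j\<in>J. (\<Sum>i\<in>I. c i * a i j) = 0)"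
  using assms(2-5)
proof (induction J arbitrary: I a rule: finite_induct)
  case empty
  then obtain i where "i \<in> I" by fastforce
  then show ?case using subfield_ofD(1,2)[OF E] by (intro exI[of _ "\<lambda>_. 1"]) auto
next
  case (insert j0 J)
  show ?case
  proof (cases "\<forall>i\<in>I. a i j0 = 0")
    case True
    have "card J < card I" using insert by simp
    from insert.IH[OF insert.prems(1) this, of a] insert.prems(3)
    obtain c where "c ` I \<subseteq> E" "\<exists>i\<in>I. c i \<noteq> 0" "\<forall>j\<in>J. (\<Sum>i\<in>I. c i * a i j) = 0" by auto
    then show ?thesis using True by (intro exI[of _ c]) auto
  next
    case False
    then obtain i0 where i0: "i0 \<in> I" "a i0 j0 \<noteq> 0" by auto
    let ?I = "I - {i0}"
    define a' where "a' i j = a i j - a i j0 / a i0 j0 * a i0 j" for i j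
    have "card J < card ?I" using insert i0 by (simp add: card_Diff_singleton)
    moreover have "a' i j \<in> E" if "i \<in> ?I" "j \<in> J" for i j
      using that insert.prems(3) i0 by (auto simp: a'_def intro!: subfield_ofD[OF E])
    ultimately obtain c where c: "c ` ?I \<subseteq> E" "\<exists>i\<in>?I. c i \<noteq> 0"
      "\<forall>j\<in>J. (\<Sum>i\<in>?I. c i * a' i j) = 0"
      using insert.IH[of ?I a'] insert.prems(1) by auto
    define e where "e = - (\<Sum>i\<in>?I. c i * a i j0) / a i0 j0"
    define c' where "c' = c(i0 := e)"
    have eE: "e \<in> E" unfolding e_def using c(1) insert.prems(3) i0
      by (intro subfield_ofD[OF E] subfield_sum[OF E]) auto
    have sum': "(\<Sum>i\<in>I. c' i * a i j) = e * a i0 j + (\<Sum>i\<in>?I. c i * a i j)" for j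
      using insert.prems(1) i0 by (subst sum.remove[of I i0]) (auto simp: c'_def intro!: sum.cong)
    have "(\<Sum>i\<in>I. c' i * a i j) = 0" if "j \<in> insert j0 J" for j
    proof (cases "j = j0")
      case True then show ?thesis using i0 by (simp add: sum' e_def)
    next
      case False
      then have "0 = (\<Sum>i\<in>?I. c i * a' i j)" using c that by auto
      also have "\<dots> = (\<Sum>i\<in>?I. c i * a i j) - (\<Sum>i\<in>?I. c i * a i j0) * (a i0 j / a i0 j0)"
        by (simp add: a'_def algebra_simps sum_subtractf sum_distrib_left)
      finally show ?thesis by (simp add: sum' e_def algebra_simps)
    qed
    moreover have "c' ` I \<subseteq> E" using c(1) eE by (auto simp: c'_def)
    moreover have "\<exists>i\<in>I. c' i \<noteq> 0" using c(2) by (auto simp: c'_def)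
    ultimately show ?thesis by blast
  qed
qed

section \<open>Valuations\<close>

text \<open>All estimates are phrased with \<open>vge\<close>, in which 0 has infinite valuation,
  since \<open>val 0\<close> is a junk integer.\<close>

definition vge :: "('l::field \<Rightarrow> int) \<Rightarrow> int \<Rightarrow> 'l \<Rightarrow> bool" where
  "vge val t x \<longleftrightarrow> x = 0 \<or> t \<le> val x"

locale valued =
  fixes val :: "'l::field \<Rightarrow> int"
  assumes nval: "normalized_valuation val"
begin

abbreviation "ge \<equiv> vge val"

lemma val_mult: "x \<noteq> 0 \<Longrightarrow> y \<noteq> 0 \<Longrightarrow> val (x * y) = val x + val y"
  using nval by (auto simp: normalized_valuation_def)

lemma val_one [simp]: "val 1 = 0"
  using val_mult[of 1 1] by simp

lemma val_uminus [simp]: "val (- x) = val x"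
proof (cases "x = 0")
  case False
  have "val (-1) = 0" using val_mult[of "-1" "-1"] by simp
  then show ?thesis using val_mult[of "-1" x] False by simp
qed simp

lemma val_inverse: "x \<noteq> 0 \<Longrightarrow> val (inverse x) = - val x"
  using val_mult[of x "inverse x"] by simp

lemma val_divide: "x \<noteq> 0 \<Longrightarrow> y \<noteq> 0 \<Longrightarrow> val (x / y) = val x - val y"
  by (simp add: divide_inverse val_mult val_inverse)

lemma val_power: "x \<noteq> 0 \<Longrightarrow> val (x ^ k) = int k * val x"
  by (induction k) (auto simp: val_mult algebra_simps)

lemma val_powi: "x \<noteq> 0 \<Longrightarrow> val (x powi k) = k * val x"
  by (cases "k \<ge> 0") (auto simp: power_int_def val_power val_inverse)

lemma val_prod: "(\<And>i. i \<in> I \<Longrightarrow> f i \<noteq> 0) \<Longrightarrow> val (prod f I) = (\<Sum>i\<in>I. val (f i))"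
  by (induction I rule: infinite_finite_induct) (auto simp: val_mult)

lemma ge_0 [simp]: "ge t 0" by (simp add: vge_def)

lemma ge_one [simp]: "ge 0 1" by (simp add: vge_def)

lemma geD: "ge t x \<Longrightarrow> x \<noteq> 0 \<Longrightarrow> t \<le> val x" by (simp add: vge_def)

lemma ge_mono: "ge t x \<Longrightarrow> t' \<le> t \<Longrightarrow> ge t' x" by (auto simp: vge_def)

lemma ge_add: "ge t x \<Longrightarrow> ge t y \<Longrightarrow> ge t (x + y)"
proof -
  assume *: "ge t x" "ge t y"
  show ?thesis
  proof (cases "x = 0 \<or> y = 0 \<or> x + y = 0")
    case False
    then have "min (val x) (val y) \<le> val (x + y)" using nval by (auto simp: normalized_valuation_def)
    then show ?thesis using * False by (auto simp: vge_def)
  qed (use * in auto)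
qed

lemma ge_uminus [simp]: "ge t (- x) \<longleftrightarrow> ge t x" by (simp add: vge_def)

lemma ge_diff: "ge t x \<Longrightarrow> ge t y \<Longrightarrow> ge t (x - y)"
  using ge_add[of t x "- y"] by simp

lemma ge_sum: "(\<And>i. i \<in> I \<Longrightarrow> ge t (f i)) \<Longrightarrow> ge t (sum f I)"
  by (induction I rule: infinite_finite_induct) (auto simp: ge_add)

lemma ge_mult: "ge s x \<Longrightarrow> ge t y \<Longrightarrow> ge (s + t) (x * y)"
  by (cases "x = 0 \<or> y = 0") (auto simp: vge_def val_mult)

lemma ge_mult': "ge s x \<Longrightarrow> ge t y \<Longrightarrow> u \<le> s + t \<Longrightarrow> ge u (x * y)"
  using ge_mult ge_mono by blast

lemma ge_mult_iff: "c \<noteq> 0 \<Longrightarrow> ge t (c * x) \<longleftrightarrow> ge (t - val c) x"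
  by (cases "x = 0") (auto simp: vge_def val_mult)

lemma ge_power: "ge 0 x \<Longrightarrow> ge 0 (x ^ k)"
  by (induction k) (auto intro: ge_mult')

lemma ge_all_0: "(\<And>t. ge t x) \<Longrightarrow> x = 0"
  by (metis geD less_add_one linorder_not_less)

lemma ge_cancel: "ge t (x - y) \<Longrightarrow> ge t y \<Longrightarrow> ge t x"
  using ge_add[of t "x - y" y] by simp

lemma ge_1_iff: "ge 0 x \<Longrightarrow> \<not> ge 1 x \<longleftrightarrow> x \<noteq> 0 \<and> val x = 0"
  by (auto simp: vge_def)

lemma ex_uniformizer: "\<exists>x. x \<noteq> 0 \<and> val x = 1"
  using nval by (auto simp: normalized_valuation_def)

lemma val_ring_eq: "val_ring val = {x. ge 0 x}" by (auto simp: val_ring_def vge_def)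

lemma max_ideal_eq: "max_ideal val = {x. ge 1 x}" by (auto simp: max_ideal_def vge_def)

end

section \<open>Complete discretely valued fields with a Frobenius\<close>

locale field_auto =
  fixes \<sigma> :: "'l::field \<Rightarrow> 'l"
  assumes sig_bij: "bij \<sigma>"
    and sig_add: "\<sigma> (x + y) = \<sigma> x + \<sigma> y"
    and sig_mult: "\<sigma> (x * y) = \<sigma> x * \<sigma> y"
begin

lemma sig_0 [simp]: "\<sigma> 0 = 0"
  using sig_add[of 0 0] by (metis add_0 add_cancel_right_right)

lemma sig_uminus: "\<sigma> (- x) = - \<sigma> x"
  using sig_add[of x "- x"] by (simp add: eq_neg_iff_add_eq_0 add.commute)

lemma sig_diff: "\<sigma> (x - y) = \<sigma> x - \<sigma> y"
  using sig_add[of x "- y"] by (simp add: sig_uminus)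

lemma sig_eq_0_iff [simp]: "\<sigma> x = 0 \<longleftrightarrow> x = 0"
  using sig_bij sig_0 by (metis bij_def injD)

lemma sig_1 [simp]: "\<sigma> 1 = 1"
  using sig_mult[of 1 1] sig_eq_0_iff[of 1] by (metis mult_cancel_right1 mult.right_neutral one_neq_zero)

lemma sig_power: "\<sigma> (x ^ k) = \<sigma> x ^ k"
  by (induction k) (auto simp: sig_mult)

lemma sig_inverse: "\<sigma> (inverse x) = inverse (\<sigma> x)"
proof (cases "x = 0")
  case False
  then show ?thesis using sig_mult[of x "inverse x"] by (metis inverse_unique right_inverse sig_1)
qed simp

lemma sig_powi: "\<sigma> (x powi k) = \<sigma> x powi k"
  by (simp add: power_int_def sig_power sig_inverse)

end

text \<open>This interface replaces \<open>W\<close> and the residue field in the later arguments.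
  Modulo the maximal ideal, \<open>\<sigma>\<close> is the \<open>q\<close>-th power map, so the
  sums in \<open>solv\<close> and \<open>solv_0\<close> become \<open>q\<close>-polynomials over an
  algebraically closed field. One unit coefficient makes such a polynomial surjective, and two give
  it a nonzero root.\<close>

locale frob_dvr = valued val + field_auto \<sigma> for val :: "'l::field \<Rightarrow> int" and \<sigma> :: "'l \<Rightarrow> 'l" +
  assumes val_sig: "x \<noteq> 0 \<Longrightarrow> val (\<sigma> x) = val x"
    and complete_sum: "(\<And>k. vge val (int k) (xs k)) \<Longrightarrow>
      \<exists>X. \<forall>k. vge val (int k) (X - (\<Sum>i<k. xs i))"
    and solv: "(\<And>i. i \<le> d \<Longrightarrow> vge val 0 (u i)) \<Longrightarrow> j \<le> d \<Longrightarrow> \<not> vge val 1 (u j) \<Longrightarrow> vge val 0 c \<Longrightarrow>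
      \<exists>y. vge val 0 y \<and> vge val 1 ((\<Sum>i\<le>d. u i * (\<sigma> ^^ i) y) - c)"
    and solv_0: "(\<And>i. i \<le> d \<Longrightarrow> vge val 0 (u i)) \<Longrightarrow> i0 < j \<Longrightarrow> j \<le> d \<Longrightarrow> \<not> vge val 1 (u i0) \<Longrightarrow>
      \<not> vge val 1 (u j) \<Longrightarrow>
      \<exists>y. vge val 0 y \<and> \<not> vge val 1 y \<and> vge val 1 (\<Sum>i\<le>d. u i * (\<sigma> ^^ i) y)"

context valued
begin

lemma ge_1_factor: "ge 1 (x * y) \<Longrightarrow> ge 0 x \<Longrightarrow> ge 0 y \<Longrightarrow> ge 1 x \<or> ge 1 y"
  by (cases "x = 0 \<or> y = 0") (auto simp: vge_def val_mult)

end

section \<open>The ring \<open>W\<close> and its fraction field\<close>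

context witt_ring
begin

lemma W_0: "0 \<in> W" and W_1: "1 \<in> W" and W_diff: "x \<in> W \<Longrightarrow> y \<in> W \<Longrightarrow> x - y \<in> W"
  and W_mult: "x \<in> W \<Longrightarrow> y \<in> W \<Longrightarrow> x * y \<in> W"
  using subring by (auto simp: subring_of_def)

lemma W_uminus: "x \<in> W \<Longrightarrow> - x \<in> W"
  using W_diff[OF W_0] by simp

lemma W_add: "x \<in> W \<Longrightarrow> y \<in> W \<Longrightarrow> x + y \<in> W"
  using W_diff[of x "- y"] W_uminus by simp

lemma W_sum: "(\<And>i. i \<in> I \<Longrightarrow> f i \<in> W) \<Longrightarrow> sum f I \<in> W"
  by (induction I rule: infinite_finite_induct) (auto simp: W_0 W_add)

lemma W_power: "x \<in> W \<Longrightarrow> x ^ k \<in> W"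
  by (induction k) (auto simp: W_1 W_mult)

lemma W_of_nat: "of_nat k \<in> W"
  by (induction k) (auto simp: W_0 W_1 W_add)

lemmas W_closed = W_0 W_1 W_diff W_mult W_uminus W_add W_sum W_power W_of_nat

lemma red_0: "red 0 = 0"
  using red_add[OF W_0 W_0] by (metis add_0 add_cancel_right_right)

lemma red_sum: "(\<And>i. i \<in> I \<Longrightarrow> f i \<in> W) \<Longrightarrow> red (sum f I) = (\<Sum>i\<in>I. red (f i))"
  by (induction I rule: infinite_finite_induct) (auto simp: red_0 red_add W_sum)

lemma red_power: "x \<in> W \<Longrightarrow> red (x ^ k) = red x ^ k"
  by (induction k) (auto simp: red_1 red_mult W_power)

lemma red_lift: "\<exists>w\<in>W. red w = a"
  using red_surj by (metis UNIV_I imageE)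

lemma fractions_subfield: "subfield_of (fractions W)"
  unfolding subfield_of_def subring_of_def
proof (intro conjI ballI)
  show "0 \<in> fractions W" unfolding fractions_def
    by (rule CollectI, rule exI[of _ 0], rule exI[of _ 1]) (simp add: W_0 W_1)
  show "1 \<in> fractions W" unfolding fractions_def
    by (rule CollectI, rule exI[of _ 1], rule exI[of _ 1]) (simp add: W_1)
next
  fix x y assume "x \<in> fractions W" "y \<in> fractions W"
  then obtain a b c d where *: "x = a / b" "y = c / d" "a \<in> W" "b \<in> W" "c \<in> W" "d \<in> W" "b \<noteq> 0" "d \<noteq> 0"
    by (auto simp: fractions_def)
  then have "x - y = (a * d - c * b) / (b * d)" "x * y = (a * c) / (b * d)" by (auto simp: field_simps)
  moreover have "a * d - c * b \<in> W" "a * c \<in> W" "b * d \<in> W" "b * d \<noteq> 0" using * by (auto simp: W_diff W_mult)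
  ultimately show "x - y \<in> fractions W" "x * y \<in> fractions W" unfolding fractions_def by blast+
next
  fix x assume "x \<in> fractions W"
  then obtain a b where *: "x = a / b" "a \<in> W" "b \<in> W" "b \<noteq> 0" by (auto simp: fractions_def)
  show "inverse x \<in> fractions W"
  proof (cases "a = 0")
    case True
    then show ?thesis using * W_0 W_1 by (auto simp: fractions_def)
  next
    case False
    then have "inverse x = b / a" using * by simp
    then show ?thesis unfolding fractions_def using * False by blast
  qed
qed

lemma W_fractions: "W \<subseteq> fractions W"
proof
  fix w assume "w \<in> W"
  then show "w \<in> fractions W" unfolding fractions_def
    by (intro CollectI exI[of _ w] exI[of _ 1]) (simp add: W_1)
qed

lemma W_series:
  assumes "\<And>m. c m \<in> W"
  shows "\<exists>C\<in>W. \<forall>M. \<exists>w\<in>W. C - (\<Sum>m<M. (of_nat CHAR('k) :: 'l) ^ m * c m) = (of_nat CHAR('k) :: 'l) ^ M * w"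
  using complete[of "\<lambda>M. \<Sum>m<M. (of_nat CHAR('k) :: 'l) ^ m * c m"] assms
  by (auto simp: pcong_def intro!: W_closed)

end

section \<open>The field \<open>L\<close> is finite over \<open>fractions W\<close> and has the same
  residue field\<close>

context frobenius_field
begin

sublocale valued val
  by unfold_locales (rule normalized)

sublocale field_auto \<sigma>
  using sigma_bij sigma_add sigma_mult by unfold_locales auto

lemma W_ge: "x \<in> W \<Longrightarrow> ge 0 x"
  using val_ring by (auto simp: val_ring_eq)

lemma fractions_ge: "x \<in> fractions W \<Longrightarrow> ge 0 x \<Longrightarrow> x \<in> W"
  using val_ring by (auto simp: val_ring_eq)

lemma pp_nz: "(of_nat CHAR('k) :: 'l) \<noteq> 0"
  using CHAR_pos by (simp add: of_nat_eq_0_iff)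

lemma red_pp: "red (of_nat CHAR('k) :: 'l) = 0"
  using W_1 by (subst red_kernel) (auto simp: W_of_nat pcong_def)

text \<open>Otherwise \<open>1 / p\<close> would be integral and in \<open>fractions W\<close>,
  hence in \<open>W\<close>, and \<open>red 1\<close> would vanish.\<close>

lemma val_pp: "val (of_nat CHAR('k) :: 'l) > 0"
proof (rule ccontr)
  assume "\<not> ?thesis"
  then have "ge 0 (inverse (of_nat CHAR('k) :: 'l))" using pp_nz by (auto simp: vge_def val_inverse)
  moreover have "inverse (of_nat CHAR('k) :: 'l) \<in> fractions W"
    using W_fractions W_of_nat fractions_subfield by (blast intro: subfield_ofD)
  ultimately have "inverse (of_nat CHAR('k) :: 'l) \<in> W" by (intro fractions_ge)
  then have "red ((of_nat CHAR('k) :: 'l) * inverse (of_nat CHAR('k) :: 'l)) = 0" by (subst red_mult) (auto simp: W_of_nat red_pp)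
  then show False using pp_nz by (simp add: red_1)
qed

lemma ge_pp: "ge 1 (of_nat CHAR('k) :: 'l)"
  using val_pp by (simp add: vge_def)

text \<open>For the converse direction, an element of \<open>W\<close> with nonzero reduction is
  invertible modulo \<open>p\<close>, and \<open>p\<close> lies in the maximal ideal; so the element
  does not.\<close>

lemma red_eq_0_iff: "w \<in> W \<Longrightarrow> red w = 0 \<longleftrightarrow> ge 1 w"
proof
  assume "w \<in> W" "red w = 0"
  then obtain v where "v \<in> W" "w = (of_nat CHAR('k) :: 'l) * v" by (auto simp: red_kernel pcong_def)
  then show "ge 1 w" using ge_mult[OF ge_pp W_ge] by simp
next
  assume w: "w \<in> W" "ge 1 w"
  show "red w = 0"
  proof (rule ccontr)
    assume nz: "red w \<noteq> 0"
    obtain v where v: "v \<in> W" "red v = inverse (red w)" using red_lift by blast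
    have "red (w * v - 1) = red (w * v) + red (- 1)"
      using red_add[of "w * v" "-1"] w v by (simp add: W_closed)
    also have "red (- 1) = - 1" using red_add[of 1 "- 1"] by (simp add: W_closed red_1 red_0 add_eq_0_iff)
    finally have "red (w * v - 1) = 0" using v w nz by (simp add: red_mult)
    moreover have wv: "w * v - 1 \<in> W" using w v by (simp add: W_closed)
    ultimately obtain z where "z \<in> W" "w * v - 1 = (of_nat CHAR('k) :: 'l) * z" by (auto simp: red_kernel pcong_def)
    then have "ge 1 (w * v - 1)" using ge_mult[OF ge_pp W_ge] by simp
    moreover have "ge 1 (w * v)" using w(2) W_ge[OF v(1)] ge_mult[of 1 w 0 v] by simp
    ultimately have "ge 1 1" using ge_diff[of 1 "w * v" "w * v - 1"] by simp
    then show False by (simp add: vge_def)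
  qed
qed

text \<open>The \<open>fractions W\<close>-span of a finite generating set of \<open>F\<close> is
  closed under products, because \<open>F\<close> is. It is a field because its elements are
  algebraic over \<open>fractions W\<close>, so \<open>compositum\<close> makes it
  everything.\<close>

lemma spanned:
  obtains B where "finite B" "\<And>x. \<exists>c. c ` B \<subseteq> fractions W \<and> x = (\<Sum>b\<in>B. c b * b)"
proof -
  let ?K = "fractions W"
  note K = subfield_ofD[OF fractions_subfield]
  from F_finite obtain B where F: "subfield_of F" and QF: "padic_field CHAR('k) W \<subseteq> F" and B: "finite B" "B \<subseteq> F"
    and spF: "\<And>x. x \<in> F \<Longrightarrow> \<exists>c. c ` B \<subseteq> padic_field CHAR('k) W \<and> x = (\<Sum>b\<in>B. c b * b)"
    unfolding finite_extension_def by blast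
  have QK: "padic_field CHAR('k) W \<subseteq> ?K" by (auto simp: padic_field_def)
  define S where "S = {(\<Sum>b\<in>B. c b * b) | c. c ` B \<subseteq> ?K}"
  have FS: "F \<subseteq> S" using spF QK unfolding S_def by blast
  have S_scale: "k * x \<in> S" if kx: "k \<in> ?K" "x \<in> S" for k x
  proof -
    from kx obtain c where "x = (\<Sum>b\<in>B. c b * b)" "c ` B \<subseteq> ?K" unfolding S_def by blast
    then show ?thesis unfolding S_def using kx K
      by (intro CollectI exI[of _ "\<lambda>b. k * c b"]) (auto simp: sum_distrib_left mult.assoc)
  qed
  have S_add: "x + y \<in> S" if xy: "x \<in> S" "y \<in> S" for x y
  proof -
    from xy obtain c d where "x = (\<Sum>b\<in>B. c b * b)" "c ` B \<subseteq> ?K" "y = (\<Sum>b\<in>B. d b * b)" "d ` B \<subseteq> ?K"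
      unfolding S_def by blast
    then show ?thesis unfolding S_def using K
      by (intro CollectI exI[of _ "\<lambda>b. c b + d b"]) (auto simp: sum.distrib distrib_right image_subset_iff)
  qed
  have KS: "?K \<subseteq> S" using S_scale[of _ 1] FS subfield_ofD(2)[OF F] by auto
  then have S_0: "0 \<in> S" and S_1: "1 \<in> S" using K by auto
  have S_sum': "sum f I \<in> S" if "\<And>i. i \<in> I \<Longrightarrow> f i \<in> S" for f and I :: "nat set"
    using that by (induction I rule: infinite_finite_induct) (auto simp: S_0 S_add)
  have S_sumB: "sum f I \<in> S" if "\<And>i. i \<in> I \<Longrightarrow> f i \<in> S" for f and I :: "'l set"
    using that by (induction I rule: infinite_finite_induct) (auto simp: S_0 S_add)
  have S_mult: "x * y \<in> S" if xy: "x \<in> S" "y \<in> S" for x y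
  proof -
    from xy obtain c d where *: "x = (\<Sum>b\<in>B. c b * b)" "c ` B \<subseteq> ?K" "y = (\<Sum>b\<in>B. d b * b)" "d ` B \<subseteq> ?K"
      unfolding S_def by blast
    then have "x * y = (\<Sum>b\<in>B. \<Sum>b'\<in>B. c b * (d b' * (b * b')))"
      by (simp add: sum_product algebra_simps)
    moreover have "b * b' \<in> S" if "b \<in> B" "b' \<in> B" for b b'
      using that B(2) FS subfield_ofD(4)[OF F] by blast
    ultimately show ?thesis using *(2,4) by (auto intro!: S_sumB S_scale[OF _ S_scale])
  qed
  have S_power: "x ^ k \<in> S" if "x \<in> S" for x k
    using that by (induction k) (auto simp: S_1 S_mult)
  have S_inv: "inverse x \<in> S" if x: "x \<in> S" for x
  proof (cases "x = 0")
    case False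
    let ?m = "card B"
    have "\<forall>k. \<exists>c. c ` B \<subseteq> ?K \<and> x ^ k = (\<Sum>b\<in>B. c b * b)" using S_power[OF x] unfolding S_def by blast
    from choice[OF this] obtain a where a: "\<And>k. a k ` B \<subseteq> ?K" "\<And>k. x ^ k = (\<Sum>b\<in>B. a k b * b)" by blast
    obtain c where c: "c ` {..?m} \<subseteq> ?K" "\<exists>i\<le>?m. c i \<noteq> 0" "\<forall>b\<in>B. (\<Sum>i\<le>?m. c i * a i b) = 0"
      using homogeneous_system[OF fractions_subfield B(1), of "{..?m}" a] a(1) by (auto simp: image_subset_iff)
    have "(\<Sum>k\<le>?m. c k * x ^ k) = (\<Sum>b\<in>B. (\<Sum>k\<le>?m. c k * a k b) * b)"
      unfolding a(2) sum_distrib_left sum_distrib_right by (subst sum.swap) (simp add: mult.assoc)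
    then have rel: "(\<Sum>k\<le>?m. c k * x ^ k) = 0" using c(3) by simp
    \<comment> \<open>Dividing the relation by \<open>x ^ k0\<close> leaves a nonzero constant term,
      which expresses \<open>inverse x\<close> as a polynomial in \<open>x\<close>.\<close>
    define k0 where "k0 = (LEAST k. c k \<noteq> 0)"
    obtain i where i: "i \<le> ?m" "c i \<noteq> 0" using c(2) by blast
    have k0: "c k0 \<noteq> 0" unfolding k0_def by (rule LeastI[of "\<lambda>k. c k \<noteq> 0", OF i(2)])
    have k0_le: "k0 \<le> ?m"
      using Least_le[of "\<lambda>k. c k \<noteq> 0", OF i(2)] i(1) unfolding k0_def by linarith
    have k0_least: "c k = 0" if "k < k0" for k
      using not_less_Least[of k "\<lambda>k. c k \<noteq> 0"] that unfolding k0_def by blast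
    have "(\<Sum>k\<le>?m. c k * x ^ k) = (\<Sum>k\<in>{k0..?m}. c k * x ^ k)"
      using k0_le k0_least by (intro sum.mono_neutral_right) auto
    also have "\<dots> = c k0 * x ^ k0 + (\<Sum>k\<in>{Suc k0..?m}. c k * x ^ k)"
      using k0_le by (simp add: sum.atLeast_Suc_atMost)
    also have "(\<Sum>k\<in>{Suc k0..?m}. c k * x ^ k) = x ^ k0 * (x * (\<Sum>k\<in>{Suc k0..?m}. c k * x ^ (k - Suc k0)))"
      unfolding sum_distrib_left
    proof (intro sum.cong refl)
      fix k assume "k \<in> {Suc k0..?m}"
      then have "x ^ k = x ^ k0 * (x * x ^ (k - Suc k0))"
        by (simp flip: power_add power_Suc)
      then show "c k * x ^ k = x ^ k0 * (x * (c k * x ^ (k - Suc k0)))" by simp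
    qed
    finally have "x ^ k0 * (c k0 + x * (\<Sum>k\<in>{Suc k0..?m}. c k * x ^ (k - Suc k0))) = 0"
      using rel by (simp add: algebra_simps)
    then have "c k0 = - (x * (\<Sum>k\<in>{Suc k0..?m}. c k * x ^ (k - Suc k0)))"
      using False by (simp add: add_eq_0_iff2)
    then have "inverse x = (- inverse (c k0)) * (\<Sum>k\<in>{Suc k0..?m}. c k * x ^ (k - Suc k0))"
      using False k0 by (simp add: field_simps)
    moreover have "(\<Sum>k\<in>{Suc k0..?m}. c k * x ^ (k - Suc k0)) \<in> S"
      using c(1) by (auto intro!: S_scale S_sum' S_power x)
    moreover have "- inverse (c k0) \<in> ?K" using c(1) k0_le K(5,7) by auto
    ultimately show ?thesis by (simp only: S_scale)
  qed (simp add: S_0)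
  have "x - y \<in> S" if "x \<in> S" "y \<in> S" for x y
    using S_add[of x "- 1 * y"] S_scale[of "- 1" y] that K(5)[OF K(2)] by simp
  then have "subfield_of S"
    unfolding subfield_of_def subring_of_def using S_0 S_1 S_mult S_inv by blast
  then have "S = UNIV" using compositum KS FS by blast
  then have "\<exists>c. c ` B \<subseteq> fractions W \<and> x = (\<Sum>b\<in>B. c b * b)" for x unfolding S_def by blast
  then show thesis using that B by blast
qed

text \<open>Division by a coefficient of least valuation makes an algebraic relation primitive, so
  that its reduction is a nonzero polynomial.\<close>

lemma algebraic_over_W:
  obtains m c where "c ` {..m} \<subseteq> W" "\<exists>i\<le>m. \<not> ge 1 (c i)" "(\<Sum>k\<le>m. c k * x ^ k) = 0"
proof -
  let ?K = "fractions W"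
  obtain B where B: "finite B" "\<And>x. \<exists>c. c ` B \<subseteq> ?K \<and> x = (\<Sum>b\<in>B. c b * b)" using spanned by metis
  let ?m = "card B"
  have "\<forall>k. \<exists>c. c ` B \<subseteq> ?K \<and> x ^ k = (\<Sum>b\<in>B. c b * b)" using B(2) by blast
  from choice[OF this] obtain a where a: "\<And>k. a k ` B \<subseteq> ?K" "\<And>k. x ^ k = (\<Sum>b\<in>B. a k b * b)" by blast
  obtain c where c: "c ` {..?m} \<subseteq> ?K" "\<exists>i\<le>?m. c i \<noteq> 0" "\<forall>b\<in>B. (\<Sum>i\<le>?m. c i * a i b) = 0"
    using homogeneous_system[OF fractions_subfield B(1), of "{..?m}" a] a(1) by (auto simp: image_subset_iff)
  have "(\<Sum>k\<le>?m. c k * x ^ k) = (\<Sum>b\<in>B. (\<Sum>k\<le>?m. c k * a k b) * b)"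
    unfolding a(2) sum_distrib_left sum_distrib_right by (subst sum.swap) (simp add: mult.assoc)
  then have rel: "(\<Sum>k\<le>?m. c k * x ^ k) = 0" using c(3) by simp
  define I where "I = {i. i \<le> ?m \<and> c i \<noteq> 0}"
  have I: "finite I" "I \<noteq> {}" using c(2) by (auto simp: I_def)
  define i0 where "i0 = arg_min_on (\<lambda>i. val (c i)) I"
  have i0: "i0 \<in> I" and min: "\<And>i. i \<in> I \<Longrightarrow> val (c i0) \<le> val (c i)"
    using arg_min_if_finite[OF I, of "\<lambda>i. val (c i)"] by (auto simp: i0_def not_less)
  have "c i / c i0 \<in> W" if "i \<le> ?m" for i
  proof (rule fractions_ge)
    show "c i / c i0 \<in> fractions W" using c(1) that i0
      by (intro subfield_ofD(8)[OF fractions_subfield]) (auto simp: I_def)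
    show "ge 0 (c i / c i0)" using min[of i] that i0 by (cases "c i = 0") (auto simp: vge_def val_divide I_def)
  qed
  moreover have "\<not> ge 1 (c i0 / c i0)" using i0 by (simp add: vge_def I_def)
  moreover have "(\<Sum>k\<le>?m. c k / c i0 * x ^ k) = (\<Sum>k\<le>?m. c k * x ^ k) / c i0" by (simp add: sum_divide_distrib)
  ultimately show thesis using i0 rel
    by (intro that[of "\<lambda>i. c i / c i0" ?m]) (auto simp: I_def simp del: times_divide_eq_left)
qed

lemma ge_1_cong: "ge 1 (x - y) \<Longrightarrow> ge 1 x \<longleftrightarrow> ge 1 y"
  using ge_cancel[of 1 x y] ge_diff[of 1 x "x - y"] by auto

text \<open>A polynomial with root \<open>x\<close> modulo the maximal ideal splits over the residue field of \<open>W\<close>;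
  dividing off one linear factor after the other, one of them must vanish at \<open>x\<close>.\<close>

lemma residue_W:
  assumes x: "ge 0 x"
  shows "\<exists>w\<in>W. ge 1 (x - w)"
proof -
  have *: "\<exists>w\<in>W. ge 1 (x - w)"
    if "c ` {..n} \<subseteq> W" "\<exists>i\<le>n. \<not> ge 1 (c i)" "ge 1 (\<Sum>k\<le>n. c k * x ^ k)" for n c
    using that
  proof (induction n arbitrary: c)
    case 0
    then show ?case by auto
  next
    case (Suc n)
    have cW: "c k \<in> W" if "k \<le> Suc n" for k using Suc.prems(1) that by auto
    show ?case
    proof (cases "ge 1 (c (Suc n))")
      case True
      then have "ge 1 (c (Suc n) * x ^ Suc n)" using ge_mult[of 1 _ 0] ge_power[OF x, of "Suc n"] by simp
      then have "ge 1 (\<Sum>k\<le>n. c k * x ^ k)" using Suc.prems(3) ge_diff by fastforce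
      moreover have "\<exists>i\<le>n. \<not> ge 1 (c i)" using Suc.prems(2) True by (metis le_Suc_eq)
      ultimately show ?thesis using cW by (intro Suc.IH[of c]) auto
    next
      case False
      then have "red (c (Suc n)) \<noteq> 0" using red_eq_0_iff cW by blast
      then obtain a where a: "(\<Sum>k\<le>Suc n. red (c k) * a ^ k) = 0" using alg_closed[of "Suc n" "\<lambda>k. red (c k)"] by auto
      obtain w where w: "w \<in> W" "red w = a" using red_lift by blast
      have "red (\<Sum>k\<le>Suc n. c k * w ^ k) = (\<Sum>k\<le>Suc n. red (c k) * a ^ k)"
        using w cW by (subst red_sum) (auto simp: W_closed red_mult red_power)
      then have cw: "ge 1 (\<Sum>k\<le>Suc n. c k * w ^ k)"
        using red_eq_0_iff[of "\<Sum>k\<le>Suc n. c k * w ^ k"] a cW w(1)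
        by (auto intro!: W_closed simp del: sum.atMost_Suc)
      \<comment> \<open>Coefficients of the quotient by the linear factor at \<open>w\<close>. The
        top one, \<open>d n\<close>, equals \<open>c (Suc n)\<close>, so the quotient again has a
        unit coefficient.\<close>
      define d where "d j = (\<Sum>k=Suc j..Suc n. c k * w ^ (k - j - 1))" for j
      have "(\<Sum>k\<le>Suc n. c k * x ^ k) - (\<Sum>k\<le>Suc n. c k * w ^ k) = (x - w) * (\<Sum>j<Suc n. d j * x ^ j)"
        unfolding d_def by (rule polyfun_diff) simp
      then have "ge 1 ((x - w) * (\<Sum>j\<le>n. d j * x ^ j))"
        using ge_diff[OF Suc.prems(3) cw] by (simp add: lessThan_Suc_atMost)
      moreover have dW: "d j \<in> W" if "j \<le> n" for j unfolding d_def using cW w by (auto intro!: W_closed)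
      moreover have "ge 0 (\<Sum>j\<le>n. d j * x ^ j)"
        using dW W_ge by (auto intro!: ge_sum ge_mult'[of 0 _ 0] ge_power x)
      moreover have "ge 0 (x - w)" using x w W_ge by (simp add: ge_diff)
      ultimately have "ge 1 (x - w) \<or> ge 1 (\<Sum>j\<le>n. d j * x ^ j)"
        by (intro ge_1_factor)
      then show ?thesis
      proof
        assume "ge 1 (\<Sum>j\<le>n. d j * x ^ j)"
        moreover have "\<not> ge 1 (d n)" using False by (simp add: d_def)
        ultimately show ?thesis using dW by (intro Suc.IH[of d]) auto
      qed (use w in blast)
    qed
  qed
  obtain m c where "c ` {..m} \<subseteq> W" "\<exists>i\<le>m. \<not> ge 1 (c i)" "(\<Sum>k\<le>m. c k * x ^ k) = 0"
    by (rule algebraic_over_W)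
  then show ?thesis using *[of c m] by simp
qed

end

section \<open>The Frobenius modulo the maximal ideal, and completeness of \<open>L\<close>\<close>

context frobenius_field
begin

definition "q = residue_card val F"

lemma frob: "ge 0 x \<Longrightarrow> ge 1 (\<sigma> x - x ^ q)"
  using sigma_frob[of x] by (simp add: q_def val_ring_eq max_ideal_eq)

lemma not_ge_1_1: "\<not> ge 1 1"
  by (simp add: vge_def)

text \<open>\<open>card\<close> gives 0 for an infinite set. This is excluded by the Frobenius
  congruence at 0, because \<open>0 ^ 0 = 1\<close>. The value 1 would identify 0 and 1 in the
  residue field of \<open>F\<close>.\<close>

lemma q_ge_2: "q \<ge> 2"
proof -
  have "q \<noteq> 0"
  proof
    assume "q = 0"
    then show False using frob[of 0] not_ge_1_1 by (simp add: sig_0)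
  qed
  moreover have "q \<noteq> 1"
  proof
    let ?r = "{(x, y). x \<in> F \<inter> val_ring val \<and> y \<in> F \<inter> val_ring val \<and> x - y \<in> max_ideal val}"
    assume "q = 1"
    then obtain C where C: "(F \<inter> val_ring val) // ?r = {C}"
      unfolding q_def residue_card_def by (rule card_1_singletonE)
    have "subfield_of F" using F_finite by (simp add: finite_extension_def)
    then have *: "0 \<in> F \<inter> val_ring val" "1 \<in> F \<inter> val_ring val"
      using subfield_ofD(1,2) by (auto simp: val_ring_eq)
    from this have "?r `` {0} \<in> {C}" "?r `` {1} \<in> {C}"
      using C by (metis (no_types, lifting) quotientI)+
    moreover have "1 \<in> ?r `` {1}" using *(2) by (simp add: max_ideal_eq)
    ultimately have "1 \<in> ?r `` {0}" by simp
    then have "ge 1 (0 - 1)" by (simp add: max_ideal_eq)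
    then show False by (simp add: vge_def)
  qed
  ultimately show ?thesis by linarith
qed

lemma ge_1_power: "ge 1 x \<Longrightarrow> k > 0 \<Longrightarrow> ge 1 (x ^ k)"
  by (cases "x = 0") (auto simp: vge_def val_power zero_power mult_le_cancel_left1
      intro: order_trans[of 1 "val x"])

text \<open>The congruence with the \<open>q\<close>-th power shows that units go to units, so
  \<open>\<sigma>\<close> multiplies all valuations by \<open>val (\<sigma> \<pi>)\<close>. This
  factor is positive, and it is 1 because \<open>\<pi>\<close> itself has a preimage.\<close>

lemma val_frob: assumes "x \<noteq> 0" shows "val (\<sigma> x) = val x"
proof -
  have unit: "val (\<sigma> x) = 0" if "x \<noteq> 0" "val x = 0" for x
  proof -
    have x: "ge 0 x" "ge 0 (x ^ q)" "\<not> ge 1 (x ^ q)" using that by (auto simp: vge_def val_power)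
    have "ge 1 (\<sigma> x) \<longleftrightarrow> ge 1 (x ^ q)" by (rule ge_1_cong[OF frob[OF x(1)]])
    moreover have "ge 0 (\<sigma> x)" using ge_mono[OF frob[OF x(1)], of 0] x(2) by (auto intro: ge_cancel)
    ultimately show ?thesis using x(3) that by (auto simp: vge_def)
  qed
  obtain \<pi> where \<pi>: "\<pi> \<noteq> 0" "val \<pi> = 1" using ex_uniformizer by blast
  have gen: "val (\<sigma> x) = val x * val (\<sigma> \<pi>)" if "x \<noteq> 0" for x
  proof -
    let ?u = "x * \<pi> powi (- val x)"
    have u: "?u \<noteq> 0" "val ?u = 0" using that \<pi> by (auto simp: val_mult val_powi)
    have "x = ?u * \<pi> powi (val x)" using \<pi>(1) by (simp add: power_int_minus)
    then have "\<sigma> x = \<sigma> ?u * \<sigma> \<pi> powi (val x)" by (metis sig_powi sig_mult)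
    then show ?thesis using unit[OF u] u \<pi>(1) by (simp add: val_mult val_powi)
  qed
  have "ge 1 (\<sigma> \<pi>)"
    using ge_1_cong[OF frob[of \<pi>]] ge_1_power[of \<pi> q] q_ge_2 \<pi> by (auto simp: vge_def)
  then have pos: "val (\<sigma> \<pi>) > 0" using \<pi>(1) by (simp add: vge_def)
  obtain y where y: "\<sigma> y = \<pi>" using sig_bij by (metis bij_pointE)
  then have "y \<noteq> 0" using \<pi>(1) sig_0 by auto
  then have "val y * val (\<sigma> \<pi>) = 1" using gen[of y] y \<pi>(2) by simp
  then have "val (\<sigma> \<pi>) = 1" using pos by (simp add: zmult_eq_1_iff)
  then show ?thesis using gen[OF assms] by simp
qed

lemma ge_frob: "ge t x \<Longrightarrow> ge t (\<sigma> x)"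
  by (cases "x = 0") (auto simp: vge_def val_frob)

lemma frob_iter: "ge 0 y \<Longrightarrow> ge 1 ((\<sigma> ^^ i) y - y ^ (q ^ i))"
proof (induction i)
  case (Suc i)
  let ?a = "(\<sigma> ^^ i) y" and ?b = "y ^ (q ^ i)"
  have b: "ge 0 ?b" using Suc.prems ge_power by blast
  have "ge 1 (\<sigma> (?a - ?b))" using Suc ge_frob by blast
  moreover have "ge 1 (\<sigma> ?b - ?b ^ q)" using frob[OF b] .
  ultimately have "ge 1 (\<sigma> (?a - ?b) + (\<sigma> ?b - ?b ^ q))" by (rule ge_add)
  then show ?case by (simp add: sig_diff power_mult[symmetric] mult.commute)
qed simp

text \<open>The coefficients are replaced by representatives in \<open>W\<close>, available by
  \<open>residue_W\<close>, and \<open>\<sigma> ^^ i\<close> by the power \<open>q ^ i\<close>;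
  neither changes the value modulo the maximal ideal.\<close>

lemma reduce_operator:
  fixes u :: "nat \<Rightarrow> 'l"
  assumes u: "\<And>i. i \<le> d \<Longrightarrow> ge 0 (u i)"
  shows "\<exists>a :: nat \<Rightarrow> 'k. (\<forall>i\<le>d. a i = 0 \<longleftrightarrow> ge 1 (u i)) \<and> (\<forall>y\<in>W. \<forall>w\<in>W.
      ge 1 ((\<Sum>i\<le>d. u i * (\<sigma> ^^ i) y) - w) \<longleftrightarrow> (\<Sum>i\<le>d. a i * red y ^ (q ^ i)) = red w)"
proof -
  have "\<forall>i\<in>{..d}. \<exists>w. w \<in> W \<and> ge 1 (u i - w)" using residue_W[OF u] by auto
  from bchoice[OF this] obtain v where v: "\<And>i. i \<le> d \<Longrightarrow> v i \<in> W" "\<And>i. i \<le> d \<Longrightarrow> ge 1 (u i - v i)" by auto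
  show ?thesis
  proof (intro exI[of _ "\<lambda>i. red (v i)"] conjI allI impI ballI)
    show "red (v i) = 0 \<longleftrightarrow> ge 1 (u i)" if "i \<le> d" for i
      using v[OF that] ge_1_cong red_eq_0_iff by blast
    fix y w assume y: "y \<in> W" and w: "w \<in> W"
    let ?z = "\<Sum>i\<le>d. v i * y ^ (q ^ i)"
    have zW: "?z \<in> W" using v(1) y by (auto intro!: W_closed)
    have "(\<Sum>i\<le>d. u i * (\<sigma> ^^ i) y) - w - (?z - w)
      = (\<Sum>i\<le>d. (u i - v i) * (\<sigma> ^^ i) y + v i * ((\<sigma> ^^ i) y - y ^ (q ^ i)))"
      by (simp add: sum.distrib[symmetric] sum_subtractf[symmetric] algebra_simps)
    moreover have "ge 0 ((\<sigma> ^^ i) y)" for i using W_ge[OF y] by (induction i) (auto simp: ge_frob)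
    ultimately have "ge 1 ((\<Sum>i\<le>d. u i * (\<sigma> ^^ i) y) - w - (?z - w))"
      using v W_ge[OF y] W_ge frob_iter[OF W_ge[OF y]]
      by (auto intro!: ge_sum ge_add intro: ge_mult'[of 1 _ 0] ge_mult'[of 0 _ 1])
    then have "ge 1 ((\<Sum>i\<le>d. u i * (\<sigma> ^^ i) y) - w) \<longleftrightarrow> ge 1 (?z - w)" by (rule ge_1_cong)
    also have "\<dots> \<longleftrightarrow> red (?z - w) = 0" using zW w red_eq_0_iff W_diff by blast
    also have "red (?z - w) = red ?z - red w"
      using red_add[of "?z - w" w] zW w by (simp add: W_closed)
    also have "red ?z = (\<Sum>i\<le>d. red (v i) * red y ^ (q ^ i))"
      using v(1) y by (subst red_sum) (auto simp: W_closed red_mult red_power)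
    finally show "ge 1 ((\<Sum>i\<le>d. u i * (\<sigma> ^^ i) y) - w)
        \<longleftrightarrow> (\<Sum>i\<le>d. red (v i) * red y ^ (q ^ i)) = red w" by simp
  qed
qed

lemma q_power_inj: "q ^ i = q ^ j \<longleftrightarrow> i = j"
  using q_ge_2 by simp

text \<open>The unit \<open>u j\<close> contributes a nonzero coefficient in degree
  \<open>q ^ j\<close>, which is positive even for \<open>j = 0\<close>. Hence subtracting the
  constant \<open>red w\<close> leaves a polynomial of positive degree, and a root exists.\<close>

lemma solve:
  assumes u: "\<And>i. i \<le> d \<Longrightarrow> ge 0 (u i)" and j: "j \<le> d" "\<not> ge 1 (u j)" and c: "ge 0 c"
  shows "\<exists>y. ge 0 y \<and> ge 1 ((\<Sum>i\<le>d. u i * (\<sigma> ^^ i) y) - c)"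
proof -
  obtain a where a: "\<And>i. i \<le> d \<Longrightarrow> a i = 0 \<longleftrightarrow> ge 1 (u i)"
    and eq: "\<And>y w. y \<in> W \<Longrightarrow> w \<in> W \<Longrightarrow>
      ge 1 ((\<Sum>i\<le>d. u i * (\<sigma> ^^ i) y) - w) \<longleftrightarrow> (\<Sum>i\<le>d. a i * red y ^ (q ^ i)) = red w"
    using reduce_operator[of d u, OF u] by blast
  obtain w where w: "w \<in> W" "ge 1 (c - w)" using residue_W[OF c] by blast
  define P where "P = (\<Sum>i\<le>d. Polynomial.monom (a i) (q ^ i)) - [:red w:]"
  have "q ^ j \<noteq> 0" using q_ge_2 by simp
  then have "coeff [:red w:] (q ^ j) = 0" by (cases "q ^ j") auto
  then have "coeff P (q ^ j) = (\<Sum>i\<le>d. if i = j then a i else 0)"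
    by (simp add: P_def coeff_sum coeff_monom q_power_inj)
  then have "coeff P (q ^ j) \<noteq> 0" using j a by simp
  then have "q ^ j \<le> degree P" by (rule le_degree)
  then have "degree P > 0" using \<open>q ^ j \<noteq> 0\<close> by linarith
  then obtain \<alpha> where \<alpha>: "poly P \<alpha> = 0" using alg_closed_imp_poly_has_root by blast
  obtain y where y: "y \<in> W" "red y = \<alpha>" using red_lift by blast
  have "(\<Sum>i\<le>d. a i * red y ^ (q ^ i)) = red w" using \<alpha> y(2) by (simp add: P_def poly_sum poly_monom)
  then have "ge 1 ((\<Sum>i\<le>d. u i * (\<sigma> ^^ i) y) - w)" using eq y(1) w(1) by blast
  then have "ge 1 ((\<Sum>i\<le>d. u i * (\<sigma> ^^ i) y) - w - (c - w))" using w(2) by (rule ge_diff)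
  then show ?thesis using W_ge[OF y(1)] by (intro exI[of _ y]) simp
qed

text \<open>Dividing the \<open>q\<close>-polynomial by its lowest power leaves a nonzero constant
  term, so roots are nonzero. The second unit coefficient keeps the degree positive.\<close>

lemma solve_0:
  assumes u: "\<And>i. i \<le> d \<Longrightarrow> ge 0 (u i)" and j: "i0 < j" "j \<le> d" "\<not> ge 1 (u i0)" "\<not> ge 1 (u j)"
  shows "\<exists>y. ge 0 y \<and> \<not> ge 1 y \<and> ge 1 (\<Sum>i\<le>d. u i * (\<sigma> ^^ i) y)"
proof -
  obtain a where a: "\<And>i. i \<le> d \<Longrightarrow> a i = 0 \<longleftrightarrow> ge 1 (u i)"
    and eq: "\<And>y w. y \<in> W \<Longrightarrow> w \<in> W \<Longrightarrow>
      ge 1 ((\<Sum>i\<le>d. u i * (\<sigma> ^^ i) y) - w) \<longleftrightarrow> (\<Sum>i\<le>d. a i * red y ^ (q ^ i)) = red w"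
    using reduce_operator[of d u, OF u] by blast
  define l where "l = (LEAST i. a i \<noteq> 0)"
  have "a i0 \<noteq> 0" using a j by simp
  from LeastI[of "\<lambda>i. a i \<noteq> 0", OF this] Least_le[of "\<lambda>i. a i \<noteq> 0", OF this]
  have l: "a l \<noteq> 0" "l < j" using j(1) by (auto simp: l_def)
  have below: "a i = 0" if "i < l" for i using not_less_Least[of i "\<lambda>i. a i \<noteq> 0"] that by (auto simp: l_def)
  define P where "P = (\<Sum>i\<in>{l..d}. Polynomial.monom (a i) (q ^ i - q ^ l))"
  \<comment> \<open>The exponents of \<open>P\<close> are differences of natural numbers; this
    inequality prevents truncation, which could make them coincide.\<close>
  have le: "q ^ l \<le> q ^ i" if "l \<le> i" for i using that q_ge_2 by (simp add: power_increasing)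
  have eqd: "q ^ i - q ^ l = q ^ k - q ^ l \<longleftrightarrow> i = k" if "l \<le> i" "l \<le> k" for i k
    using le[OF that(1)] le[OF that(2)] q_power_inj[of i k] by linarith
  have coeffP: "coeff P (q ^ k - q ^ l) = a k" if "l \<le> k" "k \<le> d" for k
  proof -
    have "coeff P (q ^ k - q ^ l) = (\<Sum>i\<in>{l..d}. if i = k then a i else 0)"
      unfolding P_def coeff_sum coeff_monom using that eqd by (intro sum.cong) auto
    then show ?thesis using that by simp
  qed
  have "q ^ j - q ^ l > 0" using l(2) q_ge_2 by simp
  moreover have "coeff P (q ^ j - q ^ l) \<noteq> 0" using coeffP[of j] l j a by simp
  ultimately have "degree P > 0" using le_degree by fastforce
  then obtain \<alpha> where \<alpha>: "poly P \<alpha> = 0" using alg_closed_imp_poly_has_root by blast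
  have "coeff P 0 = a l" using coeffP[of l] l j by simp
  then have "\<alpha> \<noteq> 0" using \<alpha> l(1) by (metis poly_0_coeff_0)
  obtain y where y: "y \<in> W" "red y = \<alpha>" using red_lift by blast
  have "(\<Sum>i\<le>d. a i * red y ^ (q ^ i)) = (\<Sum>i\<in>{l..d}. a i * \<alpha> ^ (q ^ i))"
    using below by (intro sum.mono_neutral_cong_right) (auto simp: y)
  also have "\<dots> = \<alpha> ^ (q ^ l) * poly P \<alpha>"
    unfolding P_def poly_sum poly_monom sum_distrib_left
    by (intro sum.cong refl) (simp add: mult.left_commute flip: power_add, simp add: le)
  finally have "(\<Sum>i\<le>d. a i * red y ^ (q ^ i)) = red 0" using \<alpha> red_0 by simp
  then have "ge 1 (\<Sum>i\<le>d. u i * (\<sigma> ^^ i) y)" using eq[of y 0] y(1) W_0 by simp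
  moreover have "\<not> ge 1 y" using red_eq_0_iff y \<open>\<alpha> \<noteq> 0\<close> by blast
  ultimately show ?thesis using W_ge[OF y(1)] by blast
qed

lemma digits:
  assumes \<pi>: "\<pi> \<noteq> 0" "val \<pi> = 1" and "ge 0 y"
  shows "\<exists>c z. (\<forall>i. c i \<in> W) \<and> ge 0 z \<and> y = (\<Sum>i<j. c i * \<pi> ^ i) + \<pi> ^ j * z"
proof (induction j)
  case 0
  then show ?case using assms W_0 by (intro exI[of _ "\<lambda>_. 0"] exI[of _ y]) auto
next
  case (Suc j)
  then obtain c z where c: "\<And>i. c i \<in> W" "ge 0 z" "y = (\<Sum>i<j. c i * \<pi> ^ i) + \<pi> ^ j * z" by blast
  obtain w where w: "w \<in> W" "ge 1 (z - w)" using residue_W[OF c(2)] by blast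
  let ?z = "(z - w) / \<pi>"
  have z: "z = w + \<pi> * ?z" using \<pi> by simp
  have "ge 0 ?z" using w(2) \<pi> by (cases "z = w") (auto simp: vge_def val_divide)
  moreover have "(\<Sum>i<j. (c(j := w)) i * \<pi> ^ i) = (\<Sum>i<j. c i * \<pi> ^ i)" by (intro sum.cong) auto
  then have "y = (\<Sum>i<Suc j. (c(j := w)) i * \<pi> ^ i) + \<pi> ^ Suc j * ?z"
    using c(3) arg_cong[OF z, of "\<lambda>t. \<pi> ^ j * t"] by (simp add: distrib_left mult_ac)
  moreover have "\<forall>i. (c(j := w)) i \<in> W" using c w by auto
  ultimately show ?case by blast
qed

text \<open>With a uniformizer \<open>\<pi>\<close> and \<open>e = val p\<close>, the powers \<open>\<pi>\<^sup>i\<close> for \<open>i < e\<close> span the valuation ring over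
  \<open>W\<close> modulo \<open>p\<close>. Grouping the series into blocks of length \<open>e\<close> and expanding with carries turns it
  into \<open>e\<close> many \<open>p\<close>-adic series in \<open>W\<close>.\<close>

lemma complete_series:
  assumes xs: "\<And>k. ge (int k) (xs k)"
  shows "\<exists>X. \<forall>k. ge (int k) (X - (\<Sum>i<k. xs i))"
proof -
  obtain \<pi> where \<pi>: "\<pi> \<noteq> 0" "val \<pi> = 1" using ex_uniformizer by blast
  define p where "p = (of_nat CHAR('k) :: 'l)"
  define e where "e = nat (val p)"
  have e: "e > 0" "val p = int e" and p: "p \<noteq> 0" using val_pp pp_nz by (auto simp: e_def p_def)
  have pM: "ge (int (e * M)) (p ^ M * y)" if "ge 0 y" for M y
    using that p e by (cases "y = 0") (auto simp: vge_def val_mult val_power algebra_simps)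
  have "\<exists>c z. (\<forall>i. c i \<in> W) \<and> ge 0 z \<and> y = (\<Sum>i<e. c i * \<pi> ^ i) + p * z" if y: "ge 0 y" for y
  proof -
    obtain c z where c: "\<forall>i. c i \<in> W" "ge 0 z" "y = (\<Sum>i<e. c i * \<pi> ^ i) + \<pi> ^ e * z"
      using digits[OF \<pi> y] by blast
    have "ge 0 (\<pi> ^ e / p * z)"
      using \<pi> p e c(2) by (intro ge_mult'[of 0 _ 0]) (auto simp: vge_def val_divide val_power)
    then show ?thesis using c p by (intro exI[of _ c] exI[of _ "\<pi> ^ e / p * z"]) auto
  qed
  then obtain D R where D: "\<And>y i. ge 0 y \<Longrightarrow> D y i \<in> W" and R: "\<And>y. ge 0 y \<Longrightarrow> ge 0 (R y)"
    and DR: "\<And>y. ge 0 y \<Longrightarrow> y = (\<Sum>i<e. D y i * \<pi> ^ i) + p * R y" by metis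
  \<comment> \<open>A block of terms with index at least \<open>e * m\<close> is divisible by
    \<open>p ^ m\<close>, since \<open>val p = e\<close>.\<close>
  define z where "z m = (\<Sum>k\<in>{e * m..<e * m + e}. xs k) / p ^ m" for m
  have z: "ge 0 (z m)" for m
  proof -
    have "ge (int (e * m)) (\<Sum>k\<in>{e * m..<e * m + e}. xs k)"
      by (rule ge_sum) (metis xs ge_mono atLeastLessThan_iff of_nat_le_iff)
    then show ?thesis using p e
      by (cases "(\<Sum>k\<in>{e * m..<e * m + e}. xs k) = 0") (auto simp: z_def vge_def val_divide val_power mult.commute)
  qed
  \<comment> \<open>The \<open>m\<close>-th block together with the carry from its predecessor:
    \<open>D\<close> extracts the digits and \<open>R\<close> is the quotient by \<open>p\<close>
    that is carried on. Partial sums then differ from the digit sums \<open>S\<close> only by a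
    multiple of a power of \<open>p\<close>.\<close>
  define r where "r = rec_nat (z 0) (\<lambda>m y. z (Suc m) + R y)"
  have r_Suc: "r (Suc m) = z (Suc m) + R (r m)" and r_0: "r 0 = z 0" for m by (simp_all add: r_def)
  have r: "ge 0 (r m)" for m by (induction m) (auto simp: r_Suc r_0 z R ge_add)
  define S where "S M = (\<Sum>m<M. p ^ m * (\<Sum>i<e. D (r m) i * \<pi> ^ i))" for M
  have xs_blocks: "(\<Sum>k<e * M. xs k) = (\<Sum>m<M. p ^ m * z m)" for M
  proof (induction M)
    case (Suc M)
    have "{..<e * Suc M} = {..<e * M} \<union> {e * M..<e * M + e}" by auto
    then have "(\<Sum>k<e * Suc M. xs k) = (\<Sum>k<e * M. xs k) + (\<Sum>k\<in>{e * M..<e * M + e}. xs k)"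
      by (metis (no_types, lifting) sum.union_disjoint finite_lessThan finite_atLeastLessThan ivl_disj_int_one(2))
    then show ?case using Suc p by (simp add: z_def)
  qed simp
  have carry: "(\<Sum>m<Suc M. p ^ m * z m) = S M + p ^ M * r M" for M
  proof (induction M)
    case (Suc M)
    have "p ^ M * r M = p ^ M * (\<Sum>i<e. D (r M) i * \<pi> ^ i) + p ^ Suc M * R (r M)"
      using arg_cong[OF DR[OF r[of M]], of "\<lambda>t. p ^ M * t"] by (simp add: distrib_left mult_ac)
    then show ?case using Suc.IH by (simp add: S_def r_Suc algebra_simps)
  qed (simp add: S_def r_0)
  have "\<forall>i. \<exists>C. C \<in> W \<and> (\<forall>M. \<exists>w\<in>W. C - (\<Sum>m<M. p ^ m * D (r m) i) = p ^ M * w)"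
    using W_series[of "\<lambda>m. D (r m) _"] D r unfolding p_def by blast
  from choice[OF this] obtain C where C: "\<And>i M. \<exists>w\<in>W. C i - (\<Sum>m<M. p ^ m * D (r m) i) = p ^ M * w" by blast
  define X where "X = (\<Sum>i<e. C i * \<pi> ^ i)"
  have XS: "ge (int (e * M)) (X - S M)" for M
  proof -
    have "S M = (\<Sum>i<e. (\<Sum>m<M. p ^ m * D (r m) i) * \<pi> ^ i)"
      unfolding S_def sum_distrib_left sum_distrib_right by (subst sum.swap) (simp add: mult.assoc)
    then have *: "X - S M = (\<Sum>i<e. (C i - (\<Sum>m<M. p ^ m * D (r m) i)) * \<pi> ^ i)"
      by (simp add: X_def sum_subtractf[symmetric] left_diff_distrib)
    show ?thesis unfolding *
    proof (rule ge_sum)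
      fix i
      obtain w where "w \<in> W" "C i - (\<Sum>m<M. p ^ m * D (r m) i) = p ^ M * w" using C by blast
      moreover have "ge 0 (\<pi> ^ i)" using \<pi> by (simp add: vge_def val_power)
      ultimately show "ge (int (e * M)) ((C i - (\<Sum>m<M. p ^ m * D (r m) i)) * \<pi> ^ i)"
        using pM[of w M] W_ge ge_mult'[of "int (e * M)" "p ^ M * w" 0 "\<pi> ^ i"] by simp
    qed
  qed
  have "ge (int k) (X - (\<Sum>i<k. xs i))" for k
  proof -
    have le: "k \<le> e * k" using mult_le_mono1[of 1 e k] e(1) by simp
    have leS: "k \<le> e * Suc k" using le by (metis mult_Suc_right trans_le_add2)
    have "{..<e * Suc k} = {..<k} \<union> {k..<e * Suc k}" using leS by auto
    then have "(\<Sum>i<e * Suc k. xs i) = (\<Sum>i<k. xs i) + (\<Sum>i\<in>{k..<e * Suc k}. xs i)"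
      by (metis (no_types, lifting) sum.union_disjoint finite_lessThan finite_atLeastLessThan ivl_disj_int_one(2))
    then have "X - (\<Sum>i<k. xs i) = (X - S k) - p ^ k * r k + (\<Sum>i\<in>{k..<e * Suc k}. xs i)"
      using xs_blocks[of "Suc k"] carry[of k] by (simp add: algebra_simps)
    moreover have "ge (int k) (X - S k)" using XS[of k] le ge_mono by (metis of_nat_le_iff)
    moreover have "ge (int k) (p ^ k * r k)" using pM[OF r[of k], of k] le ge_mono by (metis of_nat_le_iff)
    moreover have "ge (int k) (\<Sum>i\<in>{k..<e * Suc k}. xs i)"
      by (rule ge_sum) (metis xs ge_mono atLeastLessThan_iff of_nat_le_iff)
    ultimately show ?thesis by (simp only: ge_add ge_diff)
  qed
  then show ?thesis by blast
qed

sublocale frob_dvr val \<sigma>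
  using val_frob complete_series solve solve_0
  by unfold_locales auto

end

section \<open>Semilinear operators\<close>

text \<open>Vectors are functions on all of \<open>nat\<close>, and finite-dimensional spaces are
  the subspaces vanishing from some index on. Thus a single type serves for the ambient isocrystal
  and all simple ones.\<close>

definition sm :: "'l::field \<Rightarrow> (nat \<Rightarrow> 'l) \<Rightarrow> nat \<Rightarrow> 'l" where
  "sm c v = (\<lambda>i. c * v i)"

lemma sm_apply [simp]: "sm c v i = c * v i"
  by (simp add: sm_def)

lemma sum_fun_apply [simp]: "(\<Sum>i\<in>I. f i) x = (\<Sum>i\<in>I. f i x :: 'b::comm_monoid_add)"
  by (induction I rule: infinite_finite_induct) auto

lemma sm_simps:
  "sm 0 v = 0" "sm c 0 = 0" "sm 1 v = v" "sm a (sm b v) = sm (a * b) v"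
  "sm c (v + w) = sm c v + sm c w" "sm c (v - w) = sm c v - sm c w" "sm c (- v) = - sm c v"
  "sm (a + b) v = sm a v + sm b v" "sm (a - b) v = sm a v - sm b v" "sm (- a) v = - sm a v"
  by (auto simp: fun_eq_iff algebra_simps)

lemma sm_sum: "sm c (sum f I) = (\<Sum>i\<in>I. sm c (f i))"
  by (auto simp: fun_eq_iff sum_distrib_left)

lemma sm_eq_0: "c \<noteq> 0 \<Longrightarrow> sm c v = 0 \<longleftrightarrow> v = 0"
  by (auto simp: fun_eq_iff)

definition subspace_of :: "(nat \<Rightarrow> 'l::field) set \<Rightarrow> bool" where
  "subspace_of X \<longleftrightarrow> 0 \<in> X \<and> (\<forall>x\<in>X. \<forall>y\<in>X. x + y \<in> X) \<and> (\<forall>c. \<forall>x\<in>X. sm c x \<in> X)"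

lemma subspace_ofD:
  assumes "subspace_of X"
  shows "0 \<in> X" "x \<in> X \<Longrightarrow> y \<in> X \<Longrightarrow> x + y \<in> X" "x \<in> X \<Longrightarrow> sm c x \<in> X" "x \<in> X \<Longrightarrow> - x \<in> X"
    "x \<in> X \<Longrightarrow> y \<in> X \<Longrightarrow> x - y \<in> X"
proof -
  show "0 \<in> X" and a: "x \<in> X \<Longrightarrow> y \<in> X \<Longrightarrow> x + y \<in> X" and s: "x \<in> X \<Longrightarrow> sm c x \<in> X" for x y c
    using assms by (auto simp: subspace_of_def)
  show n: "x \<in> X \<Longrightarrow> - x \<in> X" for x using s[of x "-1"] by (simp add: sm_simps)
  show "x \<in> X \<Longrightarrow> y \<in> X \<Longrightarrow> x - y \<in> X" using a[of x "- y"] n by simp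
qed

lemma subspace_of_sum: "subspace_of X \<Longrightarrow> (\<And>i. i \<in> I \<Longrightarrow> f i \<in> X) \<Longrightarrow> sum f I \<in> X"
  by (induction I rule: infinite_finite_induct) (auto simp: subspace_ofD)

locale semilinear = field_auto \<sigma> for \<sigma> :: "'l::field \<Rightarrow> 'l" +
  fixes T :: "(nat \<Rightarrow> 'l) \<Rightarrow> nat \<Rightarrow> 'l"
  assumes T_add: "T (x + y) = T x + T y"
    and T_sm: "T (sm c x) = sm (\<sigma> c) (T x)"
begin

lemma T_0 [simp]: "T 0 = 0"
  using T_sm[of 0 0] by (simp add: sm_simps)

lemma T_uminus: "T (- x) = - T x"
  using T_sm[of "-1" x] by (simp add: sm_simps sig_uminus)

lemma T_diff: "T (x - y) = T x - T y"
  using T_add[of x "- y"] by (simp add: T_uminus)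

lemma T_sum: "T (sum f I) = (\<Sum>i\<in>I. T (f i))"
proof (induction I rule: infinite_finite_induct)
  case (insert x F)
  then show ?case by (simp only: sum.insert not_False_eq_True T_add)
qed (simp_all only: sum.infinite sum.empty not_False_eq_True T_0)

lemma Tk_add: "(T ^^ k) (x + y) = (T ^^ k) x + (T ^^ k) y"
  by (induction k) (simp_all only: funpow.simps o_apply id_apply T_add)

lemma Tk_0 [simp]: "(T ^^ k) 0 = 0"
  by (induction k) (simp_all only: funpow.simps o_apply id_apply T_0)

lemma Tk_diff: "(T ^^ k) (x - y) = (T ^^ k) x - (T ^^ k) y"
  by (induction k) (simp_all only: funpow.simps o_apply id_apply T_diff)

text \<open>The action of a skew polynomial in \<open>T\<close>. It is additive but in general not
  linear, so its kernel and image need not be subspaces.\<close>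

definition Q :: "(nat \<Rightarrow> 'l) \<Rightarrow> nat \<Rightarrow> (nat \<Rightarrow> 'l) \<Rightarrow> nat \<Rightarrow> 'l" where
  "Q a d x = (\<Sum>i\<le>d. sm (a i) ((T ^^ i) x))"

lemma Q_add: "Q a d (x + y) = Q a d x + Q a d y"
  by (simp add: Q_def Tk_add sm_simps sum.distrib)

lemma Q_diff: "Q a d (x - y) = Q a d x - Q a d y"
  by (simp add: Q_def Tk_diff sm_simps sum_subtractf)

lemma Q_0: "Q a d 0 = 0"
  by (simp add: Q_def sm_simps)

lemma Tk_closed: "(\<And>x. x \<in> X \<Longrightarrow> T x \<in> X) \<Longrightarrow> x \<in> X \<Longrightarrow> (T ^^ k) x \<in> X"
  by (induction k) auto

end

section \<open>Simple isocrystals\<close>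

locale simple_iso = frob_dvr val \<sigma> for val :: "'l::field \<Rightarrow> int" and \<sigma> :: "'l \<Rightarrow> 'l" +
  fixes \<pi> :: 'l and s :: int and r :: nat
  assumes pi_nz: "\<pi> \<noteq> 0" and val_pi: "val \<pi> = 1" and r_pos: "r > 0" and cop: "coprime s (int r)"
begin

text \<open>The semilinear map with matrix \<open>simple_isocrystal \<pi> s r\<close>, in
  coordinates padded by 0.\<close>

definition T :: "(nat \<Rightarrow> 'l) \<Rightarrow> nat \<Rightarrow> 'l" where
  "T x = (\<lambda>j. if j = 0 then \<pi> powi s * \<sigma> (x (r - 1)) else if j < r then \<sigma> (x (j - 1)) else 0)"

sublocale semilinear \<sigma> T
  by unfold_locales (auto simp: T_def fun_eq_iff sig_add sig_mult algebra_simps)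

definition V :: "(nat \<Rightarrow> 'l) set" where "V = {x. \<forall>j\<ge>r. x j = 0}"

lemma V_subspace: "subspace_of V"
  by (auto simp: subspace_of_def V_def)

lemma T_V: "T x \<in> V"
  using r_pos by (auto simp: T_def V_def)

lemma Tk_V: "x \<in> V \<Longrightarrow> (T ^^ k) x \<in> V"
  using Tk_closed T_V by blast

text \<open>The level of the basis vector \<open>e\<^sub>j\<close> is \<open>s j\<close> and that of a scalar \<open>c\<close> is \<open>r val c\<close>, so that \<open>T\<close>
  raises the level by exactly \<open>s\<close>. By coprimality, the homogeneous components of the filtration
  are one-dimensional.\<close>

definition Em :: "int \<Rightarrow> (nat \<Rightarrow> 'l) \<Rightarrow> bool" where
  "Em m x \<longleftrightarrow> x \<in> V \<and> (\<forall>j<r. x j = 0 \<or> m \<le> int r * val (x j) + s * int j)"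

text \<open>The bound for the \<open>j\<close>-th coordinate is the ceiling of
  \<open>(m - s * j) / r\<close>, written as minus a floor. In this form the filtration is a product
  of fractional ideals.\<close>

lemma Em_ge: "Em m x \<longleftrightarrow> x \<in> V \<and> (\<forall>j<r. ge (- ((s * int j - m) div int r)) (x j))"
proof -
  have "m \<le> int r * v + s * int j \<longleftrightarrow> - ((s * int j - m) div int r) \<le> v" for v j
  proof -
    have "- v \<le> (s * int j - m) div int r \<longleftrightarrow> - v * int r \<le> s * int j - m"
    proof
      assume "- v \<le> (s * int j - m) div int r"
      then have "- v * int r \<le> (s * int j - m) div int r * int r" by (rule mult_right_mono) simp
      also have "\<dots> \<le> s * int j - m" using r_pos by (simp add: minus_mod_eq_div_mult[symmetric])
      finally show "- v * int r \<le> s * int j - m" .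
    next
      assume "- v * int r \<le> s * int j - m"
      moreover have "- v * int r div int r = - v"
        using r_pos by (intro nonzero_mult_div_cancel_right) simp
      ultimately show "- v \<le> (s * int j - m) div int r"
        using zdiv_mono1[of "- v * int r" "s * int j - m" "int r"] r_pos by simp
    qed
    then show ?thesis by (auto simp: algebra_simps)
  qed
  then show ?thesis by (auto simp: Em_def vge_def)
qed

lemma Em_V: "Em m x \<Longrightarrow> x \<in> V" by (simp add: Em_def)

lemma Em_0 [simp]: "Em m 0" by (simp add: Em_def V_def)

lemma Em_add: "Em m x \<Longrightarrow> Em m y \<Longrightarrow> Em m (x + y)"
  by (auto simp: Em_ge subspace_ofD[OF V_subspace] ge_add)

lemma Em_uminus [simp]: "Em m (- x) \<longleftrightarrow> Em m x"
  by (auto simp: Em_def V_def)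

lemma Em_diff: "Em m x \<Longrightarrow> Em m y \<Longrightarrow> Em m (x - y)"
  using Em_add[of m x "- y"] by simp

lemma Em_sum: "(\<And>i. i \<in> I \<Longrightarrow> Em m (f i)) \<Longrightarrow> Em m (sum f I)"
  by (induction I rule: infinite_finite_induct) (auto simp: Em_add)

lemma Em_mono: "Em m x \<Longrightarrow> m' \<le> m \<Longrightarrow> Em m' x"
  unfolding Em_def using order_trans by blast

lemma Em_sm: assumes "c \<noteq> 0" shows "Em (m + int r * val c) (sm c x) \<longleftrightarrow> Em m x"
proof -
  have "sm c x \<in> V \<longleftrightarrow> x \<in> V" using assms by (auto simp: V_def)
  moreover have "(sm c x j = 0 \<or> m + int r * val c \<le> int r * val (sm c x j) + s * int j)
      \<longleftrightarrow> (x j = 0 \<or> m \<le> int r * val (x j) + s * int j)" for j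
    using assms by (cases "x j = 0") (auto simp: val_mult distrib_left)
  ultimately show ?thesis by (simp add: Em_def)
qed

text \<open>The only delicate coordinate is the last, which wraps around to 0. The factor
  \<open>\<pi> powi s\<close> adds \<open>r * s\<close> to the level, while leaving index
  \<open>r - 1\<close> costs \<open>s * (r - 1)\<close>; the net gain is again
  \<open>s\<close>.\<close>

lemma Em_T: assumes "x \<in> V" shows "Em (m + s) (T x) \<longleftrightarrow> Em m x"
proof
  assume T: "Em (m + s) (T x)"
  have "x j = 0 \<or> m \<le> int r * val (x j) + s * int j" if j: "j < r" for j
  proof (cases "Suc j < r")
    case True
    with T have "T x (Suc j) = 0 \<or> m + s \<le> int r * val (T x (Suc j)) + s * int (Suc j)"
      by (simp only: Em_def)
    then show ?thesis using True by (cases "x j = 0") (auto simp: T_def val_sig algebra_simps)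
  next
    case False
    then have jr: "r = Suc j" using j by simp
    have "T x 0 = 0 \<or> m + s \<le> int r * val (T x 0) + s * int 0"
      using T r_pos by (simp only: Em_def)
    moreover have "T x 0 = \<pi> powi s * \<sigma> (x j)" unfolding T_def using jr by simp
    moreover have "int r * s = s * int j + s" using jr by (simp add: algebra_simps)
    ultimately show ?thesis using pi_nz
      by (cases "x j = 0") (auto simp: val_sig val_mult val_powi val_pi distrib_left)
  qed
  then show "Em m x" using assms by (simp add: Em_def)
next
  assume E: "Em m x"
  have "T x j = 0 \<or> m + s \<le> int r * val (T x j) + s * int j" if j: "j < r" for j
  proof (cases j)
    case 0
    have "x (r - 1) = 0 \<or> m \<le> int r * val (x (r - 1)) + s * int (r - 1)"
      using E[unfolded Em_def, THEN conjunct2, rule_format, of "r - 1"] r_pos by simp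
    then show ?thesis using 0 pi_nz r_pos
      by (cases "x (r - 1) = 0") (auto simp: T_def val_sig val_mult val_powi val_pi algebra_simps of_nat_diff)
  next
    case (Suc i)
    then have "x i = 0 \<or> m \<le> int r * val (x i) + s * int i" using E j by (simp add: Em_def)
    then show ?thesis using Suc j by (cases "x i = 0") (auto simp: T_def val_sig algebra_simps)
  qed
  then show "Em (m + s) (T x)" using T_V by (simp add: Em_def)
qed

lemma Em_Tk: "x \<in> V \<Longrightarrow> Em (m + int k * s) ((T ^^ k) x) \<longleftrightarrow> Em m x"
proof (induction k)
  case (Suc k)
  have "m + int (Suc k) * s = m + int k * s + s" by (simp add: algebra_simps)
  then show ?case
    using Em_T[OF Tk_V[OF Suc.prems], of "m + int k * s" k] Suc.IH[OF Suc.prems]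
    by (simp only: funpow.simps o_apply)
qed simp

lemma Em_all_0: assumes "\<And>m. Em m x" shows "x = 0"
proof
  fix j
  have "ge t (x j)" if "j < r" for t
  proof -
    have "s * int j - (int r * t + s * int j) = int r * (- t)" by simp
    then have "(s * int j - (int r * t + s * int j)) div int r = - t"
      using r_pos by (simp only: nonzero_mult_div_cancel_left)
    then have "t \<le> - ((s * int j - (int r * t + s * int j)) div int r)" by simp
    then show ?thesis using assms[of "int r * t + s * int j"] that ge_mono unfolding Em_ge by blast
  qed
  then show "x j = 0 j" using assms[of 0] ge_all_0 by (cases "j < r") (auto simp: Em_def V_def)
qed

lemma ex_Em: assumes "x \<in> V" shows "\<exists>m. Em m x"
proof -
  define m where "m = Min ((\<lambda>j. int r * val (x j) + s * int j) ` {..<r})"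
  have "m \<le> int r * val (x j) + s * int j" if "j < r" for j
    unfolding m_def using that by (intro Min_le) auto
  then show ?thesis using assms by (auto simp: Em_def)
qed

definition lev :: "(nat \<Rightarrow> 'l) \<Rightarrow> int \<Rightarrow> bool" where
  "lev x m \<longleftrightarrow> Em m x \<and> \<not> Em (m + 1) x"

lemma ex_lev: assumes "x \<in> V" "x \<noteq> 0" shows "\<exists>m. lev x m"
proof (rule ccontr)
  assume *: "\<not> ?thesis"
  obtain m0 where m0: "Em m0 x" using ex_Em assms by blast
  have "Em m x" if "m0 \<le> m" for m
    using that by (induction m rule: int_ge_induct) (use m0 * in \<open>auto simp: lev_def\<close>)
  then have "Em m x" for m using m0 Em_mono[of m0 x m] by (cases "m0 \<le> m") auto
  then show False using Em_all_0 assms by blast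
qed

lemma lev_sm: "c \<noteq> 0 \<Longrightarrow> lev x m \<Longrightarrow> lev (sm c x) (m + int r * val c)"
  using Em_sm[of c m x] Em_sm[of c "m + 1" x] by (simp add: lev_def algebra_simps)

lemma lev_Tk: "lev x m \<Longrightarrow> lev ((T ^^ k) x) (m + int k * s)"
  using Em_Tk[of x m k] Em_Tk[of x "m + 1" k] by (auto simp: lev_def Em_V algebra_simps)

text \<open>Summands of different levels cannot cancel: subtracting the others would put the summand
  of least level one step too deep.\<close>

lemma lev_distinct_sum:
  assumes "finite I" "\<And>i. i \<in> I \<Longrightarrow> lev (y i) (f i)" "inj_on f I" "Em M (sum y I)" "i \<in> I"
  shows "M \<le> f i"
proof -
  define i0 where "i0 = arg_min_on f I"
  have i0: "i0 \<in> I" and min: "\<And>j. j \<in> I \<Longrightarrow> f i0 \<le> f j"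
    using arg_min_if_finite[of I f] assms(1,5) by (auto simp: i0_def not_less)
  have "M \<le> f i0"
  proof (rule ccontr)
    assume "\<not> ?thesis"
    then have "Em (f i0 + 1) (sum y I)" using assms(4) Em_mono by auto
    moreover have "Em (f i0 + 1) (sum y (I - {i0}))"
    proof (rule Em_sum)
      fix j assume j: "j \<in> I - {i0}"
      then have "f j \<noteq> f i0" using assms(3) i0 by (auto dest: inj_onD)
      then have "f i0 + 1 \<le> f j" using min[of j] j by auto
      then show "Em (f i0 + 1) (y j)" using assms(2)[of j] j Em_mono by (auto simp: lev_def)
    qed
    ultimately have "Em (f i0 + 1) (sum y I - sum y (I - {i0}))" by (rule Em_diff)
    then have "Em (f i0 + 1) (y i0)" using i0 assms(1) by (simp add: sum_diff1)
    then show False using assms(2) i0 by (auto simp: lev_def)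
  qed
  then show ?thesis using min[OF assms(5)] by linarith
qed

lemma residue_unique:
  assumes "int r * t + s * int j = int r * t' + s * int j'" "j < r" "j' < r"
  shows "j = j'" "t = t'"
proof -
  have "s * (int j - int j') = int r * (t' - t)" using assms(1) by (simp add: algebra_simps)
  then have "int r dvd s * (int j - int j')" by simp
  then have "int r dvd int j - int j'" using cop by (simp add: coprime_dvd_mult_right_iff coprime_commute)
  moreover have "\<bar>int j - int j'\<bar> < int r" using assms(2,3) by linarith
  ultimately show j: "j = j'" using zdvd_imp_le[of "int r" "\<bar>int j - int j'\<bar>"] by (cases "j = j'") auto
  show "t = t'" using assms(1) r_pos by (simp add: j)
qed

text \<open>The summands have levels \<open>n + i * s + r * val (c i)\<close>, pairwise distinct by
  coprimality. So there is no cancellation, and each summand is at least as deep as the sum.\<close>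

lemma combination_bound:
  assumes x: "lev x n" and M: "Em M (\<Sum>i<r. sm (c i) ((T ^^ i) x))" and i: "i < r"
  shows "c i = 0 \<or> M \<le> n + int r * val (c i) + int i * s"
proof -
  let ?I = "{i. i < r \<and> c i \<noteq> 0}"
  define f where "f i = n + int i * s + int r * val (c i)" for i
  have "Em M (\<Sum>i\<in>?I. sm (c i) ((T ^^ i) x))"
    using M by (subst (asm) sum.mono_neutral_right[of _ ?I]) (auto simp: sm_simps)
  moreover have "lev (sm (c i) ((T ^^ i) x)) (f i)" if "i \<in> ?I" for i
    using that lev_sm[OF _ lev_Tk[OF x]] by (auto simp: f_def)
  moreover have "inj_on f ?I"
  proof (rule inj_onI)
    fix i j assume "i \<in> ?I" "j \<in> ?I" "f i = f j"
    then show "i = j" using residue_unique(1)[of "val (c i)" i "val (c j)" j] by (simp add: f_def algebra_simps)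
  qed
  ultimately have le: "M \<le> f i" if "i \<in> ?I" for i using lev_distinct_sum[of ?I] that by fastforce
  show ?thesis
  proof (cases "c i = 0")
    case False
    then have "M \<le> f i" using i by (intro le) simp
    then show ?thesis by (simp add: f_def)
  qed simp
qed

lemma cyclic_independent:
  assumes "x \<in> V" "x \<noteq> 0" "(\<Sum>i<r. sm (c i) ((T ^^ i) x)) = 0" "i < r"
  shows "c i = 0"
proof (rule ccontr)
  assume "c i \<noteq> 0"
  obtain n where "lev x n" using ex_lev assms by blast
  from combination_bound[OF this, of "n + int r * val (c i) + int i * s + 1" c i] assms(3,4) \<open>c i \<noteq> 0\<close>
  show False by simp
qed

text \<open>Simplicity of the isocrystal: the first \<open>r\<close> iterates of a nonzero vector
  are independent by \<open>cyclic_independent\<close>, hence a basis of the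
  \<open>r\<close>-dimensional space \<open>V\<close>.\<close>

lemma cyclic_spans:
  assumes x: "x \<in> V" "x \<noteq> 0" and z: "z \<in> V"
  shows "\<exists>c. z = (\<Sum>i<r. sm (c i) ((T ^^ i) x))"
proof -
  define a where "a i = (if i = r then z else (T ^^ i) x)" for i
  obtain c where c: "\<exists>i\<in>{..r}. c i \<noteq> 0" "\<forall>j\<in>{..<r}. (\<Sum>i\<in>{..r}. c i * a i j) = 0"
    using homogeneous_system[OF subfield_UNIV, of "{..<r}" "{..r}" a] by auto
  have aV: "a i \<in> V" for i using x z Tk_V by (simp add: a_def)
  have "(\<Sum>i\<le>r. sm (c i) (a i)) = 0"
  proof
    fix j
    show "(\<Sum>i\<le>r. sm (c i) (a i)) j = 0 j" using c(2) aV by (cases "j < r") (auto simp: V_def)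
  qed
  moreover have "(\<Sum>i\<le>r. sm (c i) (a i)) = (\<Sum>i<r. sm (c i) ((T ^^ i) x)) + sm (c r) z"
    by (simp add: a_def lessThan_Suc_atMost[symmetric])
  ultimately have rel: "(\<Sum>i<r. sm (c i) ((T ^^ i) x)) + sm (c r) z = 0" by simp
  have "c r \<noteq> 0"
  proof
    assume "c r = 0"
    then have "c i = 0" if "i < r" for i using rel cyclic_independent[OF x, of c i] that by (simp add: sm_simps)
    then show False using c(1) \<open>c r = 0\<close> by (metis atMost_iff le_neq_implies_less)
  qed
  have "sm (c r) z = - (\<Sum>i<r. sm (c i) ((T ^^ i) x))" using rel by (simp add: add_eq_0_iff)
  then have "sm (inverse (c r)) (sm (c r) z) = (\<Sum>i<r. sm (- (c i / c r)) ((T ^^ i) x))"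
    by (simp add: sm_sum sm_simps sum_negf[symmetric] field_simps)
  then show ?thesis using \<open>c r \<noteq> 0\<close> by (auto simp: sm_simps intro!: exI[of _ "\<lambda>i. - (c i / c r)"])
qed

section \<open>Leading coefficients for the level filtration\<close>

lemma ex_residue: "\<exists>jt. fst jt < r \<and> int r * snd jt + s * int (fst jt) = m"
proof -
  obtain u v where uv: "u * s + v * int r = 1" using cop bezout_int[of s "int r"] by auto
  \<comment> \<open>The index must satisfy \<open>s * j = m\<close> modulo \<open>r\<close>, and the
    Bezout coefficient \<open>u\<close> inverts \<open>s\<close>.\<close>
  define j where "j = nat (m * u mod int r)"
  have j: "int j = m * u mod int r" "j < r" using r_pos by (auto simp: j_def nat_less_iff)
  have "m = s * (m * u) + int r * (v * m)" using uv by (metis mult.assoc mult.commute distrib_left mult_1_right)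
  also have "m * u = int r * (m * u div int r) + int j" using j by simp
  finally have "int r * (v * m + s * (m * u div int r)) + s * int j = m" by (simp add: algebra_simps)
  then show ?thesis using j(2) by (intro exI[of _ "(j, v * m + s * (m * u div int r))"]) simp
qed

definition jj :: "int \<Rightarrow> nat" where "jj m = fst (SOME jt. fst jt < r \<and> int r * snd jt + s * int (fst jt) = m)"
definition tt :: "int \<Rightarrow> int" where "tt m = snd (SOME jt. fst jt < r \<and> int r * snd jt + s * int (fst jt) = m)"

lemma jj: "jj m < r" "int r * tt m + s * int (jj m) = m"
  using someI_ex[OF ex_residue[of m]] unfolding jj_def tt_def by auto

lemma jj_eqI: "j < r \<Longrightarrow> int r * t + s * int j = m \<Longrightarrow> jj m = j \<and> tt m = t"
  using residue_unique[of "tt m" "jj m" t j] jj[of m] by simp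

text \<open>The leading coefficient at level \<open>m = r t + s j\<close> is the \<open>j\<close>-th coordinate, divided by \<open>\<pi>\<^sup>t\<close>.\<close>

definition lc :: "int \<Rightarrow> (nat \<Rightarrow> 'l) \<Rightarrow> 'l" where "lc m x = \<pi> powi (- tt m) * x (jj m)"

lemma lc_diff: "lc m (x - y) = lc m x - lc m y" by (simp add: lc_def right_diff_distrib)

lemma lc_sum: "lc m (sum f I) = (\<Sum>i\<in>I. lc m (f i))" by (simp add: lc_def sum_distrib_left)

lemma ge_lc: assumes "Em m x" shows "ge 0 (lc m x)"
proof (cases "x (jj m) = 0")
  case False
  then have "m \<le> int r * val (x (jj m)) + s * int (jj m)"
    using assms[unfolded Em_def, THEN conjunct2, rule_format, OF jj(1)[of m]] by simp
  then have "int r * tt m \<le> int r * val (x (jj m))" using jj(2)[of m] by linarith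
  then have "tt m \<le> val (x (jj m))" using r_pos by simp
  then show ?thesis using False pi_nz val_pi by (simp add: lc_def vge_def val_mult val_powi)
qed (simp add: lc_def)

text \<open>No coordinate other than \<open>jj m\<close> can have level exactly \<open>m\<close>.
  Therefore a vector of level at least \<open>m\<close> moves to the next step of the filtration
  exactly when this coordinate does.\<close>

lemma ge_1_lc: assumes x: "Em m x" shows "ge 1 (lc m x) \<longleftrightarrow> Em (m + 1) x"
proof -
  have nz: "\<pi> powi k \<noteq> 0" for k using pi_nz by simp
  have "ge 1 (lc m x) \<longleftrightarrow> ge (1 + tt m) (x (jj m))"
    using val_pi by (simp add: lc_def ge_mult_iff[OF nz] val_powi pi_nz)
  also have "\<dots> \<longleftrightarrow> x (jj m) = 0 \<or> m + 1 \<le> int r * val (x (jj m)) + s * int (jj m)"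
  proof -
    have "m + 1 \<le> int r * v + s * int (jj m) \<longleftrightarrow> 1 + tt m \<le> v" for v
    proof -
      have "m + 1 \<le> int r * v + s * int (jj m) \<longleftrightarrow> int r * tt m < int r * v" using jj(2)[of m] by linarith
      then show ?thesis using r_pos by auto
    qed
    then show ?thesis by (simp add: vge_def)
  qed
  also have "\<dots> \<longleftrightarrow> Em (m + 1) x"
  proof
    assume *: "x (jj m) = 0 \<or> m + 1 \<le> int r * val (x (jj m)) + s * int (jj m)"
    have "x j = 0 \<or> m + 1 \<le> int r * val (x j) + s * int j" if j: "j < r" for j
    proof (cases "j = jj m")
      case False
      then have "int r * val (x j) + s * int j \<noteq> m" using jj_eqI[OF j, of "val (x j)" m] by auto
      then show ?thesis using x j by (auto simp: Em_def)
    qed (use * in simp)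
    then show "Em (m + 1) x" using x by (simp add: Em_def)
  qed (use jj(1) in \<open>simp add: Em_def\<close>)
  finally show ?thesis .
qed

lemma lc_sm: "lc (m + int r * k) (sm c x) = (c * \<pi> powi (- k)) * lc m x"
proof -
  have "jj (m + int r * k) = jj m \<and> tt (m + int r * k) = tt m + k"
    using jj[of m] by (intro jj_eqI) (auto simp: algebra_simps)
  moreover have "\<pi> powi (- (tt m + k)) = \<pi> powi (- k) * \<pi> powi (- tt m)"
    using pi_nz power_int_add[of \<pi> "- k" "- tt m"] by (simp add: add.commute)
  ultimately show ?thesis by (simp add: lc_def mult_ac)
qed

lemma val_sig_pi: "val (\<sigma> \<pi>) = 1" by (simp add: val_sig pi_nz val_pi)

text \<open>The unit \<open>u\<close> appears because \<open>\<sigma>\<close> need not fix the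
  uniformizer.\<close>

lemma lc_T: "\<exists>u. u \<noteq> 0 \<and> val u = 0 \<and> (\<forall>x. lc (m + s) (T x) = u * \<sigma> (lc m x))"
proof -
  define u where "u = \<pi> powi (- tt m) * \<sigma> \<pi> powi (tt m)"
  have u: "u \<noteq> 0" "val u = 0" using pi_nz by (auto simp: u_def val_mult val_powi val_pi val_sig_pi)
  have one: "\<sigma> \<pi> powi k * (\<sigma> \<pi> powi (- k) * z) = z" for k z
    using pi_nz by (simp add: power_int_minus mult.assoc[symmetric])
  have "lc (m + s) (T x) = u * \<sigma> (lc m x)" for x
  proof (cases "Suc (jj m) < r")
    case True
    then have "jj (m + s) = Suc (jj m) \<and> tt (m + s) = tt m"
      using jj(2)[of m] by (intro jj_eqI) (auto simp: algebra_simps)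
    then show ?thesis using True by (simp add: lc_def T_def u_def sig_mult sig_powi mult.assoc one)
  next
    case False
    then have r: "r = Suc (jj m)" using jj(1)[of m] by simp
    have "jj (m + s) = 0 \<and> tt (m + s) = tt m + s"
      using jj(2)[of m] arg_cong[OF r, of "\<lambda>n. s * int n"] r_pos by (intro jj_eqI) (auto simp: algebra_simps)
    moreover have "\<pi> powi (- (tt m + s)) * \<pi> powi s = \<pi> powi (- tt m)"
      using pi_nz by (simp add: power_int_add[symmetric])
    moreover have "r - Suc 0 = jj m" using r by simp
    ultimately show ?thesis
      by (simp add: lc_def T_def u_def sig_mult sig_powi mult.assoc one)
  qed
  then show ?thesis using u by blast
qed

lemma lc_Tk: "\<exists>u. u \<noteq> 0 \<and> val u = 0 \<and> (\<forall>x. lc (m + int i * s) ((T ^^ i) x) = u * (\<sigma> ^^ i) (lc m x))"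
proof (induction i)
  case 0
  show ?case by (intro exI[of _ 1]) simp
next
  case (Suc i)
  then obtain u where u: "u \<noteq> 0" "val u = 0"
    "\<And>x. lc (m + int i * s) ((T ^^ i) x) = u * (\<sigma> ^^ i) (lc m x)" by blast
  obtain w where w: "w \<noteq> 0" "val w = 0"
    "\<And>x. lc (m + int i * s + s) (T x) = w * \<sigma> (lc (m + int i * s) x)" using lc_T by blast
  have "m + int (Suc i) * s = m + int i * s + s" by (simp add: algebra_simps)
  then have "lc (m + int (Suc i) * s) ((T ^^ Suc i) x) = (w * \<sigma> u) * (\<sigma> ^^ Suc i) (lc m x)" for x
    by (simp only: funpow.simps o_apply w(3) u(3) sig_mult mult.assoc)
  moreover have "w * \<sigma> u \<noteq> 0" "val (w * \<sigma> u) = 0" using u w by (auto simp: val_mult val_sig)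
  ultimately show ?case by blast
qed

lemma lc_lift: assumes "ge 0 y" shows "\<exists>x. Em m x \<and> lc m x = y"
proof -
  define x where "x j = (if j = jj m then y * \<pi> powi (tt m) else 0)" for j
  have "x \<in> V" using jj(1)[of m] by (auto simp: V_def x_def)
  moreover have "x j = 0 \<or> m \<le> int r * val (x j) + s * int j" for j
  proof (cases "j = jj m \<and> y \<noteq> 0")
    case True
    have "0 \<le> int r * val y" using True assms by (simp add: vge_def)
    then have "int r * tt m \<le> int r * (val y + tt m)" by (simp add: distrib_left)
    then show ?thesis using True jj(2)[of m] pi_nz by (simp add: x_def val_mult val_powi val_pi)
  qed (auto simp: x_def)
  ultimately have "Em m x" by (simp add: Em_def)
  moreover have "lc m x = y" using pi_nz by (simp add: lc_def x_def power_int_minus field_simps)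
  ultimately show ?thesis by blast
qed

end
text \<open>Resolution and induction produce eta-long functions, which these rules would turn into abstractions.\<close>

lemmas pointwise = plus_fun_apply zero_fun_apply sm_apply minus_apply uminus_apply sum_fun_apply

declare pointwise [simp del]

section \<open>Kernel and image of skew polynomials on a simple isocrystal\<close>

context simple_iso
begin

text \<open>The term \<open>a\<close> times \<open>T ^^ i\<close> raises the level by its weight
  \<open>r * val a + i * s\<close>. It affects the leading coefficient at
  \<open>m + \<delta>\<close> only if the weight is exactly \<open>\<delta>\<close>.\<close>

lemma lc_term:
  assumes wt: "a = 0 \<or> \<delta> \<le> int r * val a + int i * s"
  shows "\<exists>u. ge 0 u \<and> (ge 1 u \<longleftrightarrow> \<not> (a \<noteq> 0 \<and> int r * val a + int i * s = \<delta>)) \<and>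
    (\<forall>x. Em m x \<longrightarrow> Em (m + \<delta>) (sm a ((T ^^ i) x)) \<and>
      ge 1 (lc (m + \<delta>) (sm a ((T ^^ i) x)) - u * (\<sigma> ^^ i) (lc m x)))"
proof (cases "a = 0")
  case True
  then show ?thesis by (intro exI[of _ 0]) (auto simp: sm_simps lc_def pointwise)
next
  case False
  let ?n = "int r * val a + int i * s"
  have Em: "Em (m + ?n) (sm a ((T ^^ i) x))" if "Em m x" for x
  proof -
    have "Em (m + int i * s) ((T ^^ i) x)" using that Em_Tk Em_V by blast
    then have "Em (m + int i * s + int r * val a) (sm a ((T ^^ i) x))" using Em_sm[OF False] by blast
    then show ?thesis by (simp add: algebra_simps)
  qed
  show ?thesis
  proof (cases "?n = \<delta>")
    case True
    obtain w where w: "w \<noteq> 0" "val w = 0" "\<And>x. lc (m + int i * s) ((T ^^ i) x) = w * (\<sigma> ^^ i) (lc m x)"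
      using lc_Tk by blast
    let ?u = "a * \<pi> powi (- val a) * w"
    have u: "?u \<noteq> 0" "val ?u = 0" using False w pi_nz by (auto simp: val_mult val_powi val_pi)
    have "m + \<delta> = m + int i * s + int r * val a" using True by simp
    then have "lc (m + \<delta>) (sm a ((T ^^ i) x)) = ?u * (\<sigma> ^^ i) (lc m x)" for x
      by (simp only: lc_sm w(3) mult.assoc)
    then show ?thesis using True False Em u by (intro exI[of _ ?u]) (auto simp: vge_def)
  next
    case False': False
    then have lt: "m + \<delta> + 1 \<le> m + ?n" using wt False by auto
    have "Em (m + \<delta>) (sm a ((T ^^ i) x)) \<and> ge 1 (lc (m + \<delta>) (sm a ((T ^^ i) x)))" if "Em m x" for x
    proof -
      have E1: "Em (m + \<delta> + 1) (sm a ((T ^^ i) x))" by (rule Em_mono[OF Em[OF that] lt])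
      then have E0: "Em (m + \<delta>) (sm a ((T ^^ i) x))" by (rule Em_mono) simp
      show ?thesis using E0 E1 ge_1_lc[OF E0] by blast
    qed
    then show ?thesis using False' by (intro exI[of _ 0]) auto
  qed
qed

text \<open>On leading coefficients, \<open>Q\<close> acts modulo the maximal ideal through a
  \<open>q\<close>-polynomial, whose unit coefficients mark the terms of weight exactly
  \<open>\<delta>\<close>, the lowest edge of the Newton polygon.\<close>

lemma lc_Q:
  assumes wt: "\<And>i. i \<le> d \<Longrightarrow> a i = 0 \<or> \<delta> \<le> int r * val (a i) + int i * s"
  shows "\<exists>u. (\<forall>i\<le>d. ge 0 (u i) \<and> (ge 1 (u i) \<longleftrightarrow> \<not> (a i \<noteq> 0 \<and> int r * val (a i) + int i * s = \<delta>))) \<and>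
    (\<forall>x. Em m x \<longrightarrow> Em (m + \<delta>) (Q a d x) \<and>
      ge 1 (lc (m + \<delta>) (Q a d x) - (\<Sum>i\<le>d. u i * (\<sigma> ^^ i) (lc m x))))"
proof -
  have "\<forall>i\<in>{..d}. \<exists>u. ge 0 u \<and> (ge 1 u \<longleftrightarrow> \<not> (a i \<noteq> 0 \<and> int r * val (a i) + int i * s = \<delta>)) \<and>
    (\<forall>x. Em m x \<longrightarrow> Em (m + \<delta>) (sm (a i) ((T ^^ i) x)) \<and>
      ge 1 (lc (m + \<delta>) (sm (a i) ((T ^^ i) x)) - u * (\<sigma> ^^ i) (lc m x)))"
    using lc_term wt by simp
  from bchoice[OF this] obtain u where u: "\<And>i. i \<le> d \<Longrightarrow> ge 0 (u i) \<and>
      (ge 1 (u i) \<longleftrightarrow> \<not> (a i \<noteq> 0 \<and> int r * val (a i) + int i * s = \<delta>)) \<and>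
    (\<forall>x. Em m x \<longrightarrow> Em (m + \<delta>) (sm (a i) ((T ^^ i) x)) \<and>
      ge 1 (lc (m + \<delta>) (sm (a i) ((T ^^ i) x)) - u i * (\<sigma> ^^ i) (lc m x)))" by auto
  have "Em (m + \<delta>) (Q a d x) \<and> ge 1 (lc (m + \<delta>) (Q a d x) - (\<Sum>i\<le>d. u i * (\<sigma> ^^ i) (lc m x)))"
    if "Em m x" for x
  proof
    show "Em (m + \<delta>) (Q a d x)" unfolding Q_def using u that by (intro Em_sum) auto
    show "ge 1 (lc (m + \<delta>) (Q a d x) - (\<Sum>i\<le>d. u i * (\<sigma> ^^ i) (lc m x)))"
      unfolding Q_def lc_sum sum_subtractf[symmetric] using u that by (intro ge_sum) auto
  qed
  then show ?thesis using u by blast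
qed

text \<open>Successive approximation: \<open>solv\<close> finds a correction with the leading
  coefficient that cancels that of the remainder, so each round gains one level.\<close>

lemma Q_approx:
  assumes wt: "\<And>i. i \<le> d \<Longrightarrow> a i = 0 \<or> \<delta> \<le> int r * val (a i) + int i * s"
    and j: "j \<le> d" "a j \<noteq> 0" "int r * val (a j) + int j * s = \<delta>"
    and z: "Em (m + \<delta>) z"
  shows "\<exists>x. Em m x \<and> Em (m + \<delta> + int k) (z - Q a d x)"
proof (induction k)
  case 0
  then show ?case using z by (intro exI[of _ 0]) (simp add: Q_0)
next
  case (Suc k)
  then obtain x where x: "Em m x" "Em (m + \<delta> + int k) (z - Q a d x)" by blast
  let ?m = "m + int k" and ?z = "z - Q a d x"
  have zE: "Em (?m + \<delta>) ?z" using x(2) by (simp add: algebra_simps)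
  obtain u where u: "\<And>i. i \<le> d \<Longrightarrow> ge 0 (u i)" "\<not> ge 1 (u j)"
    and lcQ: "\<And>x. Em ?m x \<Longrightarrow> Em (?m + \<delta>) (Q a d x) \<and>
      ge 1 (lc (?m + \<delta>) (Q a d x) - (\<Sum>i\<le>d. u i * (\<sigma> ^^ i) (lc ?m x)))"
    using lc_Q[OF wt, of d ?m] j by blast
  obtain y where y: "ge 0 y" "ge 1 ((\<Sum>i\<le>d. u i * (\<sigma> ^^ i) y) - lc (?m + \<delta>) ?z)"
    using solv[of d u j "lc (?m + \<delta>) ?z", OF u(1) j(1) u(2) ge_lc[OF zE]] by blast
  obtain x' where x': "Em ?m x'" "lc ?m x' = y" using lc_lift[OF y(1)] by blast
  let ?w = "?z - Q a d x'"
  have wE: "Em (?m + \<delta>) ?w" using zE lcQ[OF x'(1)] by (auto intro: Em_diff)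
  have "ge 1 ((lc (?m + \<delta>) (Q a d x') - (\<Sum>i\<le>d. u i * (\<sigma> ^^ i) y)) + ((\<Sum>i\<le>d. u i * (\<sigma> ^^ i) y) - lc (?m + \<delta>) ?z))"
    using lcQ[OF x'(1)] x'(2) y(2) by (intro ge_add) auto
  moreover have "(lc (?m + \<delta>) (Q a d x') - (\<Sum>i\<le>d. u i * (\<sigma> ^^ i) y))
      + ((\<Sum>i\<le>d. u i * (\<sigma> ^^ i) y) - lc (?m + \<delta>) ?z) = - lc (?m + \<delta>) ?w" by (simp add: lc_diff)
  ultimately have "ge 1 (- lc (?m + \<delta>) ?w)" by (simp only:)
  then have "Em (?m + \<delta> + 1) ?w" using ge_1_lc[OF wE] by simp
  moreover have "?w = z - Q a d (x + x')" by (simp add: Q_add)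
  moreover have "Em m x'" using x'(1) by (rule Em_mono) simp
  ultimately show ?case using x(1)
    by (intro exI[of _ "x + x'"]) (simp add: Em_add algebra_simps)
qed

text \<open>Raising the level by \<open>r\<close> raises the bound of every coordinate by exactly 1,
  so completeness of the field applies coordinatewise.\<close>

lemma Em_series:
  assumes xs: "\<And>k. Em (m + int r * int k) (xs k)"
  shows "\<exists>X. \<forall>k. Em (m + int r * int k) (X - (\<Sum>i<k. xs i))"
proof -
  define c where "c j = - ((s * int j - m) div int r)" for j :: nat
  have bound: "- ((s * int j - (m + int r * int k)) div int r) = c j + int k" for j k
  proof -
    have "s * int j - (m + int r * int k) = (s * int j - m) + int r * (- int k)" by simp
    then show ?thesis using r_pos by (simp only: c_def div_mult_self2)
  qed
  have iff: "Em (m + int r * int k) x \<longleftrightarrow> x \<in> V \<and> (\<forall>j<r. ge (c j + int k) (x j))" for k x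
    by (simp only: Em_ge bound)
  have nz: "\<pi> powi n \<noteq> 0" for n using pi_nz by simp
  have "\<exists>X. \<forall>k. ge (int k) (X - (\<Sum>i<k. \<pi> powi (- c j) * xs i j))" if "j < r" for j
  proof (rule complete_sum)
    fix k
    show "ge (int k) (\<pi> powi (- c j) * xs k j)"
      using xs[of k] that by (simp add: iff ge_mult_iff[OF nz] val_powi pi_nz val_pi add.commute)
  qed
  then have "\<forall>j\<in>{..<r}. \<exists>X. \<forall>k. ge (int k) (X - (\<Sum>i<k. \<pi> powi (- c j) * xs i j))" by simp
  from bchoice[OF this] obtain Y where
    Y: "\<And>j k. j < r \<Longrightarrow> ge (int k) (Y j - (\<Sum>i<k. \<pi> powi (- c j) * xs i j))" by auto
  define X where "X j = (if j < r then \<pi> powi c j * Y j else 0)" for j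
  have XV: "X \<in> V" by (simp add: X_def V_def)
  have "Em (m + int r * int k) (X - (\<Sum>i<k. xs i))" for k
    unfolding iff
  proof (intro conjI allI impI)
    show "X - (\<Sum>i<k. xs i) \<in> V" using xs XV Em_V
      by (intro subspace_ofD(5)[OF V_subspace] subspace_of_sum[OF V_subspace]) auto
    fix j assume j: "j < r"
    have "(X - (\<Sum>i<k. xs i)) j = \<pi> powi c j * (Y j - (\<Sum>i<k. \<pi> powi (- c j) * xs i j))"
      using j pi_nz by (simp add: pointwise X_def right_diff_distrib sum_distrib_left mult.assoc[symmetric] power_int_minus)
    then show "ge (c j + int k) ((X - (\<Sum>i<k. xs i)) j)"
      using Y[OF j, of k] by (simp add: ge_mult_iff[OF nz] val_powi pi_nz val_pi)
  qed
  then show ?thesis by blast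
qed

lemma Q_solve_level:
  assumes wt: "\<And>i. i \<le> d \<Longrightarrow> a i = 0 \<or> \<delta> \<le> int r * val (a i) + int i * s"
    and j: "j \<le> d" "a j \<noteq> 0" "int r * val (a j) + int j * s = \<delta>"
    and z: "Em (m + \<delta>) z"
  shows "\<exists>x. Em m x \<and> Q a d x = z"
proof -
  \<comment> \<open>Rounds are grouped into blocks of \<open>r\<close>, since
    \<open>Em_series\<close> sums terms whose levels grow by \<open>r\<close>.\<close>
  have "\<exists>x. Em n x \<and> Em (n + \<delta> + int r) (z - Q a d x)" if "Em (n + \<delta>) z" for n z
    using Q_approx[of d a \<delta> j n z r] assms that by blast
  then obtain f where f: "\<And>n z. Em (n + \<delta>) z \<Longrightarrow> Em n (f n z) \<and> Em (n + \<delta> + int r) (z - Q a d (f n z))"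
    by metis
  define zs where "zs = rec_nat z (\<lambda>k z. z - Q a d (f (m + int r * int k) z))"
  define xs where "xs k = f (m + int r * int k) (zs k)" for k
  have zs_0: "zs 0 = z" and zs_Suc: "zs (Suc k) = zs k - Q a d (xs k)" for k by (simp_all add: zs_def xs_def)
  have zE: "Em (m + int r * int k + \<delta>) (zs k)" for k
  proof (induction k)
    case 0
    then show ?case using z by (simp add: zs_0)
  next
    case (Suc k)
    have "m + int r * int k + \<delta> + int r = m + int r * int (Suc k) + \<delta>" by (simp add: algebra_simps)
    then show ?case using f[OF Suc] by (simp only: zs_Suc xs_def)
  qed
  have xE: "Em (m + int r * int k) (xs k)" for k using f[OF zE] by (simp add: xs_def)
  obtain X where X: "\<And>k. Em (m + int r * int k) (X - (\<Sum>i<k. xs i))" using Em_series[OF xE] by blast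
  have zs: "zs k = z - Q a d (\<Sum>i<k. xs i)" for k
  proof (induction k)
    case (Suc k)
    then show ?case unfolding zs_Suc sum.lessThan_Suc Q_add by (simp only: diff_diff_eq)
  qed (simp add: zs_0 Q_0)
  have "Em n (z - Q a d X)" for n
  proof -
    define k where "k = nat (n - m - \<delta>)"
    have "n - m - \<delta> \<le> int k" by (simp add: k_def)
    also have "int k \<le> int r * int k" using r_pos mult_right_mono[of 1 "int r" "int k"] by simp
    finally have le: "n \<le> m + int r * int k + \<delta>" by simp
    have "z - Q a d X = zs k - Q a d (X - (\<Sum>i<k. xs i))" by (simp only: zs Q_diff) simp
    moreover have "Em (m + int r * int k + \<delta>) (Q a d (X - (\<Sum>i<k. xs i)))"
      using lc_Q[OF wt, of d "m + int r * int k"] X by blast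
    ultimately have "Em (m + int r * int k + \<delta>) (z - Q a d X)" using zE by (simp only: Em_diff)
    then show ?thesis by (rule Em_mono[OF _ le])
  qed
  then have "z - Q a d X = 0" by (rule Em_all_0)
  moreover have "Em m X" using X[of 0] by simp
  ultimately show ?thesis by (intro exI[of _ X]) simp
qed

text \<open>Take for \<open>\<delta>\<close> the least weight of a nonzero term and start at a level
  where \<open>z\<close> lives.\<close>

lemma Q_surj:
  assumes "j \<le> d" "a j \<noteq> 0" and z: "z \<in> V"
  shows "\<exists>x\<in>V. Q a d x = z"
proof -
  let ?I = "{i. i \<le> d \<and> a i \<noteq> 0}"
  define f where "f i = int r * val (a i) + int i * s" for i
  have I: "finite ?I" "?I \<noteq> {}" using assms by auto
  obtain j where j: "j \<in> ?I" "\<And>i. i \<in> ?I \<Longrightarrow> f j \<le> f i"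
    using arg_min_if_finite[OF I, of f] by (auto simp: not_less)
  obtain m where "Em m z" using ex_Em[OF z] by blast
  then have "Em ((m - f j) + f j) z" by simp
  moreover have "a i = 0 \<or> f j \<le> int r * val (a i) + int i * s" if "i \<le> d" for i
    using j(2)[of i] that by (cases "a i = 0") (auto simp: f_def)
  moreover have "j \<le> d" "a j \<noteq> 0" "int r * val (a j) + int j * s = f j" using j(1) by (auto simp: f_def)
  ultimately obtain x where "Em (m - f j) x" "Q a d x = z" using Q_solve_level by metis
  then show ?thesis using Em_V by blast
qed

text \<open>Two terms of least weight give the reduced equation a nonzero root. Its lift
  \<open>x\<close> has level exactly 0 and is a kernel vector up to one higher level; the correction
  \<open>x'\<close> has level at least 1, so the difference cannot vanish.\<close>

lemma Q_kernel:
  assumes wt: "\<And>i. i \<le> d \<Longrightarrow> a i = 0 \<or> \<delta> \<le> int r * val (a i) + int i * s"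
    and i0: "i0 < j" "a i0 \<noteq> 0" "int r * val (a i0) + int i0 * s = \<delta>"
    and j: "j \<le> d" "a j \<noteq> 0" "int r * val (a j) + int j * s = \<delta>"
  shows "\<exists>w\<in>V. w \<noteq> 0 \<and> Q a d w = 0"
proof -
  obtain u where u: "\<And>i. i \<le> d \<Longrightarrow> ge 0 (u i)" "\<not> ge 1 (u i0)" "\<not> ge 1 (u j)"
    and lcQ: "\<And>x. Em 0 x \<Longrightarrow> Em (0 + \<delta>) (Q a d x) \<and>
      ge 1 (lc (0 + \<delta>) (Q a d x) - (\<Sum>i\<le>d. u i * (\<sigma> ^^ i) (lc 0 x)))"
    using lc_Q[OF wt, of d 0] i0 j by (auto dest: less_imp_le order_trans)
  obtain y where y: "ge 0 y" "\<not> ge 1 y" "ge 1 (\<Sum>i\<le>d. u i * (\<sigma> ^^ i) y)"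
    using solv_0[of d u i0 j, OF u(1) i0(1) j(1) u(2,3)] by blast
  obtain x where x: "Em 0 x" "lc 0 x = y" using lc_lift[OF y(1)] by blast
  have "ge 1 (lc (0 + \<delta>) (Q a d x))"
    using lcQ[OF x(1)] y(3) x(2) by (auto intro: ge_cancel)
  then have "Em (1 + \<delta>) (Q a d x)" using lcQ[OF x(1)] ge_1_lc by (simp add: add.commute)
  then obtain x' where x': "Em 1 x'" "Q a d x' = Q a d x"
    using Q_solve_level[of d a \<delta> j 1 "Q a d x"] wt j by blast
  have "x \<noteq> x'"
  proof
    assume "x = x'"
    then have "Em (0 + 1) x" using x'(1) by simp
    then show False using ge_1_lc[OF x(1)] x(2) y(2) by simp
  qed
  then have "x - x' \<noteq> 0" by simp
  moreover have "Q a d (x - x') = 0" using x'(2) by (simp add: Q_diff)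
  moreover have "x - x' \<in> V" using x x' Em_V subspace_ofD(5)[OF V_subspace] by blast
  ultimately show ?thesis by blast
qed

definition e0 :: "nat \<Rightarrow> 'l" where "e0 j = (if j = 0 then 1 else 0)"

lemma e0: "e0 \<in> V" "e0 \<noteq> 0"
  using r_pos by (auto simp: e0_def V_def fun_eq_iff pointwise)

lemma Tk_e0: "k < r \<Longrightarrow> (T ^^ k) e0 = (\<lambda>j. if j = k then 1 else 0)"
proof (induction k)
  case (Suc k)
  then show ?case by (auto simp: T_def fun_eq_iff)
qed (simp add: e0_def fun_eq_iff)

lemma Tr_e0: "(T ^^ r) e0 = sm (\<pi> powi s) e0"
proof -
  have "(T ^^ r) e0 = T ((T ^^ (r - 1)) e0)" using r_pos by (metis Suc_diff_1 funpow.simps(2) o_apply)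
  then show ?thesis using r_pos by (auto simp: Tk_e0 T_def e0_def fun_eq_iff pointwise)
qed

text \<open>\<open>T ^^ r\<close> raises the level of \<open>x\<close> by exactly
  \<open>r * s\<close>, and \<open>combination_bound\<close> passes this on to every term of the
  expansion of \<open>(T ^^ r) x\<close>.\<close>

lemma cyclic_relation:
  assumes "x \<in> V"
  shows "\<exists>c. (T ^^ r) x = (\<Sum>i<r. sm (c i) ((T ^^ i) x)) \<and>
    (\<forall>i<r. c i = 0 \<or> int (r - i) * s \<le> int r * val (c i))"
proof (cases "x = 0")
  case True
  then show ?thesis by (intro exI[of _ "\<lambda>_. 0"]) (simp add: sm_simps)
next
  case False
  obtain n where n: "lev x n" using ex_lev assms False by blast
  obtain c where c: "(T ^^ r) x = (\<Sum>i<r. sm (c i) ((T ^^ i) x))"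
    using cyclic_spans[OF assms False Tk_V[OF assms]] by blast
  have "Em (n + int r * s) (\<Sum>i<r. sm (c i) ((T ^^ i) x))"
    using lev_Tk[OF n, of r] c by (simp add: lev_def)
  from combination_bound[OF n this] have "c i = 0 \<or> int (r - i) * s \<le> int r * val (c i)" if "i < r" for i
    using that by (force simp: of_nat_diff left_diff_distrib)
  then show ?thesis using c by blast
qed

end

section \<open>The classification of isocrystals\<close>

definition carr :: "nat \<Rightarrow> (nat \<Rightarrow> 'l::field) set" where
  "carr n = {x. \<forall>j\<ge>n. x j = 0}"

lemma carr_subspace: "subspace_of (carr n)"
  by (auto simp: subspace_of_def carr_def pointwise)

definition lincomb :: "(nat \<Rightarrow> 'l::field) \<Rightarrow> (nat \<Rightarrow> 'l) list \<Rightarrow> nat \<Rightarrow> 'l" where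
  "lincomb c us = (\<Sum>i<length us. sm (c i) (us ! i))"

lemma lincomb_append: "lincomb c (us @ vs) = lincomb c us + lincomb (\<lambda>i. c (i + length us)) vs"
proof -
  have "{..<length us + length vs} = {..<length us} \<union> {length us..<length us + length vs}" by auto
  then have "lincomb c (us @ vs) = (\<Sum>i<length us. sm (c i) ((us @ vs) ! i))
      + (\<Sum>i\<in>{length us..<length us + length vs}. sm (c i) ((us @ vs) ! i))"
    by (simp add: lincomb_def sum.union_disjoint ivl_disj_int_one(2))
  also have "(\<Sum>i\<in>{length us..<length us + length vs}. sm (c i) ((us @ vs) ! i))
      = (\<Sum>i<length vs. sm (c (i + length us)) (vs ! i))"
    using sum.shift_bounds_nat_ivl[of "\<lambda>i. sm (c i) ((us @ vs) ! i)" 0 "length us" "length vs"]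
    by (simp add: atLeast0LessThan add.commute[of "length us"] nth_append)
  finally show ?thesis by (simp add: lincomb_def nth_append)
qed

lemma lincomb_cong: "(\<And>i. i < length us \<Longrightarrow> c i = d i) \<Longrightarrow> lincomb c us = lincomb d us"
  by (simp add: lincomb_def)

lemma lincomb_in: "subspace_of X \<Longrightarrow> set us \<subseteq> X \<Longrightarrow> lincomb c us \<in> X"
  unfolding lincomb_def by (intro subspace_of_sum subspace_ofD(3)) auto

lemma lincomb_add: "lincomb c us + lincomb d us = lincomb (\<lambda>i. c i + d i) us"
  by (simp add: lincomb_def sm_simps sum.distrib)

lemma lincomb_sm: "sm a (lincomb c us) = lincomb (\<lambda>i. a * c i) us"
  by (simp add: lincomb_def sm_simps sm_sum)

lemma dependent_in_carr:
  assumes "set us \<subseteq> carr n" "n < length us"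
  shows "\<exists>c. lincomb c us = 0 \<and> (\<exists>i<length us. c i \<noteq> 0)"
proof -
  obtain c where c: "\<exists>i\<in>{..<length us}. c i \<noteq> 0" "\<forall>j\<in>{..<n}. (\<Sum>i\<in>{..<length us}. c i * (us ! i) j) = 0"
    using homogeneous_system[OF subfield_UNIV, of "{..<n}" "{..<length us}" "\<lambda>i. us ! i"] assms(2) by auto
  have "lincomb c us \<in> carr n" by (rule lincomb_in[OF carr_subspace assms(1)])
  then have "lincomb c us j = 0" for j
    using c(2) by (cases "j < n") (auto simp: carr_def lincomb_def pointwise)
  then show ?thesis using c(1) by (intro exI[of _ c]) (auto simp: fun_eq_iff pointwise)
qed

locale isocrystal = frob_dvr val \<sigma> + semilinear \<sigma> F
  for val :: "'l::field \<Rightarrow> int" and \<sigma> :: "'l \<Rightarrow> 'l" and F :: "(nat \<Rightarrow> 'l) \<Rightarrow> nat \<Rightarrow> 'l" +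
  fixes n :: nat and \<pi> :: 'l
  assumes pi_nz: "\<pi> \<noteq> 0" and val_pi: "val \<pi> = 1"
    and F_carr: "x \<in> carr n \<Longrightarrow> F x \<in> carr n"
    and F_inj: "x \<in> carr n \<Longrightarrow> F x = 0 \<Longrightarrow> x = 0"
begin

lemma Fk_carr: "x \<in> carr n \<Longrightarrow> (F ^^ k) x \<in> carr n"
  using Tk_closed F_carr by blast

section \<open>Chains and the subspaces they span\<close>

definition h :: "nat \<Rightarrow> (nat \<Rightarrow> 'l) \<Rightarrow> (nat \<Rightarrow> 'l) \<Rightarrow> nat \<Rightarrow> 'l" where
  "h r v x = (\<Sum>j<r. sm (x j) ((F ^^ j) v))"

text \<open>A chain \<open>(s, r, v)\<close> with \<open>F\<^sup>r v = \<pi>\<^sup>s v\<close> is a morphism \<open>h r v\<close> from the simple isocrystal of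
  slope \<open>s/r\<close>, mapping its first basis vector to \<open>v\<close>.\<close>

definition chain :: "int \<times> nat \<times> (nat \<Rightarrow> 'l) \<Rightarrow> bool" where
  "chain = (\<lambda>(s, r, v). r > 0 \<and> coprime s (int r) \<and> v \<in> carr n \<and> (F ^^ r) v = sm (\<pi> powi s) v)"

fun spc :: "(int \<times> nat \<times> (nat \<Rightarrow> 'l)) list \<Rightarrow> (nat \<Rightarrow> 'l) set" where
  "spc [] = {0}"
| "spc ((s, r, v) # cs) = {h r v x + u | x u. x \<in> carr r \<and> u \<in> spc cs}"

text \<open>Directness of the sum of the chains, stated through the morphisms \<open>h r v\<close>
  so that simplicity of the source can prove it. It implies linear independence of
  \<open>us cs\<close>, see \<open>indc_lincomb\<close>.\<close>

fun indc :: "(int \<times> nat \<times> (nat \<Rightarrow> 'l)) list \<Rightarrow> bool" where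
  "indc [] \<longleftrightarrow> True"
| "indc ((s, r, v) # cs) \<longleftrightarrow> (\<forall>x\<in>carr r. h r v x \<in> spc cs \<longrightarrow> x = 0) \<and> indc cs"

definition us :: "(int \<times> nat \<times> (nat \<Rightarrow> 'l)) list \<Rightarrow> (nat \<Rightarrow> 'l) list" where
  "us cs = concat (map (\<lambda>(s, r, v). map (\<lambda>j. (F ^^ j) v) [0..<r]) cs)"

lemma us_simps: "us [] = []" "us ((s, r, v) # cs) = map (\<lambda>j. (F ^^ j) v) [0..<r] @ us cs"
  by (simp_all add: us_def)

lemma h_lincomb: "h r v x = lincomb x (map (\<lambda>j. (F ^^ j) v) [0..<r])"
  by (simp add: h_def lincomb_def)

lemma h_add: "h r v (x + y) = h r v x + h r v y"
  by (simp add: h_def pointwise sm_simps sum.distrib)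

lemma h_sm: "h r v (sm c x) = sm c (h r v x)"
  by (simp add: h_def pointwise sm_simps sm_sum)

lemma h_0: "h r v 0 = 0"
  by (simp add: h_def pointwise sm_simps)

lemma h_sum: "h r v (sum f I) = (\<Sum>i\<in>I. h r v (f i))"
proof (induction I rule: infinite_finite_induct)
  case (insert x F)
  then show ?case by (simp only: sum.insert not_False_eq_True h_add)
qed (simp_all only: sum.infinite sum.empty not_False_eq_True h_0)

lemma us_carr: "\<forall>c\<in>set cs. chain c \<Longrightarrow> set (us cs) \<subseteq> carr n"
  by (auto simp: us_def chain_def Fk_carr)

lemma spc_iff: "u \<in> spc cs \<longleftrightarrow> (\<exists>c. u = lincomb c (us cs))"
proof (induction cs arbitrary: u)
  case Nil
  then show ?case by (simp add: us_simps lincomb_def)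
next
  case (Cons a cs)
  obtain s r v where a: "a = (s, r, v)" by (cases a)
  let ?vs = "map (\<lambda>j. (F ^^ j) v) [0..<r]"
  show ?case
  proof
    assume "u \<in> spc (a # cs)"
    then obtain x c where u: "u = h r v x + lincomb c (us cs)" using Cons a by auto
    let ?c = "\<lambda>i. if i < r then x i else c (i - r)"
    have "lincomb ?c (us (a # cs)) = lincomb ?c ?vs + lincomb (\<lambda>i. ?c (i + r)) (us cs)"
      unfolding a us_simps lincomb_append by simp
    also have "lincomb ?c ?vs = h r v x" unfolding h_lincomb by (rule lincomb_cong) simp
    finally show "\<exists>c. u = lincomb c (us (a # cs))" using u by (intro exI[of _ ?c]) simp
  next
    assume "\<exists>c. u = lincomb c (us (a # cs))"
    then obtain c where u: "u = lincomb c (us (a # cs))" by blast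
    let ?x = "\<lambda>i. if i < r then c i else 0"
    have "lincomb c ?vs = h r v ?x" unfolding h_lincomb by (rule lincomb_cong) simp
    then have "u = h r v ?x + lincomb (\<lambda>i. c (i + r)) (us cs)"
      using u unfolding a us_simps lincomb_append by simp
    moreover have "?x \<in> carr r" by (simp add: carr_def)
    ultimately show "u \<in> spc (a # cs)" using Cons a by auto
  qed
qed

lemma indc_lincomb: "indc cs \<Longrightarrow> lincomb c (us cs) = 0 \<Longrightarrow> i < length (us cs) \<Longrightarrow> c i = 0"
proof (induction cs arbitrary: c i)
  case Nil
  then show ?case by (simp add: us_simps)
next
  case (Cons a cs)
  obtain s r v where a: "a = (s, r, v)" by (cases a)
  let ?x = "\<lambda>i. if i < r then c i else 0"
  have "lincomb c (map (\<lambda>j. (F ^^ j) v) [0..<r]) = h r v ?x" unfolding h_lincomb by (rule lincomb_cong) simp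
  then have 0: "h r v ?x + lincomb (\<lambda>i. c (i + r)) (us cs) = 0"
    using Cons.prems(2) unfolding a us_simps lincomb_append by simp
  then have "h r v ?x = lincomb (\<lambda>i. (-1) * c (i + r)) (us cs)"
    unfolding lincomb_sm[symmetric] by (simp add: sm_simps add_eq_0_iff2)
  then have "h r v ?x \<in> spc cs" unfolding spc_iff by blast
  moreover have "?x \<in> carr r" by (simp add: carr_def)
  ultimately have x0: "?x = 0" using Cons.prems(1) a by auto
  then have "lincomb (\<lambda>i. c (i + r)) (us cs) = 0" using 0 by (simp only: h_0) simp
  then have "c (j + r) = 0" if "j < length (us cs)" for j using Cons.IH Cons.prems(1) a that by force
  moreover have "c j = 0" if "j < r" for j using fun_cong[OF x0, of j] that by (simp add: pointwise)
  ultimately show ?case using Cons.prems(3) a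
    by (cases "i < r") (auto simp: us_simps dest: spec[of _ "i - r"], metis add.commute le_add_diff_inverse less_diff_conv2 not_less)
qed

lemma indc_length: "indc cs \<Longrightarrow> \<forall>c\<in>set cs. chain c \<Longrightarrow> length (us cs) \<le> n"
  using dependent_in_carr[OF us_carr, of cs] indc_lincomb[of cs] by (metis not_le)

lemma spc_subspace: "subspace_of (spc cs)"
  unfolding subspace_of_def spc_iff
proof (intro conjI ballI allI)
  show "\<exists>c. 0 = lincomb c (us cs)" by (intro exI[of _ "\<lambda>_. 0"]) (simp add: lincomb_def sm_simps)
qed (auto simp: spc_iff lincomb_add lincomb_sm)

lemma spc_carr: "\<forall>c\<in>set cs. chain c \<Longrightarrow> spc cs \<subseteq> carr n"
proof
  fix u assume "\<forall>c\<in>set cs. chain c" "u \<in> spc cs"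
  then show "u \<in> carr n" unfolding spc_iff using lincomb_in[OF carr_subspace us_carr] by auto
qed

lemma spc_length: assumes ch: "\<forall>c\<in>set cs. chain c" and ind: "indc cs" and all: "spc cs = carr n"
  shows "length (us cs) = n"
proof (rule ccontr)
  assume "length (us cs) \<noteq> n"
  then have lt: "length (us cs) < n" using indc_length[OF ind ch] by simp
  define e :: "nat \<Rightarrow> nat \<Rightarrow> 'l" where "e i = (\<lambda>j. if j = i then 1 else 0)" for i
  have "\<exists>c. e i = lincomb c (us cs)" if "i < n" for i
    using that all unfolding spc_iff[symmetric] by (simp add: carr_def e_def)
  then obtain c where c: "\<And>i. i < n \<Longrightarrow> e i = lincomb (c i) (us cs)" by metis
  obtain g where g: "\<exists>i\<in>{..<n}. g i \<noteq> 0" "\<forall>j\<in>{..<length (us cs)}. (\<Sum>i\<in>{..<n}. g i * c i j) = 0"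
    using homogeneous_system[OF subfield_UNIV, of "{..<length (us cs)}" "{..<n}" c] lt by auto
  have "(\<Sum>i<n. sm (g i) (e i)) = (\<Sum>i<n. \<Sum>j<length (us cs). sm (g i * c i j) (us cs ! j))"
    using c by (intro sum.cong) (auto simp: lincomb_def sm_sum sm_simps)
  also have "\<dots> = (\<Sum>j<length (us cs). sm (\<Sum>i<n. g i * c i j) (us cs ! j))"
    by (subst sum.swap) (auto simp: fun_eq_iff pointwise sum_distrib_right intro!: sum.cong)
  also have "\<dots> = 0" using g(2) by (simp add: sm_simps)
  finally have 0: "(\<Sum>i<n. sm (g i) (e i)) = 0" .
  have "g j = 0" if "j < n" for j
    using fun_cong[OF 0, of j] that by (simp add: pointwise e_def if_distrib[of "\<lambda>x. _ * x"] cong: if_cong)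
  then show False using g(1) by auto
qed

lemma iso_E: "chain (s, r, v) \<Longrightarrow> simple_iso val \<sigma> \<pi> s r"
  using pi_nz val_pi by unfold_locales (auto simp: chain_def)

end

lemma (in simple_iso) V_carr: "V = carr r"
  by (simp add: V_def carr_def)

context isocrystal
begin

lemma h_T:
  assumes "chain (s, r, v)"
  shows "h r v (simple_iso.T \<sigma> \<pi> s r x) = F (h r v x)"
proof -
  interpret E: simple_iso val \<sigma> \<pi> s r by (rule iso_E[OF assms])
  obtain r' where r: "r = Suc r'" using E.r_pos by (cases r) auto
  have top: "F ((F ^^ r') v) = sm (\<pi> powi s) v"
    using assms by (simp add: chain_def r)
  have "F (h r v x) = (\<Sum>j<r. sm (\<sigma> (x j)) ((F ^^ Suc j) v))"
    by (simp only: h_def T_sum T_sm funpow.simps o_apply)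
  also have "\<dots> = (\<Sum>j<r'. sm (\<sigma> (x j)) ((F ^^ Suc j) v)) + sm (\<pi> powi s * \<sigma> (x r')) v"
    by (simp add: r top sm_simps mult.commute)
  also have "\<dots> = h r v (E.T x)"
  proof -
    have TS: "E.T x (Suc j) = \<sigma> (x j)" if "j < r'" for j
      unfolding E.T_def using that by (simp add: r)
    have T0: "E.T x 0 = \<pi> powi s * \<sigma> (x r')" unfolding E.T_def by (simp add: r)
    have hy: "h r v y = (\<Sum>j<r'. sm (\<sigma> (x j)) ((F ^^ Suc j) v)) + sm (\<pi> powi s * \<sigma> (x r')) v"
      if "y 0 = \<pi> powi s * \<sigma> (x r')" "\<And>j. j < r' \<Longrightarrow> y (Suc j) = \<sigma> (x j)" for y
      unfolding h_def r sum.lessThan_Suc_shift by (simp add: that add.commute)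
    show ?thesis by (rule hy[OF T0 TS, symmetric])
  qed
  finally show ?thesis by simp
qed

lemma h_Tk: "chain (s, r, v) \<Longrightarrow> h r v ((simple_iso.T \<sigma> \<pi> s r ^^ k) x) = (F ^^ k) (h r v x)"
  by (induction k) (simp_all only: funpow.simps o_apply id_apply h_T)

lemma h_Q:
  assumes "chain (s, r, v)"
  shows "h r v (semilinear.Q (simple_iso.T \<sigma> \<pi> s r) a d x) = Q a d (h r v x)"
proof -
  interpret E: simple_iso val \<sigma> \<pi> s r by (rule iso_E[OF assms])
  show ?thesis by (simp only: E.Q_def Q_def h_sum h_sm h_Tk[OF assms])
qed

lemma F_spc: "\<forall>c\<in>set cs. chain c \<Longrightarrow> u \<in> spc cs \<Longrightarrow> F u \<in> spc cs"
proof (induction cs arbitrary: u)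
  case (Cons a cs)
  obtain s r v where a: "a = (s, r, v)" by (cases a)
  have ch: "chain (s, r, v)" using Cons.prems a by simp
  interpret E: simple_iso val \<sigma> \<pi> s r by (rule iso_E[OF ch])
  obtain x w where xw: "x \<in> carr r" "w \<in> spc cs" "u = h r v x + w" using Cons.prems a by auto
  have "F u = h r v (E.T x) + F w" unfolding xw(3) T_add h_T[OF ch] ..
  moreover have "F w \<in> spc cs" using Cons xw by simp
  moreover have "E.T x \<in> carr r" using E.T_V E.V_carr by simp
  ultimately show ?case using a by auto
qed simp

text \<open>The equation is solved summand by summand: \<open>h r v\<close> intertwines the operator
  on the simple isocrystal with the one on \<open>spc\<close>.\<close>

lemma Q_surj_spc: "\<forall>c\<in>set cs. chain c \<Longrightarrow> j \<le> d \<Longrightarrow> a j \<noteq> 0 \<Longrightarrow> z \<in> spc cs \<Longrightarrow> \<exists>x\<in>spc cs. Q a d x = z"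
proof (induction cs arbitrary: z)
  case Nil
  then show ?case by (simp add: Q_0)
next
  case (Cons b cs)
  obtain s r v where b: "b = (s, r, v)" by (cases b)
  have ch: "chain (s, r, v)" using Cons.prems b by simp
  interpret E: simple_iso val \<sigma> \<pi> s r by (rule iso_E[OF ch])
  obtain x w where xw: "x \<in> carr r" "w \<in> spc cs" "z = h r v x + w" using Cons.prems b by auto
  obtain y where y: "y \<in> carr r" "E.Q a d y = x"
    using E.Q_surj[of j d a x] Cons.prems(2,3) xw(1) E.V_carr by auto
  obtain w' where w': "w' \<in> spc cs" "Q a d w' = w" using Cons xw by auto
  have "Q a d (h r v y + w') = z" unfolding Q_add h_Q[OF ch, symmetric] y(2) w'(2) xw(3) ..
  moreover have "h r v y + w' \<in> spc (b # cs)" using b y(1) w'(1) by auto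
  ultimately show ?case by blast
qed

text \<open>\<open>F\<close> is itself a skew polynomial, hence surjective on \<open>spc cs\<close>;
  together with injectivity on \<open>carr n\<close> this makes \<open>F\<close> injective modulo
  \<open>spc cs\<close>.\<close>

lemma F_cancel:
  assumes ch: "\<forall>c\<in>set cs. chain c" and u: "u \<in> carr n" "F u \<in> spc cs"
  shows "u \<in> spc cs"
proof -
  define a :: "nat \<Rightarrow> 'l" where "a i = (if i = 1 then 1 else 0)" for i
  have Q1: "Q a (Suc 0) x = F x" for x by (simp add: Q_def a_def sm_simps)
  obtain x where x: "x \<in> spc cs" "F x = F u"
    using Q_surj_spc[OF ch, of "Suc 0" "Suc 0" a "F u"] u(2) by (auto simp: Q1 a_def)
  have "F (u - x) = 0" using x(2) by (simp add: T_diff)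
  moreover have "u - x \<in> carr n" using x(1) u(1) spc_carr[OF ch] subspace_ofD(5)[OF carr_subspace] by blast
  ultimately show ?thesis using F_inj[of "u - x"] x(1) by simp
qed

lemma Fk_cancel: "\<forall>c\<in>set cs. chain c \<Longrightarrow> u \<in> carr n \<Longrightarrow> (F ^^ k) u \<in> spc cs \<Longrightarrow> u \<in> spc cs"
proof (induction k)
  case (Suc k)
  then show ?case using F_cancel[of cs "(F ^^ k) u"] Fk_carr by simp
qed simp

section \<open>Relations modulo an invariant subspace and the lifting of simple quotients\<close>

definition rel :: "(nat \<Rightarrow> 'l) set \<Rightarrow> (nat \<Rightarrow> 'l) \<Rightarrow> nat \<Rightarrow> bool" where
  "rel X u d \<longleftrightarrow> (\<exists>a. (F ^^ d) u + (\<Sum>i<d. sm (a i) ((F ^^ i) u)) \<in> X)"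

lemma top_relation:
  assumes X: "subspace_of X" and "(\<Sum>i<m. sm (c i) ((F ^^ i) u)) \<in> X" "i < m" "c i \<noteq> 0"
  shows "\<exists>k<m. rel X u k"
proof -
  let ?I = "{i. i < m \<and> c i \<noteq> 0}"
  define k where "k = Max ?I"
  have "k \<in> ?I" unfolding k_def using assms by (intro Max_in) auto
  then have k: "k < m" "c k \<noteq> 0" by auto
  have above: "c j = 0" if "k < j" "j < m" for j
  proof (rule ccontr)
    assume "c j \<noteq> 0"
    then have "j \<le> k" unfolding k_def using that(2) by (intro Max_ge) auto
    then show False using that(1) by simp
  qed
  have "(\<Sum>i<m. sm (c i) ((F ^^ i) u)) = (\<Sum>i<Suc k. sm (c i) ((F ^^ i) u))"
    using k(1) above by (intro sum.mono_neutral_right) (auto simp: sm_simps)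
  then have "sm (inverse (c k)) ((\<Sum>i<k. sm (c i) ((F ^^ i) u)) + sm (c k) ((F ^^ k) u)) \<in> X"
    using assms(2) by (auto intro: subspace_ofD[OF X])
  also have "sm (inverse (c k)) ((\<Sum>i<k. sm (c i) ((F ^^ i) u)) + sm (c k) ((F ^^ k) u))
      = (F ^^ k) u + (\<Sum>i<k. sm (inverse (c k) * c i) ((F ^^ i) u))"
    using k(2) by (simp add: sm_simps sm_sum add.commute)
  finally show ?thesis unfolding rel_def using k(1) by (intro exI[of _ k] conjI exI[of _ "\<lambda>i. inverse (c k) * c i"])
qed

lemma ex_relation:
  assumes X: "subspace_of X" and u: "u \<in> carr n"
  shows "\<exists>k. rel X u k"
proof -
  have "set (map (\<lambda>i. (F ^^ i) u) [0..<Suc n]) \<subseteq> carr n" using Fk_carr[OF u] by auto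
  from dependent_in_carr[OF this] obtain c i where
    "lincomb c (map (\<lambda>i. (F ^^ i) u) [0..<Suc n]) = 0" "i < Suc n" "c i \<noteq> 0" by auto
  moreover have "lincomb c (map (\<lambda>i. (F ^^ i) u) [0..<Suc n]) = (\<Sum>i<Suc n. sm (c i) ((F ^^ i) u))"
    unfolding lincomb_def by (intro sum.cong) (auto simp del: upt_Suc)
  ultimately show ?thesis using top_relation[OF X, where m = "Suc n" and c = c and u = u and i = i]
    subspace_ofD(1)[OF X] by auto
qed

text \<open>\<open>s / r\<close> is the minimum of \<open>val (a i) / (d - i)\<close> in lowest
  terms: up to sign, the slope of the Newton polygon segment ending at the monic top term. With it,
  the terms \<open>i0\<close> and \<open>d\<close> both have least weight, as
  \<open>Q_kernel\<close> requires.\<close>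

lemma ex_slope:
  fixes a :: "nat \<Rightarrow> 'l"
  assumes "i < d" "a i \<noteq> 0"
  shows "\<exists>s r i0. r > 0 \<and> coprime s (int r) \<and> i0 < d \<and> a i0 \<noteq> 0 \<and> int r * val (a i0) = int (d - i0) * s \<and>
    (\<forall>i<d. a i = 0 \<or> int (d - i) * s \<le> int r * val (a i))"
proof -
  let ?I = "{i. i < d \<and> a i \<noteq> 0}"
  define f :: "nat \<Rightarrow> rat" where "f i = of_int (val (a i)) / of_nat (d - i)" for i
  have I: "finite ?I" "?I \<noteq> {}" using assms by auto
  define i0 where "i0 = arg_min_on f ?I"
  have *: "i0 \<in> ?I" "\<not> (\<exists>i\<in>?I. f i < f i0)"
    using arg_min_if_finite[OF I, of f] unfolding i0_def[symmetric] by blast+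
  then have i0: "i0 < d" "a i0 \<noteq> 0" by auto
  have min: "f i0 \<le> f i" if "i < d" "a i \<noteq> 0" for i 
    using *(2) that by (intro leI notI) auto
  let ?D = "int (d - i0)" and ?v = "val (a i0)"
  define g where "g = gcd ?v ?D"
  have D: "?D > 0" using i0 by simp
  then have g: "g > 0" by (simp add: g_def gcd_pos_int)
  define s r where "s = ?v div g" and "r = nat (?D div g)"
  have gd: "g dvd ?v" "g dvd ?D" by (simp_all add: g_def)
  have "?D div g > 0" using D g gd(2) by (metis dvd_div_eq_0_iff div_int_pos_iff less_le not_le)
  then have r: "r > 0" "int r = ?D div g" by (simp_all add: r_def)
  have eqs: "?v = s * g" "?D = int r * g" using gd r by (simp_all add: s_def)
  have "coprime s (int r)"
    using div_gcd_coprime[of ?v ?D] D by (simp add: s_def r(2) g_def)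
  moreover have "int r * ?v = ?D * s" using eqs by simp
  moreover have "int (d - i) * s \<le> int r * val (a i)" if i: "i < d" "a i \<noteq> 0" for i
  proof -
    have "of_int ?v * of_nat (d - i) \<le> (of_int (val (a i)) * of_nat (d - i0) :: rat)"
      using min[OF i] i i0 by (simp add: f_def field_simps del: of_nat_diff)
    then have "of_int (?v * int (d - i)) \<le> (of_int (val (a i) * ?D) :: rat)" by (simp del: of_nat_diff)
    then have "?v * int (d - i) \<le> val (a i) * ?D" by linarith
    then have "g * (int (d - i) * s) \<le> g * (int r * val (a i))" unfolding eqs by (simp add: mult_ac)
    then show ?thesis using g by simp
  qed
  ultimately show ?thesis using r(1) i0 by blast
qed

lemma ex_new_chain:
  assumes ch: "\<forall>c\<in>set cs. chain c" and v: "v \<in> carr n" "v \<notin> spc cs"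
  shows "\<exists>s r u. chain (s, r, u) \<and> u \<notin> spc cs"
proof -
  define X where "X = spc cs"
  have X: "subspace_of X" by (simp add: X_def spc_subspace)
  note sub = subspace_ofD[OF X]
  have XF: "F x \<in> X" if "x \<in> X" for x using F_spc[OF ch] that by (simp add: X_def)
  \<comment> \<open>The degree is minimal among all vectors outside \<open>X\<close>, not just for
    \<open>v\<close>. Hence the first \<open>d\<close> iterates of any such vector are independent
    modulo \<open>X\<close>; \<open>G_ker\<close> uses this for another vector.\<close>
  define d where "d = (LEAST d. \<exists>v. v \<in> carr n \<and> v \<notin> X \<and> rel X v d)"
  have "\<exists>d v. v \<in> carr n \<and> v \<notin> X \<and> rel X v d" using v ex_relation[OF X v(1)] by (auto simp: X_def)
  from LeastI_ex[OF this] obtain v where v: "v \<in> carr n" "v \<notin> X" "rel X v d" by (auto simp: d_def)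
  have minimal: "\<not> rel X u k" if "u \<in> carr n" "u \<notin> X" "k < d" for u k
    using not_less_Least[of k "\<lambda>d. \<exists>v. v \<in> carr n \<and> v \<notin> X \<and> rel X v d"] that by (auto simp: d_def)
  have indep: "c i = 0"
    if "u \<in> carr n" "u \<notin> X" "(\<Sum>i<d. sm (c i) ((F ^^ i) u)) \<in> X" "i < d" for u c i
    using top_relation[OF X that(3,4)] minimal[OF that(1,2)] by blast
  obtain a where a: "(F ^^ d) v + (\<Sum>i<d. sm (a i) ((F ^^ i) v)) \<in> X" using v(3) by (auto simp: rel_def)
  have "\<exists>i<d. a i \<noteq> 0"
  proof (rule ccontr)
    assume "\<not> ?thesis"
    then have "(F ^^ d) v \<in> X" using a by (simp add: sm_simps)
    then show False using Fk_cancel[OF ch v(1)] v(2) by (simp add: X_def)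
  qed
  then obtain s r i0 where r: "r > 0" "coprime s (int r)" and i0: "i0 < d" "a i0 \<noteq> 0"
    "int r * val (a i0) = int (d - i0) * s"
    and slope: "\<And>i. i < d \<Longrightarrow> a i = 0 \<or> int (d - i) * s \<le> int r * val (a i)"
    using ex_slope by metis
  interpret E: simple_iso val \<sigma> \<pi> s r using r pi_nz val_pi by unfold_locales auto
  define A where "A i = (if i = d then 1 else a i)" for i
  \<comment> \<open>A nonzero vector of the simple isocrystal satisfying the same relation as
    \<open>v\<close> does modulo \<open>X\<close>.\<close>
  obtain w where w: "w \<in> E.V" "w \<noteq> 0" "E.Q A d w = 0"
  proof -
    have "A i = 0 \<or> int d * s \<le> int r * val (A i) + int i * s" if "i \<le> d" for i
      using slope[of i] that by (cases "i = d") (auto simp: A_def of_nat_diff left_diff_distrib)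
    moreover have "A i0 \<noteq> 0" "int r * val (A i0) + int i0 * s = int d * s"
      using i0 by (auto simp: A_def of_nat_diff left_diff_distrib)
    moreover have "A d \<noteq> 0" "int r * val (A d) + int d * s = int d * s" by (auto simp: A_def)
    ultimately show thesis using E.Q_kernel[of d A "int d * s" i0 d] i0(1) that by blast
  qed
  have wd: "(E.T ^^ d) w = (\<Sum>i<d. sm (- a i) ((E.T ^^ i) w))"
  proof -
    have "(\<Sum>i<d. sm (A i) ((E.T ^^ i) w)) + sm (A d) ((E.T ^^ d) w) = 0"
      using w(3) by (simp add: E.Q_def lessThan_Suc_atMost[symmetric])
    moreover have "(\<Sum>i<d. sm (A i) ((E.T ^^ i) w)) = (\<Sum>i<d. sm (a i) ((E.T ^^ i) w))"
      by (intro sum.cong) (auto simp: A_def)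
    ultimately show ?thesis by (simp add: A_def sm_simps sum_negf add_eq_0_iff)
  qed
  \<comment> \<open>The graph of the semilinear-equivariant linear map sending the iterates of
    \<open>v\<close> to those of \<open>w\<close> and \<open>X\<close> to 0. \<open>G_fun\<close>
    gives uniqueness of values, \<open>G_F\<close> compatibility with the operators, and
    \<open>G_ker\<close> injectivity modulo \<open>X\<close>.\<close>
  define G where "G u z \<longleftrightarrow> (\<exists>c. u - (\<Sum>i<d. sm (c i) ((F ^^ i) v)) \<in> X \<and> z = (\<Sum>i<d. sm (c i) ((E.T ^^ i) w)))" for u z
  have G_add: "G (u + u') (z + z')" if "G u z" "G u' z'" for u z u' z'
  proof -
    from that obtain c c' where c: "u - (\<Sum>i<d. sm (c i) ((F ^^ i) v)) \<in> X" "z = (\<Sum>i<d. sm (c i) ((E.T ^^ i) w))"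
      "u' - (\<Sum>i<d. sm (c' i) ((F ^^ i) v)) \<in> X" "z' = (\<Sum>i<d. sm (c' i) ((E.T ^^ i) w))" by (auto simp: G_def)
    have eq: "u + u' - (\<Sum>i<d. sm (c i + c' i) ((F ^^ i) v))
      = (u - (\<Sum>i<d. sm (c i) ((F ^^ i) v))) + (u' - (\<Sum>i<d. sm (c' i) ((F ^^ i) v)))"
      by (simp add: sm_simps sum.distrib)
    show ?thesis unfolding G_def
      by (intro exI[of _ "\<lambda>i. c i + c' i"], simp only: eq sub(2)[OF c(1,3)])
        (simp add: c(2,4) sm_simps sum.distrib)
  qed
  have G_sm: "G (sm b u) (sm b z)" if "G u z" for u z b
  proof -
    from that obtain c where c: "u - (\<Sum>i<d. sm (c i) ((F ^^ i) v)) \<in> X" "z = (\<Sum>i<d. sm (c i) ((E.T ^^ i) w))"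
      by (auto simp: G_def)
    have eq: "sm b u - (\<Sum>i<d. sm (b * c i) ((F ^^ i) v)) = sm b (u - (\<Sum>i<d. sm (c i) ((F ^^ i) v)))"
      by (simp add: sm_simps sm_sum)
    show ?thesis unfolding G_def
      by (intro exI[of _ "\<lambda>i. b * c i"], simp only: eq sub(3)[OF c(1)]) (simp add: c(2) sm_simps sm_sum)
  qed
  have G_X: "G x 0" if "x \<in> X" for x unfolding G_def using that by (intro exI[of _ "\<lambda>_. 0"]) (simp add: sm_simps)
  have G_sum: "G (sum f I) (sum g I)" if "\<And>i. i \<in> I \<Longrightarrow> G (f i) (g i)" for f g and I :: "nat set"
    using that
  proof (induction I rule: infinite_finite_induct)
    case (insert x I)
    then show ?case using G_add[of "f x" "g x" "sum f I" "sum g I"] by simp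
  qed (simp_all add: G_X sub(1))
  have G_basis: "G ((F ^^ i) v) ((E.T ^^ i) w)" if "i < d" for i
  proof -
    let ?c = "\<lambda>j. if j = i then 1 else 0 :: 'l"
    have eq: "(\<Sum>j<d. sm (?c j) (f j)) = f i" for f :: "nat \<Rightarrow> nat \<Rightarrow> 'l"
    proof -
      have "(\<Sum>j<d. sm (?c j) (f j)) = (\<Sum>j<d. if j = i then f j else 0)"
        by (intro sum.cong) (auto simp: sm_simps)
      then show ?thesis using that by simp
    qed
    show ?thesis unfolding G_def by (intro exI[of _ ?c]) (simp only: eq, simp add: sub(1))
  qed
  have G_d: "G ((F ^^ d) v) ((E.T ^^ d) w)"
    unfolding G_def using a wd by (intro exI[of _ "\<lambda>i. - a i"]) (simp add: sm_simps sum_negf)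
  have G_F: "G (F u) (E.T z)" if uz: "G u z" for u z
  proof -
    from uz obtain c where c: "u - (\<Sum>i<d. sm (c i) ((F ^^ i) v)) \<in> X" "z = (\<Sum>i<d. sm (c i) ((E.T ^^ i) w))"
      by (auto simp: G_def)
    have "G ((F ^^ Suc i) v) ((E.T ^^ Suc i) w)" if "i < d" for i
      using G_basis[of "Suc i"] G_d that by (cases "Suc i = d") (auto simp del: funpow.simps)
    then have "G (\<Sum>i<d. sm (\<sigma> (c i)) ((F ^^ Suc i) v)) (\<Sum>i<d. sm (\<sigma> (c i)) ((E.T ^^ Suc i) w))"
      by (intro G_sum G_sm) auto
    moreover have "E.T z = (\<Sum>i<d. sm (\<sigma> (c i)) ((E.T ^^ Suc i) w))"
      by (simp only: c(2) E.T_sum E.T_sm funpow.simps o_apply)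
    moreover have "F (\<Sum>i<d. sm (c i) ((F ^^ i) v)) = (\<Sum>i<d. sm (\<sigma> (c i)) ((F ^^ Suc i) v))"
      by (simp only: T_sum T_sm funpow.simps o_apply)
    ultimately have "G (F (\<Sum>i<d. sm (c i) ((F ^^ i) v))) (E.T z)" by simp
    from G_add[OF this G_X[OF XF[OF c(1)]]] show ?thesis by (simp add: T_diff)
  qed
  have G_Fk: "G ((F ^^ k) u) ((E.T ^^ k) z)" if "G u z" for u z k
    using that by (induction k) (simp_all add: G_F)
  have G_fun: "z = 0" if uz: "G u z" "u \<in> X" for u z
  proof -
    from uz obtain c where c: "u - (\<Sum>i<d. sm (c i) ((F ^^ i) v)) \<in> X" "z = (\<Sum>i<d. sm (c i) ((E.T ^^ i) w))"
      by (auto simp: G_def)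
    have "(\<Sum>i<d. sm (c i) ((F ^^ i) v)) \<in> X" using sub(5)[OF uz(2) c(1)] by simp
    then have "c i = 0" if "i < d" for i using indep[OF v(1,2)] that by blast
    then show ?thesis using c(2) by (simp add: sm_simps)
  qed
  have G_carr: "u \<in> carr n" if uz: "G u z" for u z
  proof -
    from uz obtain c where "u - (\<Sum>i<d. sm (c i) ((F ^^ i) v)) \<in> X" by (auto simp: G_def)
    then have 1: "u - (\<Sum>i<d. sm (c i) ((F ^^ i) v)) \<in> carr n" using spc_carr[OF ch] by (auto simp: X_def)
    have 2: "(\<Sum>i<d. sm (c i) ((F ^^ i) v)) \<in> carr n"
      using Fk_carr[OF v(1)] by (intro subspace_of_sum[OF carr_subspace] subspace_ofD(3)[OF carr_subspace])
    show ?thesis using subspace_ofD(2)[OF carr_subspace 1 2] by simp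
  qed
  have d0: "0 < d" using i0 by simp
  \<comment> \<open>A kernel vector \<open>u\<close> outside \<open>X\<close> would have all its
    iterates in the kernel. By minimality of \<open>d\<close> the first \<open>d\<close> of them
    would already span everything modulo \<open>X\<close>, including \<open>v\<close>, although
    \<open>v\<close> goes to \<open>w\<close>, which is not 0.\<close>
  have G_ker: "u \<in> X" if u0: "G u 0" for u
  proof (rule ccontr)
    assume uX: "u \<notin> X"
    have u: "u \<in> carr n" by (rule G_carr[OF u0])
    have "\<forall>k. \<exists>c. (F ^^ k) u - (\<Sum>i<d. sm (c i) ((F ^^ i) v)) \<in> X \<and> (\<Sum>i<d. sm (c i) ((E.T ^^ i) w)) = 0"
    proof
      fix k
      have "G ((F ^^ k) u) ((E.T ^^ k) 0)" by (rule G_Fk[OF u0])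
      then have "G ((F ^^ k) u) 0" by (simp only: E.Tk_0)
      then obtain c where c: "(F ^^ k) u - (\<Sum>i<d. sm (c i) ((F ^^ i) v)) \<in> X"
        "0 = (\<Sum>i<d. sm (c i) ((E.T ^^ i) w))" unfolding G_def by blast
      show "\<exists>c. (F ^^ k) u - (\<Sum>i<d. sm (c i) ((F ^^ i) v)) \<in> X \<and> (\<Sum>i<d. sm (c i) ((E.T ^^ i) w)) = 0"
        using c(1) c(2)[symmetric] by blast
    qed
    from choice[OF this] obtain C where C: "\<And>k. (F ^^ k) u - (\<Sum>i<d. sm (C k i) ((F ^^ i) v)) \<in> X"
      "\<And>k. (\<Sum>i<d. sm (C k i) ((E.T ^^ i) w)) = 0" by blast
    \<comment> \<open>Rows below \<open>d\<close> hold the coordinates of the iterates of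
      \<open>u\<close>, row \<open>d\<close> those of \<open>v\<close>. A dependence of these
      \<open>d + 1\<close> rows, mapped to the simple isocrystal, kills the coefficient of
      \<open>v\<close>; what remains is a forbidden relation for \<open>u\<close>.\<close>
    define C' where "C' k i = (if k = d then if i = 0 then 1 else 0 else C k i)" for k i
    obtain g where g: "\<exists>k\<in>{..d}. g k \<noteq> 0" "\<forall>i\<in>{..<d}. (\<Sum>k\<in>{..d}. g k * C' k i) = 0"
      using homogeneous_system[OF subfield_UNIV, of "{..<d}" "{..d}" C'] by auto
    have comb: "sm (g d) (f 0) + (\<Sum>k<d. sm (g k) (\<Sum>i<d. sm (C k i) (f i))) = 0"
      for f :: "nat \<Rightarrow> nat \<Rightarrow> 'l"
    proof -
      have "(\<Sum>i<d. sm (C' d i) (f i)) = (\<Sum>i<d. if i = 0 then f i else 0)"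
        by (intro sum.cong) (auto simp: C'_def sm_simps)
      then have "(\<Sum>i<d. sm (C' d i) (f i)) = f 0" using d0 by simp
      moreover have "(\<Sum>k<d. sm (g k) (\<Sum>i<d. sm (C' k i) (f i))) = (\<Sum>k<d. sm (g k) (\<Sum>i<d. sm (C k i) (f i)))"
        by (intro sum.cong) (auto simp: C'_def)
      ultimately have "sm (g d) (f 0) + (\<Sum>k<d. sm (g k) (\<Sum>i<d. sm (C k i) (f i)))
          = (\<Sum>k\<le>d. sm (g k) (\<Sum>i<d. sm (C' k i) (f i)))"
        by (simp add: lessThan_Suc_atMost[symmetric] add.commute)
      also have "\<dots> = (\<Sum>i<d. \<Sum>k\<le>d. sm (g k * C' k i) (f i))"
        unfolding sm_sum sm_simps by (rule sum.swap)
      also have "\<dots> = (\<Sum>i<d. sm (\<Sum>k\<le>d. g k * C' k i) (f i))"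
        by (intro sum.cong) (auto simp: fun_eq_iff pointwise sum_distrib_right)
      also have "\<dots> = 0" using g(2) by (simp add: sm_simps)
      finally show ?thesis .
    qed
    have "sm (g d) w = 0" using comb[of "\<lambda>i. (E.T ^^ i) w"] by (simp add: C(2) sm_simps)
    then have gd: "g d = 0" using sm_eq_0 w(2) by blast
    have "(\<Sum>k<d. sm (g k) ((F ^^ k) u - (\<Sum>i<d. sm (C k i) ((F ^^ i) v)))) \<in> X"
      by (intro subspace_of_sum[OF X] sub(3) C)
    also have "(\<Sum>k<d. sm (g k) ((F ^^ k) u - (\<Sum>i<d. sm (C k i) ((F ^^ i) v)))) = (\<Sum>k<d. sm (g k) ((F ^^ k) u))"
      using comb[of "\<lambda>i. (F ^^ i) v"] by (simp add: sm_simps(6) sum_subtractf gd sm_simps(1))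
    finally have "g k = 0" if "k < d" for k using indep[OF u uX] that by blast
    then show False using g(1) gd by (metis atMost_iff le_neq_implies_less)
  qed
  \<comment> \<open>Since \<open>w\<close> generates, a preimage \<open>u0\<close> of the first
    basis vector is obtained by the same combination of iterates of \<open>v\<close>.\<close>
  obtain c where c: "E.e0 = (\<Sum>i<r. sm (c i) ((E.T ^^ i) w))"
    using E.cyclic_spans[OF w(1,2) E.e0(1)] by blast
  define u0 where "u0 = (\<Sum>i<r. sm (c i) ((F ^^ i) v))"
  have "G v w" using G_basis[OF d0] by simp
  then have G0: "G u0 E.e0" unfolding u0_def c by (intro G_sum G_sm G_Fk)
  have "G ((F ^^ r) u0 + sm (- (\<pi> powi s)) u0) ((E.T ^^ r) E.e0 + sm (- (\<pi> powi s)) E.e0)"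
    by (intro G_add G_sm G_Fk G0)
  then have "G ((F ^^ r) u0 + sm (- (\<pi> powi s)) u0) 0" by (simp add: E.Tr_e0 sm_simps)
  then have diff: "(F ^^ r) u0 + sm (- (\<pi> powi s)) u0 \<in> X" by (rule G_ker)
  \<comment> \<open>The operator \<open>F ^^ r - \<pi> powi s\<close>. Its value at
    \<open>u0\<close> lies in \<open>X\<close>, and surjectivity on \<open>X\<close> allows it to be
    corrected to 0.\<close>
  define q where "q i = (if i = 0 then - (\<pi> powi s) else if i = r then 1 else 0)" for i
  have Qq: "Q q r x = (F ^^ r) x + sm (- (\<pi> powi s)) x" for x
  proof -
    have "(\<Sum>i\<in>{..r}. sm (q i) ((F ^^ i) x)) = (\<Sum>i\<in>{0, r}. sm (q i) ((F ^^ i) x))"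
      by (rule sum.mono_neutral_right) (auto simp: q_def sm_simps)
    then show ?thesis using r(1) by (simp add: Q_def q_def sm_simps)
  qed
  obtain x where x: "x \<in> X" "Q q r x = (F ^^ r) u0 + sm (- (\<pi> powi s)) u0"
    using Q_surj_spc[OF ch, of r r q] diff r(1) by (auto simp: X_def q_def)
  define u where "u = u0 - x"
  have "Q q r u = 0" unfolding u_def Q_diff x(2) unfolding Qq by simp
  then have Fr: "(F ^^ r) u = sm (\<pi> powi s) u" by (simp add: Qq sm_simps)
  have "u \<in> carr n" unfolding u_def using G_carr[OF G0] x(1) spc_carr[OF ch]
    by (intro subspace_ofD(5)[OF carr_subspace]) (auto simp: X_def)
  then have "chain (s, r, u)" using r Fr by (simp add: chain_def)
  moreover have "u \<notin> X"
  proof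
    assume "u \<in> X"
    then have "u0 \<in> X" using sub(2)[OF _ x(1), of u] by (simp add: u_def)
    then show False using G_fun[OF G0] E.e0(2) by blast
  qed
  ultimately show ?thesis by (auto simp: X_def)
qed

text \<open>The vectors that \<open>h r u\<close> maps into \<open>spc cs\<close> form an invariant
  subspace. If it were nonzero, it would contain the first basis vector by simplicity, whose image
  is \<open>u\<close>.\<close>

lemma new_chain_indep:
  assumes ch: "\<forall>c\<in>set cs. chain c" "chain (s, r, u)" and u: "u \<notin> spc cs" and x: "x \<in> carr r" "h r u x \<in> spc cs"
  shows "x = 0"
proof (rule ccontr)
  assume "x \<noteq> 0"
  interpret E: simple_iso val \<sigma> \<pi> s r by (rule iso_E[OF ch(2)])
  have "x \<in> E.V" using x(1) by (simp only: E.V_carr)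
  then obtain c where c: "E.e0 = (\<Sum>i<r. sm (c i) ((E.T ^^ i) x))"
    using E.cyclic_spans[OF _ \<open>x \<noteq> 0\<close> E.e0(1)] by blast
  have "h r u E.e0 = (\<Sum>i<r. sm (c i) ((F ^^ i) (h r u x)))"
    by (simp only: c h_sum h_sm h_Tk[OF ch(2)])
  also have "\<dots> \<in> spc cs"
    using Tk_closed[of "spc cs"] F_spc[OF ch(1)] x(2)
    by (intro subspace_of_sum[OF spc_subspace] subspace_ofD(3)[OF spc_subspace]) auto
  also have "h r u E.e0 = (\<Sum>j<r. if j = 0 then (F ^^ j) u else 0)"
    unfolding h_def by (intro sum.cong) (auto simp: E.e0_def sm_simps)
  also have "\<dots> = u" using E.r_pos by simp
  finally show False using u by simp
qed

theorem chain_basis: "\<exists>cs. (\<forall>c\<in>set cs. chain c) \<and> indc cs \<and> spc cs = carr n"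
proof -
  have "\<exists>cs. (\<forall>c\<in>set cs. chain c) \<and> indc cs \<and> spc cs = carr n"
    if "\<forall>c\<in>set cs. chain c" "indc cs" for cs
    using that
  proof (induction "n - length (us cs)" arbitrary: cs rule: less_induct)
    case less
    show ?case
    proof (cases "spc cs = carr n")
      case False
      then obtain v where "v \<in> carr n" "v \<notin> spc cs" using spc_carr[OF less.prems(1)] by blast
      from ex_new_chain[OF less.prems(1) this] obtain s r u where u: "chain (s, r, u)" "u \<notin> spc cs" by blast
      let ?cs = "(s, r, u) # cs"
      have ch: "\<forall>c\<in>set ?cs. chain c" using u less.prems by simp
      have ind: "indc ?cs" using new_chain_indep[OF less.prems(1) u] less.prems(2) by simp
      have "length (us ?cs) = r + length (us cs)" "r > 0" using u(1) by (auto simp: us_simps chain_def)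
      then have "n - length (us ?cs) < n - length (us cs)" using indc_length[OF ind ch] by linarith
      from less.hyps[OF this ch ind] show ?thesis .
    qed (use less.prems in blast)
  qed
  from this[of "[]"] show ?thesis by simp
qed

end

section \<open>Growth of the iterates\<close>

context valued
begin

text \<open>Slopes are rational while valuations are integers, so bounds need rounding up.\<close>

definition rge :: "rat \<Rightarrow> 'l \<Rightarrow> bool" where "rge \<theta> x \<longleftrightarrow> ge \<lceil>\<theta>\<rceil> x"

lemma rge_iff: "rge \<theta> x \<longleftrightarrow> x = 0 \<or> \<theta> \<le> of_int (val x)"
  by (simp add: rge_def vge_def ceiling_le_iff)

lemma rge_0 [simp]: "rge \<theta> 0"
  by (simp add: rge_def)

lemma rge_add: "rge \<theta> x \<Longrightarrow> rge \<theta> y \<Longrightarrow> rge \<theta> (x + y)"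
  unfolding rge_def by (rule ge_add)

lemma rge_mult: "rge \<theta> x \<Longrightarrow> rge \<eta> y \<Longrightarrow> rge (\<theta> + \<eta>) (x * y)"
  by (cases "x = 0 \<or> y = 0") (auto simp: rge_iff val_mult)

lemma rge_mono: "rge \<theta> x \<Longrightarrow> \<eta> \<le> \<theta> \<Longrightarrow> rge \<eta> x"
  by (auto simp: rge_iff)

text \<open>Membership in \<open>\<pi>\<close> to the power \<open>t\<close> times the standard
  lattice.\<close>

definition vg :: "int \<Rightarrow> (nat \<Rightarrow> 'l) \<Rightarrow> bool" where
  "vg t x \<longleftrightarrow> (\<forall>i. ge t (x i))"

lemma vg_add: "vg t x \<Longrightarrow> vg t y \<Longrightarrow> vg t (x + y)"
  by (simp add: vg_def pointwise ge_add)

lemma vg_0: "vg t 0"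
  by (simp add: vg_def pointwise)

lemma vg_sum: "(\<And>i. i \<in> I \<Longrightarrow> vg t (f i)) \<Longrightarrow> vg t (sum f I)"
  by (induction I rule: infinite_finite_induct) (simp_all add: vg_0 vg_add)

lemma vg_sm: "ge s c \<Longrightarrow> vg t x \<Longrightarrow> vg (s + t) (sm c x)"
  by (simp add: vg_def pointwise ge_mult)

lemma vg_sm_iff: "c \<noteq> 0 \<Longrightarrow> vg t (sm c x) \<longleftrightarrow> vg (t - val c) x"
  by (simp add: vg_def pointwise ge_mult_iff)

lemma vg_mono: "vg t x \<Longrightarrow> t' \<le> t \<Longrightarrow> vg t' x"
  unfolding vg_def using ge_mono by blast

lemma ex_vg:
  assumes "x \<in> carr n" "x \<noteq> 0"
  shows "\<exists>t. vg t x \<and> \<not> vg (t + 1) x"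
proof -
  let ?I = "{i. i < n \<and> x i \<noteq> 0}"
  define t where "t = Min ((\<lambda>i. val (x i)) ` ?I)"
  have "x i = 0" if "\<not> i < n" for i using assms(1) that by (simp add: carr_def)
  then have ne: "?I \<noteq> {}" and *: "i \<in> ?I" if "x i \<noteq> 0" for i using that assms(2) by (auto simp: fun_eq_iff pointwise)
  have "\<exists>i. x i \<noteq> 0" using assms(2) by (auto simp: fun_eq_iff pointwise)
  then obtain i where "i \<in> ?I" using * by blast
  then have "t \<in> (\<lambda>i. val (x i)) ` ?I" unfolding t_def by (intro Min_in) auto
  then obtain k where "k \<in> ?I" "t = val (x k)" by blast
  moreover have "t \<le> val (x i)" if "x i \<noteq> 0" for i unfolding t_def using *[OF that] by (intro Min_le) auto
  ultimately show ?thesis by (intro exI[of _ t]) (auto simp: vg_def vge_def)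
qed

end

context isocrystal
begin

text \<open>Combinations of weight at least \<open>\<theta>\<close>, where a scalar weighs its
  valuation and \<open>F\<close> weighs \<open>\<nu>\<close>. The rules below express that weights
  add.\<close>

definition Z :: "rat \<Rightarrow> (nat \<Rightarrow> 'l) \<Rightarrow> nat \<Rightarrow> rat \<Rightarrow> (nat \<Rightarrow> 'l) set" where
  "Z \<nu> u d \<theta> = {\<Sum>i<d. sm (c i) ((F ^^ i) u) | c. \<forall>i<d. rge (\<theta> - of_nat i * \<nu>) (c i)}"

lemma Z_add: "z \<in> Z \<nu> u d \<theta> \<Longrightarrow> z' \<in> Z \<nu> u d \<theta> \<Longrightarrow> z + z' \<in> Z \<nu> u d \<theta>"
proof -
  assume "z \<in> Z \<nu> u d \<theta>" "z' \<in> Z \<nu> u d \<theta>"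
  then obtain c c' where "z = (\<Sum>i<d. sm (c i) ((F ^^ i) u))" "\<forall>i<d. rge (\<theta> - of_nat i * \<nu>) (c i)"
    "z' = (\<Sum>i<d. sm (c' i) ((F ^^ i) u))" "\<forall>i<d. rge (\<theta> - of_nat i * \<nu>) (c' i)" by (auto simp: Z_def)
  then show ?thesis unfolding Z_def
    by (intro CollectI exI[of _ "\<lambda>i. c i + c' i"]) (simp add: sm_simps sum.distrib rge_add)
qed

lemma Z_sm: "rge \<eta> b \<Longrightarrow> z \<in> Z \<nu> u d \<theta> \<Longrightarrow> sm b z \<in> Z \<nu> u d (\<eta> + \<theta>)"
proof -
  assume b: "rge \<eta> b" and "z \<in> Z \<nu> u d \<theta>"
  then obtain c where c: "z = (\<Sum>i<d. sm (c i) ((F ^^ i) u))" "\<forall>i<d. rge (\<theta> - of_nat i * \<nu>) (c i)"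
    by (auto simp: Z_def)
  then have "\<forall>i<d. rge (\<eta> + \<theta> - of_nat i * \<nu>) (b * c i)"
    using rge_mult[OF b] by (simp add: add_diff_eq[symmetric])
  then show ?thesis unfolding Z_def c(1)
    by (intro CollectI exI[of _ "\<lambda>i. b * c i"]) (simp add: sm_simps sm_sum)
qed

lemma Z_0: "0 \<in> Z \<nu> u d \<theta>"
  unfolding Z_def by (intro CollectI exI[of _ "\<lambda>_. 0"]) (simp add: sm_simps)

lemma Z_sum: "(\<And>i. i \<in> I \<Longrightarrow> f i \<in> Z \<nu> u d \<theta>) \<Longrightarrow> sum f I \<in> Z \<nu> u d \<theta>"
  by (induction I rule: infinite_finite_induct) (simp_all add: Z_0 Z_add)

lemma Z_uminus: "z \<in> Z \<nu> u d \<theta> \<Longrightarrow> - z \<in> Z \<nu> u d \<theta>"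
  using Z_sm[of 0 "-1" z \<nu> u d \<theta>] by (simp add: sm_simps rge_iff)

lemma Z_diff: "z \<in> Z \<nu> u d \<theta> \<Longrightarrow> z' \<in> Z \<nu> u d \<theta> \<Longrightarrow> z - z' \<in> Z \<nu> u d \<theta>"
  using Z_add[of z \<nu> u d \<theta> "- z'"] Z_uminus by simp

lemma Z_pad: "z \<in> Z \<nu> u d \<theta> \<Longrightarrow> d \<le> d' \<Longrightarrow> z \<in> Z \<nu> u d' \<theta>"
proof -
  assume z: "z \<in> Z \<nu> u d \<theta>" and d: "d \<le> d'"
  from z obtain c where c: "z = (\<Sum>i<d. sm (c i) ((F ^^ i) u))" "\<forall>i<d. rge (\<theta> - of_nat i * \<nu>) (c i)"
    by (auto simp: Z_def)
  have "z = (\<Sum>i<d'. sm (if i < d then c i else 0) ((F ^^ i) u))"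
    unfolding c(1) using d by (intro sum.mono_neutral_cong_left) (auto simp: sm_simps)
  then show ?thesis unfolding Z_def using c(2) by auto
qed

lemma Z_basis: "i < d \<Longrightarrow> (F ^^ i) u \<in> Z \<nu> u d (of_nat i * \<nu>)"
proof -
  assume i: "i < d"
  have "(\<Sum>j<d. sm (if j = i then 1 else 0) ((F ^^ j) u)) = (\<Sum>j<d. if j = i then (F ^^ j) u else 0)"
    by (intro sum.cong) (auto simp: sm_simps)
  then have "(F ^^ i) u = (\<Sum>j<d. sm (if j = i then 1 else 0) ((F ^^ j) u))" using i by simp
  then show ?thesis unfolding Z_def by (auto simp: rge_iff intro!: exI[of _ "\<lambda>j. if j = i then 1 else 0"])
qed

lemma rge_sig: "rge \<theta> x \<Longrightarrow> rge \<theta> (\<sigma> x)"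
  by (cases "x = 0") (auto simp: rge_iff val_sig)

lemma Z_F: "z \<in> Z \<nu> u d \<theta> \<Longrightarrow> F z \<in> Z \<nu> u (Suc d) (\<theta> + \<nu>)"
proof -
  assume "z \<in> Z \<nu> u d \<theta>"
  then obtain c where c: "z = (\<Sum>i<d. sm (c i) ((F ^^ i) u))" "\<forall>i<d. rge (\<theta> - of_nat i * \<nu>) (c i)"
    by (auto simp: Z_def)
  have eq: "F z = (\<Sum>i<d. sm (\<sigma> (c i)) ((F ^^ Suc i) u))" by (simp only: c(1) T_sum T_sm funpow.simps o_apply)
  have mem: "sm (\<sigma> (c i)) ((F ^^ Suc i) u) \<in> Z \<nu> u (Suc d) (\<theta> + \<nu>)" if "i < d" for i
  proof -
    have "rge (\<theta> - of_nat i * \<nu>) (\<sigma> (c i))" using c(2) that rge_sig by blast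
    from Z_sm[OF this Z_basis[of "Suc i" "Suc d" u \<nu>]] that show ?thesis by (simp add: algebra_simps)
  qed
  show ?thesis unfolding eq using mem by (intro Z_sum) (simp only: lessThan_iff)
qed

lemma Z_Fk: "z \<in> Z \<nu> u d \<theta> \<Longrightarrow> (F ^^ k) z \<in> Z \<nu> u (d + k) (\<theta> + of_nat k * \<nu>)"
proof (induction k)
  case (Suc k)
  then show ?case using Z_F[of "(F ^^ k) z" \<nu> u "d + k" "\<theta> + of_nat k * \<nu>"] by (simp add: algebra_simps)
qed simp

text \<open>The annihilator of a vector in an extension is obtained as the product of an annihilator of its
  image in the quotient and one of the resulting vector in the subspace. Its weight, with \<open>F\<close> counted
  as \<open>\<nu>\<close>, is at least the sum of the weights.\<close>

lemma slope_relation: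
  assumes "\<forall>c\<in>set cs. chain c \<and> \<nu> \<le> of_int (fst c) / of_nat (fst (snd c))" and "u \<in> spc cs"
  shows "(F ^^ length (us cs)) u \<in> Z \<nu> u (length (us cs)) (of_nat (length (us cs)) * \<nu>)"
  using assms
proof (induction cs arbitrary: u)
  case Nil
  then show ?case by (simp add: us_simps Z_0)
next
  case (Cons a cs)
  obtain s r v where a: "a = (s, r, v)" by (cases a)
  have ch: "chain (s, r, v)" and le: "\<nu> \<le> of_int s / of_nat r" using Cons.prems(1) a by auto
  have chs: "\<forall>c\<in>set cs. chain c" using Cons.prems(1) by simp
  interpret E: simple_iso val \<sigma> \<pi> s r by (rule iso_E[OF ch])
  let ?R = "length (us cs)"
  have R: "length (us (a # cs)) = r + ?R" by (simp add: a us_simps)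
  obtain x u' where x: "x \<in> carr r" "u' \<in> spc cs" "u = h r v x + u'" using Cons.prems(2) a by auto
  have "x \<in> E.V" using x(1) by (simp only: E.V_carr)
  then obtain c where c: "(E.T ^^ r) x = (\<Sum>i<r. sm (c i) ((E.T ^^ i) x))"
    "\<And>i. i < r \<Longrightarrow> c i = 0 \<or> int (r - i) * s \<le> int r * val (c i)" using E.cyclic_relation[of x] by blast
  have hx: "(F ^^ r) (h r v x) = (\<Sum>i<r. sm (c i) ((F ^^ i) (h r v x)))"
    by (simp only: h_Tk[OF ch, symmetric] c(1) h_sum h_sm)
  define z where "z = (\<Sum>i<r. sm (c i) ((F ^^ i) u))"
  have zZ: "z \<in> Z \<nu> u r (of_nat r * \<nu>)"
  proof -
    have "rge (of_nat r * \<nu> - of_nat i * \<nu>) (c i)" if i: "i < r" for i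
    proof (cases "c i = 0")
      case False
      have "of_nat r * \<nu> - of_nat i * \<nu> = of_nat (r - i) * \<nu>" using i by (simp add: of_nat_diff left_diff_distrib)
      also have "\<dots> \<le> of_nat (r - i) * (of_int s / of_nat r)" by (rule mult_left_mono[OF le]) simp
      also have "\<dots> = of_int (int (r - i) * s) / of_nat r" by simp
      also have "\<dots> \<le> of_int (int r * val (c i)) / of_nat r"
        using c(2)[OF i] False by (intro divide_right_mono) (simp_all only: of_int_le_iff of_nat_0_le_iff simp_thms)
      also have "\<dots> = of_int (val (c i))" using E.r_pos by simp
      finally show ?thesis by (simp add: rge_iff)
    qed simp
    then show ?thesis unfolding Z_def z_def by blast
  qed
  \<comment> \<open>Applying the relation of \<open>x\<close> to \<open>u\<close> kills the
    component in the first chain, so that the induction hypothesis covers the remainder.\<close>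
  define w where "w = (F ^^ r) u - z"
  have "w = (F ^^ r) u' - (\<Sum>i<r. sm (c i) ((F ^^ i) u'))"
    unfolding w_def z_def x(3) Tk_add hx by (simp add: sm_simps sum.distrib)
  then have "w \<in> spc cs"
    using Tk_closed[of "spc cs"] F_spc[OF chs] x(2)
    by (simp only:, intro subspace_ofD(5)[OF spc_subspace] subspace_of_sum[OF spc_subspace] subspace_ofD(3)[OF spc_subspace]) auto
  then have "(F ^^ ?R) w \<in> Z \<nu> w ?R (of_nat ?R * \<nu>)" using Cons by simp
  then obtain b where b: "(F ^^ ?R) w = (\<Sum>k<?R. sm (b k) ((F ^^ k) w))"
    "\<And>k. k < ?R \<Longrightarrow> rge (of_nat ?R * \<nu> - of_nat k * \<nu>) (b k)" by (auto simp: Z_def)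
  have Fkw: "(F ^^ k) w = (F ^^ (r + k)) u - (F ^^ k) z" for k
    unfolding w_def Tk_diff by (simp add: funpow_add add.commute[of r])
  have FkwZ: "(F ^^ k) w \<in> Z \<nu> u (r + ?R) (of_nat r * \<nu> + of_nat k * \<nu>)" if k: "k < ?R" for k
  proof -
    have "(F ^^ (r + k)) u \<in> Z \<nu> u (r + ?R) (of_nat r * \<nu> + of_nat k * \<nu>)"
      using Z_basis[of "r + k" "r + ?R" u \<nu>] k by (simp add: distrib_right)
    moreover have "(F ^^ k) z \<in> Z \<nu> u (r + ?R) (of_nat r * \<nu> + of_nat k * \<nu>)"
      using Z_pad[OF Z_Fk[OF zZ, of k]] k by simp
    ultimately show ?thesis unfolding Fkw by (rule Z_diff)
  qed
  have "(F ^^ (r + ?R)) u = (\<Sum>k<?R. sm (b k) ((F ^^ k) w)) + (F ^^ ?R) z"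
    using Fkw[of ?R] b(1) by simp
  moreover have "(\<Sum>k<?R. sm (b k) ((F ^^ k) w)) \<in> Z \<nu> u (r + ?R) (of_nat (r + ?R) * \<nu>)"
  proof (rule Z_sum)
    fix k assume k: "k \<in> {..<?R}"
    then have "sm (b k) ((F ^^ k) w) \<in> Z \<nu> u (r + ?R) (of_nat ?R * \<nu> - of_nat k * \<nu> + (of_nat r * \<nu> + of_nat k * \<nu>))"
      by (intro Z_sm b(2) FkwZ) auto
    then show "sm (b k) ((F ^^ k) w) \<in> Z \<nu> u (r + ?R) (of_nat (r + ?R) * \<nu>)" by (simp add: algebra_simps)
  qed
  moreover have "(F ^^ ?R) z \<in> Z \<nu> u (r + ?R) (of_nat (r + ?R) * \<nu>)"
    using Z_Fk[OF zZ, of ?R] by (simp add: algebra_simps)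
  ultimately show ?case unfolding R by (simp only: Z_add)
qed

text \<open>Each application of \<open>F\<close> adds \<open>\<nu>\<close> to the weight; the one
  iterate that leaves the range, \<open>(F ^^ R) u\<close>, is rewritten by the relation without
  loss of weight.\<close>

lemma iterate_Z:
  assumes R: "(F ^^ R) u \<in> Z \<nu> u R (of_nat R * \<nu>)"
  shows "(F ^^ m) u \<in> Z \<nu> u R (of_nat m * \<nu>)"
proof (induction m)
  case 0
  \<comment> \<open>If \<open>R = 0\<close>, the relation says that \<open>u\<close> is 0.\<close>
  then show ?case using R Z_basis[of 0 R u \<nu>] by (cases "R = 0") auto
next
  case (Suc m)
  then obtain c where c: "(F ^^ m) u = (\<Sum>i<R. sm (c i) ((F ^^ i) u))"
    "\<forall>i<R. rge (of_nat m * \<nu> - of_nat i * \<nu>) (c i)" by (auto simp: Z_def)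
  have eq: "(F ^^ Suc m) u = (\<Sum>i<R. sm (\<sigma> (c i)) ((F ^^ Suc i) u))"
    by (simp only: funpow.simps o_apply c(1) T_sum T_sm)
  have mem: "sm (\<sigma> (c i)) ((F ^^ Suc i) u) \<in> Z \<nu> u R (of_nat (Suc m) * \<nu>)" if i: "i < R" for i
  proof -
    have "rge (of_nat m * \<nu> - of_nat i * \<nu>) (\<sigma> (c i))" using c(2) i rge_sig by blast
    moreover have "(F ^^ Suc i) u \<in> Z \<nu> u R (of_nat (Suc i) * \<nu>)"
      using R Z_basis[of "Suc i" R u \<nu>] i by (cases "Suc i = R") (auto simp del: funpow.simps)
    ultimately have "sm (\<sigma> (c i)) ((F ^^ Suc i) u)
      \<in> Z \<nu> u R ((of_nat m * \<nu> - of_nat i * \<nu>) + of_nat (Suc i) * \<nu>)" by (rule Z_sm)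
    then show ?thesis by (simp add: algebra_simps)
  qed
  show ?case unfolding eq using mem by (intro Z_sum) (simp only: lessThan_iff)
qed

end

section \<open>Estimates relative to the standard lattice\<close>

locale bounded_isocrystal = isocrystal +
  fixes c :: int
  assumes c_nonneg: "0 \<le> c"
    and F_lower: "vg t x \<Longrightarrow> vg (t - c) (F x)"
    and F_upper: "x \<in> carr n \<Longrightarrow> vg t (F x) \<Longrightarrow> vg (t - c) x"
begin

lemma Fk_lower: "vg t x \<Longrightarrow> vg (t - int k * c) ((F ^^ k) x)"
proof (induction k)
  case (Suc k)
  then show ?case using F_lower[of "t - int k * c" "(F ^^ k) x"] by (simp add: algebra_simps)
qed simp

lemma Fk_upper: "x \<in> carr n \<Longrightarrow> vg t ((F ^^ k) x) \<Longrightarrow> vg (t - int k * c) x"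
proof (induction k arbitrary: t)
  case (Suc k)
  then have "vg (t - c) ((F ^^ k) x)" using F_upper[OF Fk_carr] by simp
  from Suc.IH[OF Suc.prems(1) this] show ?case by (simp add: algebra_simps)
qed simp

text \<open>\<open>F ^^ r\<close> multiplies \<open>v\<close> by a scalar of valuation
  \<open>s\<close>, whereas each application of \<open>F\<close> moves a vector by at most
  \<open>c\<close> relative to the lattice.\<close>

lemma slope_bound:
  assumes ch: "chain (s, r, v)" and v: "v \<noteq> 0"
  shows "\<bar>s\<bar> \<le> int r * c"
proof -
  have "v \<in> carr n" and Fr: "(F ^^ r) v = sm (\<pi> powi s) v" using ch by (auto simp: chain_def)
  then obtain t where t: "vg t v" "\<not> vg (t + 1) v" using ex_vg v by blast
  have iff: "vg y (sm (\<pi> powi s) v) \<longleftrightarrow> vg (y - s) v" for y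
    using pi_nz by (simp add: vg_sm_iff val_powi val_pi)
  have "vg (t - int r * c - s) v" using Fk_lower[OF t(1), of r] unfolding Fr iff .
  then have "t - int r * c - s \<le> t" using t(2) vg_mono[of "t - int r * c - s" v "t + 1"] by force
  moreover have "t + s - int r * c \<le> t"
  proof (rule ccontr)
    assume "\<not> ?thesis"
    then have le: "t + 1 \<le> t + s - int r * c" by simp
    have "vg (t + s) ((F ^^ r) v)" unfolding Fr iff using t(1) by simp
    from Fk_upper[OF \<open>v \<in> carr n\<close> this] show False using vg_mono[OF _ le] t(2) by blast
  qed
  ultimately show ?thesis by linarith
qed

text \<open>Express \<open>(F ^^ m) u\<close> through the first iterates. One \<open>n * c\<close>
  of the error bounds the term \<open>i * \<nu>\<close> in the weight of a coefficient, the other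
  the loss of integrality of \<open>(F ^^ i) u\<close>.\<close>

lemma iterate_bound:
  fixes \<nu> :: rat
  assumes ch: "\<forall>c\<in>set cs. chain c \<and> \<nu> \<le> of_int (fst c) / of_nat (fst (snd c))" and R: "length (us cs) \<le> n"
    and u: "u \<in> spc cs" "vg 0 u" and \<nu>: "\<bar>\<nu>\<bar> \<le> of_int c"
  shows "vg \<lceil>of_nat m * \<nu> - of_int (2 * int n * c)\<rceil> ((F ^^ m) u)"
proof -
  let ?R = "length (us cs)"
  obtain a where a: "(F ^^ m) u = (\<Sum>i<?R. sm (a i) ((F ^^ i) u))"
    "\<And>i. i < ?R \<Longrightarrow> rge (of_nat m * \<nu> - of_nat i * \<nu>) (a i)"
    using iterate_Z[OF slope_relation[OF ch u(1)], of m] by (auto simp: Z_def)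
  have "vg \<lceil>of_nat m * \<nu> - of_int (2 * int n * c)\<rceil> (sm (a i) ((F ^^ i) u))" if i: "i < ?R" for i
  proof -
    have "of_nat i * \<nu> \<le> of_nat i * of_int c" using \<nu> by (intro mult_left_mono) auto
    also have "\<dots> \<le> of_nat n * of_int c" using i R c_nonneg by (intro mult_right_mono) auto
    finally have "of_nat m * \<nu> - of_int (int n * c) \<le> of_nat m * \<nu> - of_nat i * \<nu>" by simp
    then have "ge \<lceil>of_nat m * \<nu> - of_int (int n * c)\<rceil> (a i)" using rge_mono[OF a(2)[OF i]] by (simp add: rge_def)
    moreover have "int i * c \<le> int n * c" using i R c_nonneg by (intro mult_right_mono) auto
    then have "vg (- (int n * c)) ((F ^^ i) u)" using vg_mono[OF Fk_lower[OF u(2), of i]] by simp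
    ultimately have "vg (\<lceil>of_nat m * \<nu> - of_int (int n * c)\<rceil> + - (int n * c)) (sm (a i) ((F ^^ i) u))" by (rule vg_sm)
    moreover have "\<lceil>of_nat m * \<nu> - of_int (2 * int n * c)\<rceil> = \<lceil>of_nat m * \<nu> - of_int (int n * c)\<rceil> + - (int n * c)"
    proof -
      have "of_nat m * \<nu> - of_int (2 * int n * c) = (of_nat m * \<nu> - of_int (int n * c)) - of_int (int n * c)"
        by simp
      then show ?thesis by (simp only: ceiling_diff_of_int)
    qed
    ultimately show ?thesis by simp
  qed
  then show ?thesis unfolding a(1) by (intro vg_sum) simp
qed

end

section \<open>Hodge points\<close>

definition mv :: "'l::field mat \<Rightarrow> (nat \<Rightarrow> 'l) \<Rightarrow> nat \<Rightarrow> 'l" where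
  "mv A x = (\<lambda>i. if i < dim_row A then \<Sum>k<dim_col A. A $$ (i, k) * x k else 0)"

lemma mv_carr: "A \<in> carrier_mat n m \<Longrightarrow> mv A x \<in> carr n"
  by (auto simp: mv_def carr_def)

lemma mv_add: "mv A (x + y) = mv A x + mv A y"
  by (auto simp: mv_def fun_eq_iff pointwise distrib_left sum.distrib)

lemma mv_sm: "mv A (sm c x) = sm c (mv A x)"
  by (auto simp: mv_def fun_eq_iff pointwise sum_distrib_left mult_ac)

lemma mv_0: "mv A 0 = 0"
  by (simp add: mv_def fun_eq_iff pointwise)

lemma mv_sum: "mv A (sum f I) = (\<Sum>i\<in>I. mv A (f i))"
  by (induction I rule: infinite_finite_induct) (simp_all add: mv_0 mv_add)

lemma index_mult: "A \<in> carrier_mat n m \<Longrightarrow> B \<in> carrier_mat m l \<Longrightarrow> i < n \<Longrightarrow> j < l \<Longrightarrow>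
    (A * B) $$ (i, j) = (\<Sum>k<m. A $$ (i, k) * B $$ (k, j))"
  by (simp add: scalar_prod_def atLeast0LessThan)

lemma mv_mult: "A \<in> carrier_mat n m \<Longrightarrow> B \<in> carrier_mat m l \<Longrightarrow> mv (A * B) x = mv A (mv B x)"
proof
  fix i assume A: "A \<in> carrier_mat n m" and B: "B \<in> carrier_mat m l"
  show "mv (A * B) x i = mv A (mv B x) i"
  proof (cases "i < n")
    case True
    then have "mv (A * B) x i = (\<Sum>k<l. \<Sum>j<m. A $$ (i, j) * B $$ (j, k) * x k)"
      using A B by (auto simp: mv_def index_mult[OF A B] sum_distrib_right simp del: index_mult_mat(1) intro!: sum.cong)
    also have "\<dots> = (\<Sum>j<m. \<Sum>k<l. A $$ (i, j) * B $$ (j, k) * x k)" by (rule sum.swap)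
    also have "\<dots> = mv A (mv B x) i" using A B True by (simp add: mv_def sum_distrib_left mult.assoc)
    finally show ?thesis .
  qed (use A B in \<open>simp add: mv_def\<close>)
qed

lemma mv_one: "x \<in> carr n \<Longrightarrow> mv (1\<^sub>m n) x = x"
proof
  fix i assume "x \<in> carr n"
  moreover have "(\<Sum>k<n. (1\<^sub>m n) $$ (i, k) * x k) = (\<Sum>k<n. if k = i then x k else 0)" if "i < n"
    using that by (intro sum.cong) auto
  ultimately show "mv (1\<^sub>m n) x i = x i" by (auto simp: mv_def carr_def)
qed

lemma mv_diag: "mv (mat_diag n t) x = (\<lambda>i. if i < n then t i * x i else 0)"
proof
  fix i
  have "(\<Sum>k<n. mat_diag n t $$ (i, k) * x k) = (\<Sum>k<n. if k = i then t i * x k else 0)" if "i < n"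
    using that by (intro sum.cong) (auto simp: mat_diag_def)
  then show "mv (mat_diag n t) x i = (if i < n then t i * x i else 0)" by (auto simp: mv_def mat_diag_def)
qed

lemma elements_mat_subset_iff:
  "A \<in> carrier_mat n m \<Longrightarrow> elements_mat A \<subseteq> R \<longleftrightarrow> (\<forall>i<n. \<forall>j<m. A $$ (i, j) \<in> R)"
  by (auto dest!: elements_matD)

lemma GL_D: "A \<in> GL n R \<Longrightarrow> A \<in> carrier_mat n n"
  by (simp add: GL_def)

lemma GL_UNIV_det: "A \<in> GL n UNIV \<Longrightarrow> det A \<noteq> 0"
  unfolding GL_def by (auto dest!: det_mult[of A n] arg_cong[of "A * _" _ det])

section \<open>Matrices over the valuation ring\<close>

context valued
begin

abbreviation "Omat n m A \<equiv> A \<in> carrier_mat n m \<and> (\<forall>i<n. \<forall>j<m. ge 0 (A $$ (i, j)))"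

abbreviation "GLO n \<equiv> GL n (val_ring val)"

lemma GLO_iff: "A \<in> GLO n \<longleftrightarrow> Omat n n A \<and> (\<exists>B. Omat n n B \<and> A * B = 1\<^sub>m n \<and> B * A = 1\<^sub>m n)"
proof -
  have *: "X \<in> carrier_mat n n \<Longrightarrow> elements_mat X \<subseteq> val_ring val \<longleftrightarrow> (\<forall>i<n. \<forall>j<n. ge 0 (X $$ (i, j)))" for X
    by (simp add: elements_mat_subset_iff val_ring_eq)
  show ?thesis by (simp add: GL_def Bex_def * cong: conj_cong)
qed

lemma Omat_mult: "Omat n m A \<Longrightarrow> Omat m l B \<Longrightarrow> Omat n l (A * B)"
proof (intro conjI allI impI)
  assume A: "Omat n m A" and B: "Omat m l B"
  show "A * B \<in> carrier_mat n l" using A B by auto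
  fix i j assume ij: "i < n" "j < l"
  have A': "A \<in> carrier_mat n m" and B': "B \<in> carrier_mat m l" using A B by auto
  show "ge 0 ((A * B) $$ (i, j))" unfolding index_mult[OF A' B' ij]
    using A B ij by (auto intro!: ge_sum ge_mult'[of 0 _ 0])
qed

lemma GLO_mult:
  assumes "A \<in> GLO n" "B \<in> GLO n"
  shows "A * B \<in> GLO n"
proof -
  obtain A' B' where A: "Omat n n A" "Omat n n A'" "A * A' = 1\<^sub>m n" "A' * A = 1\<^sub>m n"
    and B: "Omat n n B" "Omat n n B'" "B * B' = 1\<^sub>m n" "B' * B = 1\<^sub>m n"
    using assms unfolding GLO_iff by blast
  have c: "A \<in> carrier_mat n n" "A' \<in> carrier_mat n n" "B \<in> carrier_mat n n" "B' \<in> carrier_mat n n"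
    using A B by auto
  have "(A * B) * (B' * A') = A * (B * B') * A'" using c by (simp add: assoc_mult_mat[of _ n n _ n _ n])
  then have "(A * B) * (B' * A') = 1\<^sub>m n" using A B c by simp
  moreover have "(B' * A') * (A * B) = B' * (A' * A) * B" using c by (simp add: assoc_mult_mat[of _ n n _ n _ n])
  then have "(B' * A') * (A * B) = 1\<^sub>m n" using A B c by simp
  ultimately show ?thesis unfolding GLO_iff using Omat_mult[OF A(1) B(1)] Omat_mult[OF B(2) A(2)] by blast
qed

lemma GLO_one: "1\<^sub>m n \<in> GLO n"
  unfolding GLO_iff by (intro conjI exI[of _ "1\<^sub>m n"]) auto

lemma vg_mv: "Omat n m A \<Longrightarrow> vg t x \<Longrightarrow> vg t (mv A x)"
  by (auto simp: vg_def mv_def intro!: ge_sum ge_mult'[of 0 _ t])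

text \<open>The determinants of \<open>A\<close> and of its inverse are integral with product
  1.\<close>

lemma GLO_det:
  assumes "A \<in> GLO n"
  shows "det A \<noteq> 0 \<and> val (det A) = 0"
proof -
  have O: "ge 0 (det B)" if B: "Omat n n B" for B
  proof -
    have c: "B \<in> carrier_mat n n" using B by simp
    have prod: "ge 0 (prod f I)" if "\<And>i. i \<in> I \<Longrightarrow> ge 0 (f i)" for f :: "nat \<Rightarrow> 'l" and I
      using that by (induction I rule: infinite_finite_induct) (auto intro: ge_mult'[of 0 _ 0])
    have "ge 0 (\<Prod>i = 0..<n. B $$ (i, p i))" if "p permutes {0..<n}" for p
      using B permutes_in_image[OF that] by (intro prod) auto
    then show ?thesis unfolding det_def'[OF c]
      by (intro ge_sum ge_mult'[of 0 _ 0]) (auto simp: sign_def)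
  qed
  obtain B where B: "Omat n n A" "Omat n n B" "A * B = 1\<^sub>m n" using assms unfolding GLO_iff by blast
  then have "det A * det B = 1" using det_mult[of A n B] by simp
  moreover from this have nz: "det A \<noteq> 0" "det B \<noteq> 0" by auto
  ultimately have "val (det A) + val (det B) = 0" using val_mult by fastforce
  then show ?thesis using O[OF B(1)] O[OF B(2)] nz by (auto simp: vge_def)
qed

text \<open>A subspace of too large dimension contains a primitive vector whose image under \<open>V\<close> is supported on
  the coordinates \<open>i\<close> with \<open>val (t i) < \<tau>\<close>.\<close>

lemma minmax:
  assumes U: "U \<in> GLO n" and V: "V \<in> GLO n" and A: "A = U * mat_diag n t * V" and t: "\<And>i. i < n \<Longrightarrow> t i \<noteq> 0"
    and I: "finite I" and w: "\<And>i. i \<in> I \<Longrightarrow> w i \<in> carr n"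
    and indep: "\<And>z. (\<Sum>i\<in>I. sm (z i) (w i)) = 0 \<Longrightarrow> \<forall>i\<in>I. z i = 0"
    and div: "\<And>z. vg 0 (\<Sum>i\<in>I. sm (z i) (w i)) \<Longrightarrow> vg \<tau> (mv A (\<Sum>i\<in>I. sm (z i) (w i)))"
  shows "card I \<le> card {i. i < n \<and> \<tau> \<le> val (t i)}"
proof (rule ccontr)
  let ?J = "{i. i < n \<and> \<tau> \<le> val (t i)}"
  assume "\<not> ?thesis"
  then have "card ?J < card I" by simp
  then obtain z where z: "\<exists>i\<in>I. z i \<noteq> 0" "\<forall>j\<in>?J. (\<Sum>i\<in>I. z i * mv V (w i) j) = 0"
    using homogeneous_system[OF subfield_UNIV _ I, of ?J "\<lambda>i. mv V (w i)"] by auto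
  obtain U' V' where U': "Omat n n U" "Omat n n U'" "U' * U = 1\<^sub>m n" and V': "Omat n n V" "Omat n n V'" "V' * V = 1\<^sub>m n"
    using U V unfolding GLO_iff by blast
  define x where "x = (\<Sum>i\<in>I. sm (z i) (w i))"
  have xc: "x \<in> carr n" unfolding x_def using w by (intro subspace_of_sum[OF carr_subspace] subspace_ofD(3)[OF carr_subspace])
  have "x \<noteq> 0" using indep z(1) by (auto simp: x_def)
  then obtain s where s: "vg s x" "\<not> vg (s + 1) x" using ex_vg xc by blast
  obtain p where p: "p \<noteq> 0" "val p = 1" using ex_uniformizer by blast
  \<comment> \<open>Scaling makes \<open>x\<close> primitive, and \<open>V\<close>, invertible over
    the valuation ring, keeps it primitive. So some coordinate \<open>j\<close> of \<open>q\<close>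
    is a unit; there \<open>val (t j) < \<tau>\<close>, against the divisibility of the
    image.\<close>
  define a where "a = p powi (- s)"
  have a: "a \<noteq> 0" "val a = - s" using p by (auto simp: a_def val_powi)
  define y where "y = sm a x"
  have y: "vg 0 y" "\<not> vg 1 y" "y \<in> carr n"
    using s a xc by (auto simp: y_def vg_sm_iff add.commute intro: subspace_ofD(3)[OF carr_subspace])
  define q where "q = mv V y"
  have "mv V' q = y" unfolding q_def using mv_mult[of V' n n V n y] V' y(3) by (simp add: mv_one)
  then have "\<not> vg 1 q" using vg_mv[OF V'(2), of 1 q] y(2) by auto
  then obtain j where j: "\<not> ge 1 (q j)" by (auto simp: vg_def)
  have "vg 0 q" unfolding q_def using vg_mv[OF V'(1) y(1)] .
  then have "ge 0 (q j)" by (simp add: vg_def)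
  then have qj: "q j \<noteq> 0" "val (q j) = 0" using j ge_1_iff by auto
  have jn: "j < n" using qj(1) V' by (auto simp: q_def mv_def split: if_splits)
  have "q = sm a (\<Sum>i\<in>I. sm (z i) (mv V (w i)))" by (simp only: q_def y_def x_def mv_sm mv_sum)
  then have "q k = 0" if "k \<in> ?J" for k using z(2) that by (simp add: pointwise)
  then have "val (t j) < \<tau>" using jn qj(1) by force
  have "y = (\<Sum>i\<in>I. sm (a * z i) (w i))" by (simp add: y_def x_def sm_sum sm_simps)
  then have "vg \<tau> (mv A y)" using div[of "\<lambda>i. a * z i"] y(1) by simp
  then have "vg \<tau> (mv U' (mv A y))" using vg_mv[OF U'(2)] by blast
  moreover have "mv A y = mv U (mv (mat_diag n t) q)"
  proof -
    have c: "U \<in> carrier_mat n n" "mat_diag n t \<in> carrier_mat n n" "V \<in> carrier_mat n n" using U' V' by auto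
    show ?thesis unfolding A q_def mv_mult[OF mult_carrier_mat[OF c(1,2)] c(3)] mv_mult[OF c(1,2)] ..
  qed
  then have "mv U' (mv A y) = mv (mat_diag n t) q"
    using mv_mult[of U' n n U n "mv (mat_diag n t) q", symmetric] U' mv_one[OF mv_carr[OF mat_diag_dim]]
    by simp
  ultimately have "ge \<tau> (t j * q j)" using jn by (auto simp: vg_def mv_diag split: if_splits)
  then show False using \<open>val (t j) < \<tau>\<close> qj t[OF jn] by (simp add: vge_def val_mult)
qed

section \<open>Smith normal form\<close>

definition hsim :: "nat \<Rightarrow> 'l mat \<Rightarrow> 'l mat \<Rightarrow> bool" where
  "hsim n A B \<longleftrightarrow> (\<exists>U\<in>GLO n. \<exists>V\<in>GLO n. A = U * B * V)"

lemma hsim_trans: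
  assumes "hsim n A B" "hsim n B C" "C \<in> carrier_mat n n"
  shows "hsim n A C"
proof -
  obtain U V U' V' where *: "U \<in> GLO n" "V \<in> GLO n" "U' \<in> GLO n" "V' \<in> GLO n"
    and A: "A = U * (U' * C * V') * V" using assms unfolding hsim_def by blast
  have c: "U \<in> carrier_mat n n" "V \<in> carrier_mat n n" "U' \<in> carrier_mat n n" "V' \<in> carrier_mat n n"
    using * GL_D by blast+
  have "A = (U * U') * C * (V' * V)" unfolding A using c assms(3) by (simp add: assoc_mult_mat[of _ n n _ n _ n])
  then show ?thesis unfolding hsim_def using * GLO_mult by blast
qed

definition perm :: "nat \<Rightarrow> (nat \<Rightarrow> nat) \<Rightarrow> 'l mat" where
  "perm n f = mat n n (\<lambda>(i, j). if f i = j then 1 else 0)"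

lemma perm_carrier: "perm n f \<in> carrier_mat n n"
  by (simp add: perm_def)

lemma perm_left: "A \<in> carrier_mat n m \<Longrightarrow> i < n \<Longrightarrow> j < m \<Longrightarrow> f i < n \<Longrightarrow> (perm n f * A) $$ (i, j) = A $$ (f i, j)"
proof -
  assume A: "A \<in> carrier_mat n m" and ij: "i < n" "j < m" "f i < n"
  have "(perm n f * A) $$ (i, j) = (\<Sum>k<n. perm n f $$ (i, k) * A $$ (k, j))"
    by (rule index_mult[OF perm_carrier A ij(1,2)])
  also have "\<dots> = (\<Sum>k<n. if f i = k then A $$ (k, j) else 0)"
    using ij(1) by (intro sum.cong) (auto simp: perm_def)
  finally have "(perm n f * A) $$ (i, j) = (\<Sum>k<n. if f i = k then A $$ (k, j) else 0)" .
  then show ?thesis using ij by simp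
qed

lemma perm_right: "A \<in> carrier_mat m n \<Longrightarrow> i < m \<Longrightarrow> j < n \<Longrightarrow> f j < n \<Longrightarrow> (\<And>k. f (f k) = k) \<Longrightarrow>
  (A * perm n f) $$ (i, j) = A $$ (i, f j)"
proof -
  assume A: "A \<in> carrier_mat m n" and ij: "i < m" "j < n" "f j < n" and f: "\<And>k. f (f k) = k"
  have "(A * perm n f) $$ (i, j) = (\<Sum>k<n. A $$ (i, k) * perm n f $$ (k, j))"
    by (rule index_mult[OF A perm_carrier ij(1,2)])
  also have "\<dots> = (\<Sum>k<n. if f j = k then A $$ (i, k) else 0)"
    using ij(2) f by (intro sum.cong) (auto simp: perm_def)
  finally have "(A * perm n f) $$ (i, j) = (\<Sum>k<n. if f j = k then A $$ (i, k) else 0)" .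
  then show ?thesis using ij by simp
qed

lemma perm_square: "(\<And>k. f (f k) = k) \<Longrightarrow> (\<And>k. k < n \<Longrightarrow> f k < n) \<Longrightarrow> perm n f * perm n f = 1\<^sub>m n"
proof (rule eq_matI)
  fix i j assume f: "\<And>k. f (f k) = k" "\<And>k. k < n \<Longrightarrow> f k < n"
    and "i < dim_row (1\<^sub>m n :: 'l mat)" "j < dim_col (1\<^sub>m n :: 'l mat)"
  then have ij: "i < n" "j < n" by auto
  show "(perm n f * perm n f) $$ (i, j) = 1\<^sub>m n $$ (i, j)"
    unfolding perm_left[of _ n n i j f, OF perm_carrier ij f(2)[OF ij(1)]] using ij f by (simp add: perm_def)
qed (auto simp: perm_def)

lemma perm_GLO: "(\<And>k. f (f k) = k) \<Longrightarrow> (\<And>k. k < n \<Longrightarrow> f k < n) \<Longrightarrow> perm n f \<in> GLO n"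
  unfolding GLO_iff using perm_square[of f n] by (auto simp: perm_def intro!: exI[of _ "perm n f"])

text \<open>An entry of least valuation divides all others. Transpositions move it to the corner,
  after which integral row and column operations clear its row and column; \<open>B\<close> is the
  Schur complement.\<close>

lemma smith_step:
  assumes A: "A \<in> carrier_mat (Suc n) (Suc n)" and det: "det A \<noteq> 0"
  shows "\<exists>a B. a \<noteq> 0 \<and> B \<in> carrier_mat n n \<and> det B \<noteq> 0 \<and>
    hsim (Suc n) A (four_block_mat (mat 1 1 (\<lambda>_. a)) (0\<^sub>m 1 n) (0\<^sub>m n 1) B)"
proof -
  let ?N = "Suc n"
  let ?I = "{(i, j). i < ?N \<and> j < ?N \<and> A $$ (i, j) \<noteq> 0}"
  have fin: "finite ?I" by (rule finite_subset[of _ "{..<?N} \<times> {..<?N}"]) auto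
  have "\<exists>i<?N. A $$ (i, 0) \<noteq> 0"
  proof (rule ccontr)
    assume "\<not> ?thesis"
    then have "det A = 0" using laplace_expansion_column[OF A, of 0] by simp
    then show False using det by simp
  qed
  then have ne: "?I \<noteq> {}" by auto
  define kl where "kl = arg_min_on (\<lambda>ij. val (A $$ ij)) ?I"
  obtain k l where kl': "kl = (k, l)" by (cases kl)
  have kl: "k < ?N" "l < ?N" "A $$ (k, l) \<noteq> 0"
    using arg_min_if_finite(1)[OF fin ne, of "\<lambda>ij. val (A $$ ij)"] unfolding kl_def[symmetric] kl' by auto
  have min: "ge (val (A $$ (k, l))) (A $$ (i, j))" if "i < ?N" "j < ?N" for i j
  proof (cases "A $$ (i, j) = 0")
    case False
    then have "(i, j) \<in> ?I" using that by simp
    then have "\<not> val (A $$ (i, j)) < val (A $$ (k, l))"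
      using arg_min_if_finite(2)[OF fin ne, of "\<lambda>ij. val (A $$ ij)"] unfolding kl_def[symmetric] kl' by blast
    then show ?thesis by (simp add: vge_def)
  qed simp
  define f g where "f = transpose 0 k" and "g = transpose 0 l"
  have f: "f (f i) = i" and g: "g (g i) = i" for i by (simp_all add: f_def g_def)
  have fN: "i < ?N \<Longrightarrow> f i < ?N" and gN: "i < ?N \<Longrightarrow> g i < ?N" for i
    using kl by (auto simp: f_def g_def transpose_def)
  let ?P = "perm ?N f" and ?R = "perm ?N g"
  have PR: "?P \<in> GLO ?N" "?R \<in> GLO ?N" using perm_GLO f fN g gN by auto
  have Pc: "?P \<in> carrier_mat ?N ?N" "?R \<in> carrier_mat ?N ?N" by (simp_all add: perm_carrier)
  define A' where "A' = ?P * A * ?R"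
  have A'c: "A' \<in> carrier_mat ?N ?N" using Pc A by (simp add: A'_def)
  have A': "A' $$ (i, j) = A $$ (f i, g j)" if "i < ?N" "j < ?N" for i j
    unfolding A'_def perm_right[OF mult_carrier_mat[OF Pc(1) A] that gN[OF that(2)] g]
    by (rule perm_left[of A ?N ?N i "g j" f, OF A that(1) gN[OF that(2)] fN[OF that(1)]])
  have "?P * A' * ?R = (?P * ?P) * A * (?R * ?R)"
    unfolding A'_def using Pc A by (simp add: assoc_mult_mat[of _ ?N ?N _ ?N _ ?N])
  then have AA': "A = ?P * A' * ?R" using A perm_square[of f ?N] perm_square[of g ?N] f g fN gN by simp
  then have sim1: "hsim ?N A A'" unfolding hsim_def using PR by blast
  have "det A = det ?P * det A' * det ?R"
    using AA' det_mult[OF mult_carrier_mat[OF Pc(1) A'c] Pc(2)] det_mult[OF Pc(1) A'c] by simp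
  then have det': "det A' \<noteq> 0" using det by auto
  define a where "a = A $$ (k, l)"
  have a: "a \<noteq> 0" "A' $$ (0, 0) = a" using kl by (auto simp: a_def A' f_def g_def)
  have ge_a: "ge 0 (A' $$ (i, j) / a)" if "i < ?N" "j < ?N" for i j
    using min[OF fN[OF that(1)] gN[OF that(2)]] A'[OF that] a(1)
    by (cases "A' $$ (i, j) = 0") (auto simp: vge_def val_divide a_def)
  define C where "C = mat n 1 (\<lambda>(i, j). A' $$ (Suc i, 0) / a)"
  define R where "R = mat 1 n (\<lambda>(i, j). A' $$ (0, Suc j) / a)"
  define B where "B = mat n n (\<lambda>(i, j). A' $$ (Suc i, Suc j)) - a \<cdot>\<^sub>m (C * R)"
  let ?a = "mat 1 1 (\<lambda>_. a)"
  have cs: "C \<in> carrier_mat n 1" "R \<in> carrier_mat 1 n" "B \<in> carrier_mat n n" "?a \<in> carrier_mat 1 1"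
    by (auto simp: C_def R_def B_def)
  have CO: "Omat n 1 C" and RO: "Omat 1 n R" using ge_a by (auto simp: C_def R_def)
  let ?L = "\<lambda>C. four_block_mat (1\<^sub>m 1) (0\<^sub>m 1 n) C (1\<^sub>m n)"
  let ?U = "\<lambda>R. four_block_mat (1\<^sub>m 1) R (0\<^sub>m n 1) (1\<^sub>m n)"
  let ?M = "four_block_mat ?a (0\<^sub>m 1 n) (0\<^sub>m n 1) B"
  have inv: "X + - X = 0\<^sub>m i j" "- X + X = 0\<^sub>m i j" if "X \<in> carrier_mat i j" for X :: "'l mat" and i j
    using that by (auto intro!: eq_matI)
  have LC: "?L C \<in> GLO ?N"
  proof -
    have mult: "?L X * ?L Y = ?L (X + Y)" if "X \<in> carrier_mat n 1" "Y \<in> carrier_mat n 1" for X Y :: "'l mat"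
      using that by (subst mult_four_block_mat[of _ 1 1 _ n _ n _ _ 1 _ n]) auto
    have one: "?L (0\<^sub>m n 1) = 1\<^sub>m ?N" by (rule eq_matI) auto
    have "?L C * ?L (- C) = 1\<^sub>m ?N" "?L (- C) * ?L C = 1\<^sub>m ?N"
      using mult[of C "- C"] mult[of "- C" C] cs(1) by (auto simp: one inv)
    moreover have "Omat ?N ?N (?L X)" if "Omat n 1 X" for X using that by auto
    ultimately show ?thesis unfolding GLO_iff using CO by (intro conjI exI[of _ "?L (- C)"]) auto
  qed
  have UR: "?U R \<in> GLO ?N"
  proof -
    have mult: "?U X * ?U Y = ?U (Y + X)" if "X \<in> carrier_mat 1 n" "Y \<in> carrier_mat 1 n" for X Y :: "'l mat"
      using that by (subst mult_four_block_mat[of _ 1 1 _ n _ n _ _ 1 _ n]) auto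
    have one: "?U (0\<^sub>m 1 n) = 1\<^sub>m ?N" by (rule eq_matI) auto
    have "?U R * ?U (- R) = 1\<^sub>m ?N" "?U (- R) * ?U R = 1\<^sub>m ?N"
      using mult[of R "- R"] mult[of "- R" R] cs(2) by (auto simp: one inv)
    then show ?thesis unfolding GLO_iff using RO by (intro conjI exI[of _ "?U (- R)"]) auto
  qed
  have "?L C * ?M * ?U R = four_block_mat ?a (?a * R) (C * ?a) (C * ?a * R + B)"
  proof -
    have "?L C * ?M = four_block_mat ?a (0\<^sub>m 1 n) (C * ?a) B"
      using cs by (subst mult_four_block_mat[of _ 1 1 _ n _ n _ _ 1 _ n]) auto
    then show ?thesis using cs by (simp, subst mult_four_block_mat[of _ 1 1 _ n _ n _ _ 1 _ n]) auto
  qed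
  also have "\<dots> = A'"
    using A'c a by (intro eq_matI) (auto simp: B_def C_def R_def scalar_prod_def less_Suc_eq_0_disj)
  finally have A'M: "A' = ?L C * ?M * ?U R" ..
  then have sim2: "hsim ?N A' ?M" unfolding hsim_def using LC UR by blast
  have Mc: "?M \<in> carrier_mat ?N ?N" using cs by auto
  have "det A' = det (?L C) * det ?M * det (?U R)" unfolding A'M
    using det_mult[OF mult_carrier_mat[OF GL_D[OF LC] Mc] GL_D[OF UR]] det_mult[OF GL_D[OF LC] Mc] by simp
  then have "det ?M \<noteq> 0" using det' by auto
  then have "det B \<noteq> 0" using det_four_block_mat_lower_left_zero[OF cs(4) _ refl cs(3), of "0\<^sub>m 1 n"] by auto
  then show ?thesis using a(1) cs(3) hsim_trans[OF sim1 sim2 Mc] by blast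
qed

lemma smith_form:
  assumes "A \<in> carrier_mat n n" "det A \<noteq> 0"
  shows "\<exists>t. (\<forall>i<n. t i \<noteq> 0) \<and> hsim n A (mat_diag n t)"
  using assms
proof (induction n arbitrary: A)
  case 0
  have "A = 1\<^sub>m 0 * mat_diag 0 (\<lambda>_. 0) * 1\<^sub>m 0" using 0 by (intro eq_matI) (auto simp: mat_diag_def)
  then show ?case unfolding hsim_def using GLO_one by blast
next
  case (Suc n)
  obtain a B where B: "a \<noteq> 0" "B \<in> carrier_mat n n" "det B \<noteq> 0"
    and sim: "hsim (Suc n) A (four_block_mat (mat 1 1 (\<lambda>_. a)) (0\<^sub>m 1 n) (0\<^sub>m n 1) B)"
    using smith_step[OF Suc.prems] by blast
  obtain t U V where t: "\<And>i. i < n \<Longrightarrow> t i \<noteq> 0" and UV: "U \<in> GLO n" "V \<in> GLO n" "B = U * mat_diag n t * V"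
    using Suc.IH[OF B(2,3)] unfolding hsim_def by blast
  let ?b = "\<lambda>U. four_block_mat (1\<^sub>m 1) (0\<^sub>m 1 n) (0\<^sub>m n 1) U"
  let ?D = "four_block_mat (mat 1 1 (\<lambda>_. a)) (0\<^sub>m 1 n) (0\<^sub>m n 1) (mat_diag n t)"
  let ?t = "\<lambda>i. case i of 0 \<Rightarrow> a | Suc i \<Rightarrow> t i"
  have blk: "?b X \<in> GLO (Suc n)" if XG: "X \<in> GLO n" for X
  proof -
    obtain Y where X: "Omat n n X" "Omat n n Y" "X * Y = 1\<^sub>m n" "Y * X = 1\<^sub>m n" using XG unfolding GLO_iff by blast
    then have c: "X \<in> carrier_mat n n" "Y \<in> carrier_mat n n" by auto
    have "?b Z * ?b Z' = ?b (Z * Z')" if "Z \<in> carrier_mat n n" "Z' \<in> carrier_mat n n" for Z Z' :: "'l mat"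
      using that by (subst mult_four_block_mat[of _ 1 1 _ n _ n _ _ 1 _ n]) auto
    moreover have "?b (1\<^sub>m n) = 1\<^sub>m (Suc n)" by (rule eq_matI) auto
    ultimately have "?b X * ?b Y = 1\<^sub>m (Suc n)" "?b Y * ?b X = 1\<^sub>m (Suc n)" using X c by auto
    then show ?thesis unfolding GLO_iff using X by (intro conjI exI[of _ "?b Y"]) auto
  qed
  have c: "U \<in> carrier_mat n n" "V \<in> carrier_mat n n" "mat_diag n t \<in> carrier_mat n n" using UV GL_D by auto
  have "?b U * ?D = four_block_mat (mat 1 1 (\<lambda>_. a)) (0\<^sub>m 1 n) (0\<^sub>m n 1) (U * mat_diag n t)"
    using c by (subst mult_four_block_mat[of _ 1 1 _ n _ n _ _ 1 _ n]) (auto simp: left_mult_zero_mat[OF c(3)])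
  moreover have "four_block_mat (mat 1 1 (\<lambda>_. a)) (0\<^sub>m 1 n) (0\<^sub>m n 1) Y * ?b V
      = four_block_mat (mat 1 1 (\<lambda>_. a)) (0\<^sub>m 1 n) (0\<^sub>m n 1) (Y * V)" if "Y \<in> carrier_mat n n" for Y
    using that c by (subst mult_four_block_mat[of _ 1 1 _ n _ n _ _ 1 _ n]) auto
  ultimately have "?b U * ?D * ?b V = four_block_mat (mat 1 1 (\<lambda>_. a)) (0\<^sub>m 1 n) (0\<^sub>m n 1) B"
    unfolding UV(3) using mult_carrier_mat[OF c(1,3)] by simp
  moreover have "?D = mat_diag (Suc n) ?t"
    by (rule eq_matI) (auto simp: mat_diag_def less_Suc_eq_0_disj split: if_splits)
  ultimately have "hsim (Suc n) (four_block_mat (mat 1 1 (\<lambda>_. a)) (0\<^sub>m 1 n) (0\<^sub>m n 1) B) (mat_diag (Suc n) ?t)"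
    unfolding hsim_def using blk UV by metis
  then have "hsim (Suc n) A (mat_diag (Suc n) ?t)" using hsim_trans[OF sim] by simp
  moreover have "\<forall>i<Suc n. ?t i \<noteq> 0" using B(1) t by (auto split: nat.split)
  ultimately show ?case by blast
qed

end

section \<open>Existence and uniqueness of the Hodge point\<close>

context valued
begin

lemma is_hodge_point_iff:
  assumes "A \<in> carrier_mat n n"
  shows "is_hodge_point val A \<mu> \<longleftrightarrow> (\<exists>U\<in>GLO n. \<exists>V\<in>GLO n. \<exists>t. (\<forall>i<n. t i \<noteq> 0) \<and>
    A = U * mat_diag n t * V \<and> \<mu> = mset (map (\<lambda>i. val (t i)) [0..<n]))"
  unfolding is_hodge_point_def Let_def carrier_matD(1)[OF assms] by (rule refl)

lemma size_filter_map:
  "size {#x \<in># mset (map f [0..<n]). P x#} = card {i. i < n \<and> P (f i)}"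
proof -
  have "{#x \<in># mset (map f [0..<n]). P x#} = mset (filter P (map f [0..<n]))" by simp
  then have "size {#x \<in># mset (map f [0..<n]). P x#} = length (filter P (map f [0..<n]))"
    by (simp only: size_mset)
  also have "\<dots> = card {i. i < length (map f [0..<n]) \<and> P (map f [0..<n] ! i)}"
    by (rule length_filter_conv_card)
  also have "{i. i < length (map f [0..<n]) \<and> P (map f [0..<n] ! i)} = {i. i < n \<and> P (f i)}" by auto
  finally show ?thesis .
qed

lemma hodge_point_exists:
  assumes "A \<in> carrier_mat n n" "det A \<noteq> 0"
  shows "\<exists>\<mu>. is_hodge_point val A \<mu>"
  using smith_form[OF assms] unfolding is_hodge_point_iff[OF assms(1)] hsim_def by blast

text \<open>The min-max principle for one factorization is tested on the vectors that
  \<open>V'\<close> of the other maps to the unit vectors \<open>e i\<close> with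
  \<open>\<tau> \<le> val (t' i)\<close>. Exchanging the factorizations gives uniqueness.\<close>

lemma hodge_point_le:
  assumes A: "A \<in> carrier_mat n n" and "is_hodge_point val A \<mu>" "is_hodge_point val A \<mu>'"
  shows "size {#x \<in># \<mu>'. \<tau> \<le> x#} \<le> size {#x \<in># \<mu>. \<tau> \<le> x#}"
proof -
  obtain U V t where t: "U \<in> GLO n" "V \<in> GLO n" "\<And>i. i < n \<Longrightarrow> t i \<noteq> 0" "A = U * mat_diag n t * V"
    and \<mu>: "\<mu> = mset (map (\<lambda>i. val (t i)) [0..<n])"
    using assms unfolding is_hodge_point_iff[OF A] by blast
  obtain U' V' t' where t': "U' \<in> GLO n" "V' \<in> GLO n" "A = U' * mat_diag n t' * V'"
    and \<mu>': "\<mu>' = mset (map (\<lambda>i. val (t' i)) [0..<n])"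
    using assms unfolding is_hodge_point_iff[OF A] by blast
  obtain W where W: "Omat n n V'" "Omat n n W" "V' * W = 1\<^sub>m n" using t'(2) unfolding GLO_iff by blast
  have UO: "Omat n n U'" using t'(1) unfolding GLO_iff by blast
  have c: "U' \<in> carrier_mat n n" "V' \<in> carrier_mat n n" "W \<in> carrier_mat n n" using UO W by auto
  let ?I = "{i. i < n \<and> \<tau> \<le> val (t' i)}"
  define e :: "nat \<Rightarrow> nat \<Rightarrow> 'l" where "e i = (\<lambda>j. if j = i then 1 else 0)" for i
  define w where "w i = mv W (e i)" for i
  have e: "e i \<in> carr n" if "i < n" for i using that by (simp add: e_def carr_def)
  have Vw: "mv V' (\<Sum>i\<in>?I. sm (z i) (w i)) = (\<Sum>i\<in>?I. sm (z i) (e i))" for z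
  proof -
    have "mv V' (w i) = e i" if "i < n" for i
      using mv_mult[OF c(2,3), of "e i"] W(3) mv_one[OF e[OF that]] by (simp add: w_def)
    then show ?thesis unfolding mv_sum mv_sm by (intro sum.cong) auto
  qed
  have coord: "(\<Sum>i\<in>?I. sm (z i) (e i)) j = (if j \<in> ?I then z j else 0)" for z j
  proof -
    have "(\<Sum>i\<in>?I. sm (z i) (e i)) j = (\<Sum>i\<in>?I. if i = j then z i else 0)"
      unfolding sum_fun_apply by (intro sum.cong) (auto simp: e_def pointwise)
    then show ?thesis by simp
  qed
  have "card ?I \<le> card {i. i < n \<and> \<tau> \<le> val (t i)}"
  proof (rule minmax[OF t(1,2,4,3), of ?I w])
    fix z assume "(\<Sum>i\<in>?I. sm (z i) (w i)) = 0"
    then have "(\<Sum>i\<in>?I. sm (z i) (e i)) = 0" using Vw[of z] by (simp add: mv_0)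
    then have "(\<Sum>i\<in>?I. sm (z i) (e i)) j = 0" for j by (simp add: pointwise)
    then have "(if i \<in> ?I then z i else 0) = 0" for i unfolding coord .
    then show "\<forall>i\<in>?I. z i = 0" by meson
  next
    fix z assume x: "vg 0 (\<Sum>i\<in>?I. sm (z i) (w i))"
    define q where "q = (\<Sum>i\<in>?I. sm (z i) (e i))"
    have "mv A (\<Sum>i\<in>?I. sm (z i) (w i)) = mv U' (mv (mat_diag n t') q)"
      unfolding t'(3) q_def Vw[symmetric]
      by (simp only: mv_mult[OF mult_carrier_mat[OF c(1) mat_diag_dim] c(2)] mv_mult[OF c(1) mat_diag_dim])
    moreover have q: "vg 0 q" using vg_mv[OF W(1) x] unfolding q_def Vw .
    have "ge \<tau> (t' i * q i)" if "i < n" for i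
    proof (cases "i \<in> ?I")
      case True
      then have "ge \<tau> (t' i)" by (simp add: vge_def)
      then show ?thesis using q ge_mult[of \<tau> "t' i" 0 "q i"] by (simp add: vg_def)
    next
      case False
      then have "q i = 0" unfolding q_def coord by (rule if_not_P)
      then show ?thesis by simp
    qed
    then have "vg \<tau> (mv (mat_diag n t') q)" unfolding vg_def mv_diag by simp
    ultimately show "vg \<tau> (mv A (\<Sum>i\<in>?I. sm (z i) (w i)))" using vg_mv[OF UO] by simp
  qed (use c(3) mv_carr in \<open>auto simp: w_def\<close>)
  then show ?thesis unfolding \<mu> \<mu>' size_filter_map .
qed

text \<open>A multiplicity is the difference of two consecutive tail sizes.\<close>

lemma multiset_eq_tails:
  fixes M M' :: "int multiset"
  assumes "\<And>\<tau>. size {#x \<in># M. \<tau> \<le> x#} = size {#x \<in># M'. \<tau> \<le> x#}"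
  shows "M = M'"
proof (rule multiset_eqI)
  fix a
  have split: "size {#x \<in># N. a \<le> x#} = count N a + size {#x \<in># N. a + 1 \<le> x#}" for N :: "int multiset"
    by (induction N) auto
  show "count M a = count M' a" using split[of M] split[of M'] assms[of a] assms[of "a + 1"] by simp
qed

lemma hodge_point_eq:
  assumes "A \<in> carrier_mat n n" "is_hodge_point val A \<mu>"
  shows "hodge_point val A = \<mu>"
  unfolding hodge_point_def
proof (rule the_equality)
  show "\<mu>' = \<mu>" if "is_hodge_point val A \<mu>'" for \<mu>'
    using hodge_point_le[OF assms(1) that assms(2)] hodge_point_le[OF assms that]
    by (intro multiset_eq_tails antisym)
qed (rule assms(2))

lemma hodge_point_form:
  assumes A: "A \<in> carrier_mat n n" "det A \<noteq> 0"
  obtains U V t where "U \<in> GLO n" "V \<in> GLO n" "\<And>i. i < n \<Longrightarrow> t i \<noteq> 0" "A = U * mat_diag n t * V"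
    "hodge_point val A = mset (map (\<lambda>i. val (t i)) [0..<n])"
proof -
  obtain \<mu> where \<mu>: "is_hodge_point val A \<mu>" using hodge_point_exists[OF A] by blast
  then show thesis using that hodge_point_eq[OF A(1) \<mu>] unfolding is_hodge_point_iff[OF A(1)] by blast
qed

lemma det_mat_diag: "det (mat_diag n t) = (\<Prod>i<n. t i :: 'l)"
  by (subst det_upper_triangular[of _ n])
    (auto simp: mat_diag_def prod_list_diag_prod atLeast0LessThan intro!: upper_triangularI)

text \<open>The two outer factors have unit determinants, so only the diagonal contributes.\<close>

lemma hodge_point_sum:
  assumes A: "A \<in> carrier_mat n n" "det A \<noteq> 0"
  shows "sum_mset (hodge_point val A) = val (det A)"
proof -
  obtain U V t where t: "U \<in> GLO n" "V \<in> GLO n" "\<And>i. i < n \<Longrightarrow> t i \<noteq> 0" "A = U * mat_diag n t * V"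
    and \<mu>: "hodge_point val A = mset (map (\<lambda>i. val (t i)) [0..<n])" using hodge_point_form[OF A] by blast
  have c: "U \<in> carrier_mat n n" "V \<in> carrier_mat n n" using t GL_D by auto
  have "det A = det U * (\<Prod>i<n. t i) * det V"
    unfolding t(4) det_mult[OF mult_carrier_mat[OF c(1) mat_diag_dim] c(2)] det_mult[OF c(1) mat_diag_dim] det_mat_diag ..
  moreover have "(\<Prod>i<n. t i) \<noteq> 0" using t(3) by simp
  ultimately have "val (det A) = val (\<Prod>i<n. t i)" using GLO_det[OF t(1)] GLO_det[OF t(2)] by (simp add: val_mult)
  also have "\<dots> = (\<Sum>i<n. val (t i))" using t(3) by (intro val_prod) auto
  also have "\<dots> = sum_list (map (\<lambda>i. val (t i)) [0..<n])" by (simp add: interv_sum_list_conv_sum_set_nat atLeast0LessThan)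
  finally show ?thesis unfolding \<mu> sum_mset_sum_list ..
qed

end

section \<open>Newton points\<close>

text \<open>The columns of \<open>g\<close> times the block matrix, for a matrix \<open>g\<close>
  with columns \<open>us\<close>: a shift inside each block, closed up by
  \<open>\<pi> powi s\<close> times its first vector.\<close>

fun steps :: "'l::field \<Rightarrow> (int \<times> nat) list \<Rightarrow> (nat \<Rightarrow> 'l) list \<Rightarrow> (nat \<Rightarrow> 'l) list" where
  "steps \<pi> [] us = []"
| "steps \<pi> ((s, r) # srs) us =
    map (\<lambda>j. if j + 1 < r then us ! (j + 1) else sm (\<pi> powi s) (us ! 0)) [0..<r] @ steps \<pi> srs (drop r us)"

abbreviation "iso_blocks \<pi> srs \<equiv> diag_block_mat (map (\<lambda>(s, r). simple_isocrystal \<pi> s r) srs)"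

lemma length_steps: "length (steps \<pi> srs us) = sum_list (map snd srs)"
  by (induction srs arbitrary: us) auto

lemma iso_blocks_carrier: "iso_blocks \<pi> srs \<in> carrier_mat (sum_list (map snd srs)) (sum_list (map snd srs))"
proof (induction srs)
  case (Cons a srs)
  obtain s r where a: "a = (s, r)" by (cases a)
  have "simple_isocrystal \<pi> s r \<in> carrier_mat r r" by (simp add: simple_isocrystal_def)
  then show ?case using four_block_carrier_mat[OF _ Cons] by (simp add: a Let_def)
qed simp

lemma iso_blocks_Cons:
  "iso_blocks \<pi> ((s, r) # srs) = (let m = sum_list (map snd srs) in
    four_block_mat (simple_isocrystal \<pi> s r) (0\<^sub>m r m) (0\<^sub>m m r) (iso_blocks \<pi> srs))"
proof -
  have "dim_row (iso_blocks \<pi> srs) = sum_list (map snd srs)" "dim_col (iso_blocks \<pi> srs) = sum_list (map snd srs)"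
    using iso_blocks_carrier[of \<pi> srs] by blast+
  then show ?thesis by (simp add: Let_def simple_isocrystal_def)
qed

lemma steps_column:
  assumes "\<forall>(s, r)\<in>set srs. r > 0" "length us = sum_list (map snd srs)" "j < length us"
  shows "(\<Sum>k<length us. (us ! k) i * iso_blocks \<pi> srs $$ (k, j)) = (steps \<pi> srs us ! j) i"
  using assms
proof (induction srs arbitrary: us j)
  case Nil
  then show ?case by simp
next
  case (Cons a srs)
  obtain s r where a: "a = (s, r)" by (cases a)
  let ?m = "sum_list (map snd srs)" and ?D = "iso_blocks \<pi> srs" and ?S = "simple_isocrystal \<pi> s r"
  have len: "length us = r + ?m" and r: "r > 0" using Cons.prems a by auto
  have dims: "dim_row ?D = ?m" "dim_col ?D = ?m" "dim_row ?S = r" "dim_col ?S = r"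
    using iso_blocks_carrier[of \<pi> srs] by (auto simp: simple_isocrystal_def)
  have entry: "iso_blocks \<pi> (a # srs) $$ (k, j) =
    (if k < r then if j < r then ?S $$ (k, j) else 0 else if j < r then 0 else ?D $$ (k - r, j - r))"
    if "k < r + ?m" for k
    unfolding a iso_blocks_Cons Let_def using that Cons.prems(3) len dims by (subst index_mat_four_block) auto
  show ?case
  proof (cases "j < r")
    case True
    have "(\<Sum>k<length us. (us ! k) i * iso_blocks \<pi> (a # srs) $$ (k, j)) = (\<Sum>k<r. (us ! k) i * ?S $$ (k, j))"
      using True entry len by (intro sum.mono_neutral_cong_right) auto
    also have "\<dots> = (\<Sum>k<r. if k = (if j + 1 < r then j + 1 else 0)
        then (us ! k) i * (if j + 1 < r then 1 else \<pi> powi s) else 0)"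
      using True by (intro sum.cong) (auto simp: simple_isocrystal_def)
    also have "\<dots> = (steps \<pi> (a # srs) us ! j) i" using True r by (auto simp: a nth_append pointwise)
    finally show ?thesis .
  next
    case False
    have "(\<Sum>k<length us. (us ! k) i * iso_blocks \<pi> (a # srs) $$ (k, j))
        = (\<Sum>k\<in>{r..<r + ?m}. (us ! k) i * ?D $$ (k - r, j - r))"
      using False entry len by (intro sum.mono_neutral_cong_right) auto
    also have "\<dots> = (\<Sum>k<?m. (drop r us ! k) i * ?D $$ (k, j - r))"
      using sum.shift_bounds_nat_ivl[of "\<lambda>k. (us ! k) i * ?D $$ (k - r, j - r)" 0 r ?m] len
      by (simp add: atLeast0LessThan add.commute)
    also have "\<dots> = (steps \<pi> srs (drop r us) ! (j - r)) i"
      using Cons.IH[of "drop r us" "j - r"] Cons.prems False len by simp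
    also have "\<dots> = (steps \<pi> (a # srs) us ! j) i" using False by (simp add: a nth_append)
    finally show ?thesis .
  qed
qed

lemma det_simple_isocrystal:
  assumes "r > 0"
  shows "det (simple_isocrystal \<pi> s r :: 'l::field mat) = (-1) ^ (r - 1) * \<pi> powi s"
proof -
  let ?S = "simple_isocrystal \<pi> s r :: 'l mat"
  have S: "?S \<in> carrier_mat r r" by (simp add: simple_isocrystal_def)
  have "det ?S = (\<Sum>i<r. ?S $$ (i, r - 1) * cofactor ?S i (r - 1))"
    using assms by (intro laplace_expansion_column[OF S]) simp
  also have "\<dots> = (\<Sum>i<r. if i = 0 then \<pi> powi s * cofactor ?S i (r - 1) else 0)"
    using assms by (intro sum.cong) (auto simp: simple_isocrystal_def)
  also have "\<dots> = \<pi> powi s * cofactor ?S 0 (r - 1)" using assms by simp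
  also have "mat_delete ?S 0 (r - 1) = 1\<^sub>m (r - 1)"
    by (rule eq_matI) (auto simp: mat_delete_def simple_isocrystal_def)
  then have "cofactor ?S 0 (r - 1) = (-1) ^ (r - 1)" by (simp add: cofactor_def)
  finally show ?thesis by simp
qed

lemma (in valued) val_det_iso_blocks:
  assumes "\<pi> \<noteq> 0" "val \<pi> = 1" "\<forall>(s, r)\<in>set srs. r > 0"
  shows "det (iso_blocks \<pi> srs) \<noteq> 0 \<and> val (det (iso_blocks \<pi> srs)) = sum_list (map fst srs)"
  using assms(3)
proof (induction srs)
  case (Cons a srs)
  obtain s r where a: "a = (s, r)" by (cases a)
  let ?m = "sum_list (map snd srs)"
  have S: "simple_isocrystal \<pi> s r \<in> carrier_mat r r" by (simp add: simple_isocrystal_def)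
  have "det (iso_blocks \<pi> (a # srs)) = det (simple_isocrystal \<pi> s r) * det (iso_blocks \<pi> srs)"
    unfolding a iso_blocks_Cons Let_def
    by (rule det_four_block_mat_lower_left_zero[OF S _ refl iso_blocks_carrier]) simp
  moreover have "val ((-1) ^ k :: 'l) = 0" for k by (simp add: val_power)
  ultimately show ?case using Cons assms(1,2) a by (simp add: det_simple_isocrystal val_mult val_powi)
qed simp

section \<open>The operator \<open>b\<sigma>\<close> and its powers\<close>

context field_auto
begin

lemma sigk_add: "(\<sigma> ^^ k) (x + y) = (\<sigma> ^^ k) x + (\<sigma> ^^ k) y"
  by (induction k) (auto simp: sig_add)

lemma sigk_mult: "(\<sigma> ^^ k) (x * y) = (\<sigma> ^^ k) x * (\<sigma> ^^ k) y"
  by (induction k) (auto simp: sig_mult)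

lemma sigk_0 [simp]: "(\<sigma> ^^ k) 0 = 0"
  by (induction k) auto

lemma sigk_eq_0 [simp]: "(\<sigma> ^^ k) x = 0 \<longleftrightarrow> x = 0"
  by (induction k) auto

lemma sigk_sum: "(\<sigma> ^^ k) (sum f I) = (\<Sum>i\<in>I. (\<sigma> ^^ k) (f i))"
  by (induction I rule: infinite_finite_induct) (auto simp: sigk_add)

lemma sigk_surj: "\<exists>x. (\<sigma> ^^ k) x = y"
proof (induction k arbitrary: y)
  case (Suc k)
  obtain z where "\<sigma> z = y" using sig_bij by (metis bij_pointE)
  moreover obtain x where "(\<sigma> ^^ k) x = z" using Suc by blast
  ultimately show ?case by auto
qed auto

lemma sigk_mv: "B \<in> carrier_mat n m \<Longrightarrow> (\<sigma> ^^ k) (mv B y j) = mv (map_mat (\<sigma> ^^ k) B) (\<lambda>j. (\<sigma> ^^ k) (y j)) j"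
  by (auto simp: mv_def sigk_sum sigk_mult)

lemma map_mat_sig_det: "B \<in> carrier_mat n n \<Longrightarrow> det (map_mat \<sigma> B) = \<sigma> (det B)"
proof -
  interpret comm_ring_hom \<sigma> by unfold_locales (auto simp: sig_add sig_mult)
  show ?thesis by simp
qed

end

context frob_dvr
begin

lemma val_sigk: "x \<noteq> 0 \<Longrightarrow> val ((\<sigma> ^^ k) x) = val x"
  by (induction k) (auto simp: val_sig)

lemma ge_sigk [simp]: "ge t ((\<sigma> ^^ k) x) \<longleftrightarrow> ge t x"
  by (cases "x = 0") (auto simp: vge_def val_sigk)

definition twist :: "'l mat \<Rightarrow> (nat \<Rightarrow> 'l) \<Rightarrow> nat \<Rightarrow> 'l" where
  "twist b x = mv b (\<lambda>k. \<sigma> (x k))"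

lemma frob_power_carrier: "b \<in> carrier_mat n n \<Longrightarrow> frob_power \<sigma> b k \<in> carrier_mat n n"
  by (induction k) auto

lemma twist_power:
  assumes b: "b \<in> carrier_mat n n" and x: "x \<in> carr n"
  shows "(twist b ^^ k) x = mv (frob_power \<sigma> b k) (\<lambda>j. (\<sigma> ^^ k) (x j))"
  using x
proof (induction k arbitrary: x)
  case 0
  then show ?case using b by (simp add: mv_one)
next
  case (Suc k)
  have "(twist b ^^ Suc k) x = (twist b ^^ k) (twist b x)" by (simp add: funpow_swap1)
  also have "\<dots> = mv (frob_power \<sigma> b k) (\<lambda>j. (\<sigma> ^^ k) (mv b (\<lambda>i. \<sigma> (x i)) j))"
  proof -
    have "twist b x \<in> carr n" using mv_carr[OF b] by (simp add: twist_def)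
    from Suc.IH[OF this] show ?thesis by (simp only:) (simp only: twist_def)
  qed
  also have "(\<lambda>j. (\<sigma> ^^ k) (mv b (\<lambda>i. \<sigma> (x i)) j)) = mv (map_mat (\<sigma> ^^ k) b) (\<lambda>j. (\<sigma> ^^ Suc k) (x j))"
    unfolding sigk_mv[OF b] by (simp add: funpow_swap1)
  finally show ?case using mv_mult[OF frob_power_carrier[OF b, of k], of "map_mat (\<sigma> ^^ k) b" n] b by simp
qed

lemma val_det_frob_power:
  assumes b: "b \<in> carrier_mat n n" and nz: "det b \<noteq> 0"
  shows "det (frob_power \<sigma> b k) \<noteq> 0 \<and> val (det (frob_power \<sigma> b k)) = int k * val (det b)"
proof (induction k)
  case 0
  then show ?case using b by simp
next
  case (Suc k)
  have mm: "map_mat (\<sigma> ^^ k) b \<in> carrier_mat n n" for k using b by simp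
  have "det (map_mat (\<sigma> ^^ k) b) = (\<sigma> ^^ k) (det b)"
  proof (induction k)
    case 0
    have "map_mat (\<sigma> ^^ 0) b = b" by (rule eq_matI) auto
    then show ?case by (simp only:) simp
  next
    case (Suc k)
    have eq: "map_mat (\<sigma> ^^ Suc k) b = map_mat \<sigma> (map_mat (\<sigma> ^^ k) b)" by (rule eq_matI) auto
    show ?case unfolding eq map_mat_sig_det[OF mm] Suc.IH by simp
  qed
  then show ?case using Suc nz det_mult[OF frob_power_carrier[OF b, of k] mm[of k]]
    by (simp add: val_mult val_sigk algebra_simps)
qed

lemma isocrystal_twist:
  assumes b: "b \<in> GL n UNIV" and \<pi>: "\<pi> \<noteq> 0" "val \<pi> = 1"
  shows "isocrystal val \<sigma> (twist b) n \<pi>"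
proof unfold_locales
  have bc: "b \<in> carrier_mat n n" by (rule GL_D[OF b])
  show "twist b (x + y) = twist b x + twist b y" for x y
    unfolding twist_def mv_add[symmetric] by (rule arg_cong[of _ _ "mv b"]) (auto simp: pointwise sig_add)
  show "twist b (sm c x) = sm (\<sigma> c) (twist b x)" for c x
    unfolding twist_def mv_sm[symmetric] by (rule arg_cong[of _ _ "mv b"]) (auto simp: pointwise sig_mult)
  show "twist b x \<in> carr n" for x using mv_carr[OF bc] by (simp add: twist_def)
  show "x = 0" if x: "x \<in> carr n" "twist b x = 0" for x
  proof -
    obtain B where B: "B \<in> carrier_mat n n" "B * b = 1\<^sub>m n" using b by (auto simp: GL_def)
    have "(\<lambda>k. \<sigma> (x k)) \<in> carr n" using x(1) by (simp add: carr_def)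
    then have "mv (B * b) (\<lambda>k. \<sigma> (x k)) = (\<lambda>k. \<sigma> (x k))" by (simp only: B(2) mv_one)
    then have "(\<lambda>k. \<sigma> (x k)) = mv B (twist b x)" by (simp only: mv_mult[OF B(1) bc] twist_def)
    then have "(\<lambda>k. \<sigma> (x k)) = 0" using x(2) by (simp add: mv_0)
    then have "\<sigma> (x k) = 0" for k by (metis zero_fun_apply)
    then show "x = 0" by (simp add: fun_eq_iff pointwise)
  qed
qed (use \<pi> in auto)

end

section \<open>Chains as columns of intertwining matrices\<close>

context isocrystal
begin

definition srs_of :: "(int \<times> nat \<times> (nat \<Rightarrow> 'l)) list \<Rightarrow> (int \<times> nat) list" where
  "srs_of cs = map (\<lambda>(s, r, v). (s, r)) cs"

lemma length_us: "length (us cs) = sum_list (map snd (srs_of cs))"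
  by (induction cs) (auto simp: us_def srs_of_def)

lemma steps_us: "\<forall>c\<in>set cs. chain c \<Longrightarrow> steps \<pi> (srs_of cs) (us cs) = map F (us cs)"
proof (induction cs)
  case Nil
  then show ?case by (simp add: us_simps srs_of_def)
next
  case (Cons a cs)
  obtain s r v where a: "a = (s, r, v)" by (cases a)
  let ?vs = "map (\<lambda>j. (F ^^ j) v) [0..<r]"
  have r: "r > 0" and Fr: "(F ^^ r) v = sm (\<pi> powi s) v" using Cons.prems a by (auto simp: chain_def)
  have us: "us (a # cs) = ?vs @ us cs" by (simp add: a us_simps)
  have first: "map (\<lambda>j. if j + 1 < r then us (a # cs) ! (j + 1) else sm (\<pi> powi s) (us (a # cs) ! 0)) [0..<r]
      = map F ?vs"
  proof (rule nth_equalityI)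
    fix j assume "j < length (map (\<lambda>j. if j + 1 < r then us (a # cs) ! (j + 1) else sm (\<pi> powi s) (us (a # cs) ! 0)) [0..<r])"
    then have j: "j < r" by simp
    show "map (\<lambda>j. if j + 1 < r then us (a # cs) ! (j + 1) else sm (\<pi> powi s) (us (a # cs) ! 0)) [0..<r] ! j
      = map F ?vs ! j"
    proof (cases "j + 1 < r")
      case False
      then have "r = Suc j" using j by simp
      then have "F ((F ^^ j) v) = sm (\<pi> powi s) v" using Fr by simp
      then show ?thesis using j r False by (simp add: us nth_append)
    qed (use j in \<open>simp add: us nth_append\<close>)
  qed simp
  have srs: "srs_of (a # cs) = (s, r) # srs_of cs" by (simp add: srs_of_def a)
  have rest: "drop r (us (a # cs)) = us cs" by (simp add: us)
  have IH: "steps \<pi> (srs_of cs) (us cs) = map F (us cs)" using Cons by simp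
  have "map F (us (a # cs)) = map F ?vs @ map F (us cs)" by (simp only: us map_append)
  then show ?case by (simp only: srs steps.simps first rest IH)
qed

text \<open>The converse of \<open>steps_us\<close>: inside a block the equation forces each vector
  to be the image of its predecessor, so the block consists of the iterates of its first vector and
  closes up as a chain.\<close>

lemma chains_of_steps:
  assumes "\<forall>(s, r)\<in>set srs. r > 0 \<and> coprime s (int r)" "set vs \<subseteq> carr n"
    "length vs = sum_list (map snd srs)" "steps \<pi> srs vs = map F vs"
  shows "\<exists>cs. srs_of cs = srs \<and> us cs = vs \<and> (\<forall>c\<in>set cs. chain c)"
  using assms
proof (induction srs arbitrary: vs)
  case Nil
  then show ?case by (intro exI[of _ "[]"]) (simp add: srs_of_def us_simps)
next
  case (Cons a srs)
  obtain s r where a: "a = (s, r)" by (cases a)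
  have r: "r > 0" "coprime s (int r)" using Cons.prems(1) a by auto
  have len: "length vs = r + sum_list (map snd srs)" using Cons.prems(3) a by simp
  define v where "v = vs ! 0"
  have split: "map F vs = map F (take r vs) @ map F (drop r vs)" by (metis append_take_drop_id map_append)
  have eqs: "map (\<lambda>j. if j + 1 < r then vs ! (j + 1) else sm (\<pi> powi s) (vs ! 0)) [0..<r] = map F (take r vs)"
    "steps \<pi> srs (drop r vs) = map F (drop r vs)"
    using Cons.prems(4) len unfolding a split by auto
  have Fvs: "F (vs ! j) = (if j + 1 < r then vs ! (j + 1) else sm (\<pi> powi s) v)" if "j < r" for j
    using arg_cong[OF eqs(1), of "\<lambda>l. l ! j"] that len by (simp add: v_def split: if_splits)
  have vs: "j < r \<Longrightarrow> vs ! j = (F ^^ j) v" for j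
  proof (induction j)
    case (Suc j)
    then have "F (vs ! j) = vs ! Suc j" using Fvs[of j] by simp
    then show ?case using Suc by simp
  qed (simp add: v_def)
  obtain r' where r': "r = Suc r'" using r(1) by (cases r) auto
  have "(F ^^ r) v = sm (\<pi> powi s) v" using Fvs[of r'] vs[of r'] by (simp add: r')
  moreover have "v \<in> carr n" using Cons.prems(2) len r(1) by (auto simp: v_def)
  ultimately have ch: "chain (s, r, v)" using r by (simp add: chain_def)
  have take: "take r vs = map (\<lambda>j. (F ^^ j) v) [0..<r]"
    using vs len by (intro nth_equalityI) auto
  obtain cs where cs: "srs_of cs = srs" "us cs = drop r vs" "\<forall>c\<in>set cs. chain c"
    using Cons.IH[of "drop r vs"] Cons.prems(1,2) len eqs(2) set_drop_subset[of r vs] by auto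
  have "us ((s, r, v) # cs) = vs" by (simp only: us_simps cs(2) take[symmetric] append_take_drop_id)
  moreover have "srs_of ((s, r, v) # cs) = a # srs" using cs(1) by (simp add: srs_of_def a)
  ultimately show ?case using ch cs(3) by (intro exI[of _ "(s, r, v) # cs"]) simp
qed

end

definition cols :: "nat \<Rightarrow> (nat \<Rightarrow> 'l::field) list \<Rightarrow> 'l mat" where
  "cols n vs = mat n n (\<lambda>(i, j). (vs ! j) i)"

lemma mv_cols: "set vs \<subseteq> carr n \<Longrightarrow> length vs = n \<Longrightarrow> mv (cols n vs) c = lincomb c vs"
proof
  fix i assume vs: "set vs \<subseteq> carr n" "length vs = n"
  show "mv (cols n vs) c i = lincomb c vs i"
  proof (cases "i < n")
    case True
    then show ?thesis using vs by (simp add: mv_def cols_def lincomb_def pointwise mult.commute)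
  next
    case False
    then have "lincomb c vs i = 0" using lincomb_in[OF carr_subspace vs(1), of c] by (simp add: carr_def)
    then show ?thesis using False by (simp add: mv_def cols_def)
  qed
qed

text \<open>The matrix equation in the definition of the Newton point is compared column by column.
  Both lists lie in \<open>carr n\<close>, so agreement of the first \<open>n\<close> coordinates is
  enough.\<close>

lemma (in frob_dvr) intertwine_iff:
  assumes b: "b \<in> carrier_mat n n" and vs: "set vs \<subseteq> carr n" "length vs = n"
    and srs: "\<forall>(s, r)\<in>set srs. r > 0" "sum_list (map snd srs) = n"
  shows "cols n vs * iso_blocks \<pi> srs = b * map_mat \<sigma> (cols n vs) \<longleftrightarrow> steps \<pi> srs vs = map (twist b) vs"
proof -
  have D: "iso_blocks \<pi> srs \<in> carrier_mat n n" using iso_blocks_carrier[of \<pi> srs] srs(2) by simp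
  have g: "cols n vs \<in> carrier_mat n n" by (simp add: cols_def)
  have L: "(cols n vs * iso_blocks \<pi> srs) $$ (i, j) = (steps \<pi> srs vs ! j) i" if "i < n" "j < n" for i j
  proof -
    have "(cols n vs * iso_blocks \<pi> srs) $$ (i, j) = (\<Sum>k<n. (vs ! k) i * iso_blocks \<pi> srs $$ (k, j))"
      unfolding index_mult[OF g D that] using that by (simp add: cols_def)
    then show ?thesis using steps_column[OF srs(1), of vs j i \<pi>] vs(2) srs(2) that by simp
  qed
  have R: "(b * map_mat \<sigma> (cols n vs)) $$ (i, j) = (map (twist b) vs ! j) i" if "i < n" "j < n" for i j
    unfolding index_mult[OF b map_carrier_mat[THEN iffD2, OF g] that]
    using that b vs(2) by (simp add: cols_def twist_def mv_def)
  have S: "x \<in> carr n" if "x \<in> set (steps \<pi> srs vs)" for x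
    using that vs srs(1) vs(2)[symmetric] srs(2)
  proof -
    have "set (steps \<pi> srs vs) \<subseteq> carr n" if "\<forall>(s, r)\<in>set srs. r > 0" "length vs = sum_list (map snd srs)" "set vs \<subseteq> carr n" for srs vs
      using that
    proof (induction srs arbitrary: vs)
      case (Cons a srs)
      obtain s r where a: "a = (s, r)" by (cases a)
      have r: "r > 0" "length vs = r + sum_list (map snd srs)" using Cons.prems a by auto
      have nth: "vs ! j \<in> carr n" if "j < r" for j using Cons.prems(3) r(2) that by (auto simp: subset_iff)
      have 1: "set (steps \<pi> srs (drop r vs)) \<subseteq> carr n"
        using Cons.prems r set_drop_subset[of r vs] by (intro Cons.IH) auto
      have 2: "(if j + 1 < r then vs ! (j + 1) else sm (\<pi> powi s) (vs ! 0)) \<in> carr n" for j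
        using nth[of "j + 1"] subspace_ofD(3)[OF carr_subspace nth[OF r(1)]] by simp
      show ?case unfolding a steps.simps set_append set_map by (intro Un_least image_subsetI 1 2)
    qed simp
    then have "set (steps \<pi> srs vs) \<subseteq> carr n" using srs vs by simp
    then show ?thesis using that by blast
  qed
  show ?thesis
  proof
    assume eq: "cols n vs * iso_blocks \<pi> srs = b * map_mat \<sigma> (cols n vs)"
    show "steps \<pi> srs vs = map (twist b) vs"
    proof (rule nth_equalityI)
      show len: "length (steps \<pi> srs vs) = length (map (twist b) vs)" using vs(2) srs(2) by (simp add: length_steps)
      fix j assume "j < length (steps \<pi> srs vs)"
      then have j: "j < n" and mem: "steps \<pi> srs vs ! j \<in> carr n" using len vs(2) S by auto
      show "steps \<pi> srs vs ! j = map (twist b) vs ! j"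
      proof
        fix i
        have "twist b (vs ! j) \<in> carr n" using mv_carr[OF b] by (simp add: twist_def)
        then show "(steps \<pi> srs vs ! j) i = (map (twist b) vs ! j) i"
          using L[of i j] R[of i j] j mem eq vs(2) by (cases "i < n") (auto simp: carr_def)
      qed
    qed
  next
    assume "steps \<pi> srs vs = map (twist b) vs"
    then show "cols n vs * iso_blocks \<pi> srs = b * map_mat \<sigma> (cols n vs)"
      using L R g D b by (intro eq_matI) auto
  qed
qed

section \<open>Comparing slopes\<close>

text \<open>At least \<open>n - i\<close> entries of \<open>ls\<close> reach \<open>ls ! i\<close>.
  If \<open>xs ! i\<close> missed the bound, then by sortedness at most \<open>n - i - 1\<close>
  entries of \<open>xs\<close> could meet it.\<close>

lemma sorted_lower_bound:
  fixes ls xs :: "rat list"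
  assumes "sorted ls" "sorted xs" "length ls = n" "length xs = n" and N: "0 \<le> N"
    and le: "\<And>q. q \<in> set ls \<Longrightarrow>
      card {k. k < n \<and> q \<le> ls ! k} \<le> card {k. k < n \<and> N * q - C \<le> xs ! k}"
    and i: "i < n"
  shows "N * ls ! i - C \<le> xs ! i"
proof (rule ccontr)
  assume *: "\<not> ?thesis"
  have "{i..<n} \<subseteq> {k. k < n \<and> ls ! i \<le> ls ! k}"
    using assms(1,3) by (auto simp: sorted_nth_mono)
  then have "n - i \<le> card {k. k < n \<and> ls ! i \<le> ls ! k}" using card_mono[of _ "{i..<n}"] by fastforce
  also have "\<dots> \<le> card {k. k < n \<and> N * ls ! i - C \<le> xs ! k}" using le[of "ls ! i"] i assms(3) by simp
  also have "{k. k < n \<and> N * ls ! i - C \<le> xs ! k} \<subseteq> {Suc i..<n}"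
  proof
    fix k assume "k \<in> {k. k < n \<and> N * ls ! i - C \<le> xs ! k}"
    then have k: "k < n" "xs ! i < xs ! k" using * by auto
    have "\<not> k \<le> i" using sorted_nth_mono[OF assms(2), of k i] k(2) i assms(4) by force
    then show "k \<in> {Suc i..<n}" using k by simp
  qed
  then have "card {k. k < n \<and> N * ls ! i - C \<le> xs ! k} \<le> n - Suc i" using card_mono[of "{Suc i..<n}"] by fastforce
  finally show False using i by simp
qed

text \<open>Over the common denominator \<open>r * r'\<close>, at most \<open>n ^ 2\<close>, a
  nonzero difference has a nonzero integral numerator.\<close>

lemma rational_gap:
  fixes s s' :: int and r r' n :: nat
  assumes "0 < r" "r \<le> n" "0 < r'" "r' \<le> n"
    and close: "\<bar>of_int s / of_nat r - of_int s' / of_nat r'\<bar> * (of_nat n)\<^sup>2 < (1::rat)"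
  shows "(of_int s / of_nat r :: rat) = of_int s' / of_nat r'"
proof (rule ccontr)
  assume ne: "\<not> ?thesis"
  let ?d = "of_int s / of_nat r - of_int s' / of_nat r' :: rat"
  have d: "?d * (of_nat r * of_nat r') = of_int (s * int r' - s' * int r)"
    using assms(1,3) by (simp add: field_simps)
  have "?d * (of_nat r * of_nat r') \<noteq> 0" using ne assms(1,3) by simp
  then have "s * int r' - s' * int r \<noteq> 0" unfolding d by (simp only: of_int_eq_0_iff not_False_eq_True simp_thms)
  then have "1 \<le> \<bar>s * int r' - s' * int r\<bar>" by linarith
  then have "1 \<le> (of_int \<bar>s * int r' - s' * int r\<bar> :: rat)" by linarith
  also have "\<dots> = \<bar>?d\<bar> * (of_nat r * of_nat r')" unfolding of_int_abs d[symmetric] by (simp add: abs_mult)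
  also have "\<dots> \<le> \<bar>?d\<bar> * (of_nat n * of_nat n)" using assms(2,4) by (intro mult_left_mono mult_mono) auto
  finally show False using close by (simp add: power2_eq_square)
qed

lemma slopes_determined:
  fixes \<mu> :: "int multiset" and \<nu> \<nu>' :: "rat multiset"
  assumes size: "size \<mu> = n" "size \<nu> = n" "size \<nu>' = n"
    and bound: "\<And>q. q \<in># \<nu> \<Longrightarrow> size {#y \<in># \<nu>. q \<le> y#} \<le> size {#x \<in># \<mu>. of_nat N * q - C \<le> of_int x#}"
    and bound': "\<And>q. q \<in># \<nu>' \<Longrightarrow> size {#y \<in># \<nu>'. q \<le> y#} \<le> size {#x \<in># \<mu>. of_nat N * q - C \<le> of_int x#}"
    and sum: "of_int (sum_mset \<mu>) = of_nat N * sum_mset \<nu>" "of_int (sum_mset \<mu>) = of_nat N * sum_mset \<nu>'"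
    and den: "\<And>q. q \<in># \<nu> + \<nu>' \<Longrightarrow> \<exists>s r. 0 < r \<and> r \<le> n \<and> q = of_int s / of_nat r"
    and N: "of_nat n * C * (of_nat n)\<^sup>2 < of_nat N"
  shows "\<nu> = \<nu>'"
proof -
  define xs :: "rat list" where "xs = map of_int (sorted_list_of_multiset \<mu>)"
  define ls where "ls = sorted_list_of_multiset \<nu>"
  define ls' where "ls' = sorted_list_of_multiset \<nu>'"
  have mset: "mset (sorted_list_of_multiset \<mu>) = \<mu>" "mset ls = \<nu>" "mset ls' = \<nu>'" by (simp_all add: ls_def ls'_def)
  have sorted: "sorted xs" "sorted ls" "sorted ls'"
    by (auto simp: xs_def ls_def ls'_def sorted_map intro: sorted_wrt_mono_rel[of _ "(\<le>)"])
  have len: "length xs = n" "length ls = n" "length ls' = n"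
    using size mset by (metis length_map size_mset xs_def)+
  have size_filter: "size {#y \<in># mset zs. P y#} = card {k. k < length zs \<and> P (zs ! k)}" for P and zs :: "'z list"
    by (simp only: mset_filter[symmetric] size_mset length_filter_conv_card)
  have \<mu>_card: "size {#x \<in># \<mu>. T \<le> (of_int x :: rat)#} = card {k. k < n \<and> T \<le> xs ! k}" for T
  proof -
    have "size {#x \<in># \<mu>. T \<le> (of_int x :: rat)#}
      = card {k. k < length (sorted_list_of_multiset \<mu>) \<and> T \<le> (of_int (sorted_list_of_multiset \<mu> ! k) :: rat)}"
      using size_filter[of "\<lambda>x. T \<le> of_int x" "sorted_list_of_multiset \<mu>"] unfolding mset(1) .
    also have "\<dots> = card {k. k < n \<and> T \<le> xs ! k}"
      using len(1) by (intro arg_cong[of _ _ card]) (auto simp: xs_def)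
    finally show ?thesis .
  qed
  have sum_xs: "(\<Sum>i<n. xs ! i) = of_int (sum_mset \<mu>)"
  proof -
    have "(\<Sum>i<n. xs ! i) = sum_list xs" using len by (simp add: sum_list_sum_nth atLeast0LessThan)
    also have "\<dots> = of_int (sum_list (sorted_list_of_multiset \<mu>))" unfolding xs_def
      by (induction "sorted_list_of_multiset \<mu>" arbitrary: rule: list.induct) (auto simp: o_def)
    also have "sum_list (sorted_list_of_multiset \<mu>) = sum_mset \<mu>" by (metis mset(1) sum_mset_sum_list)
    finally show ?thesis .
  qed
  \<comment> \<open>The lower bounds make all terms \<open>xs ! j - N' * zs ! j + C\<close>
    nonnegative. They add up to \<open>n * C\<close>, so none exceeds this sum.\<close>
  have approx: "N' * zs ! i - C \<le> xs ! i \<and> xs ! i \<le> N' * zs ! i + of_nat n * C - C"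
    if "N' = of_nat N" and zs: "sorted zs" "length zs = n" "i < n"
      and b: "\<And>q. q \<in># mset zs \<Longrightarrow> size {#y \<in># mset zs. q \<le> y#} \<le> size {#x \<in># \<mu>. of_nat N * q - C \<le> of_int x#}"
      and s: "of_int (sum_mset \<mu>) = of_nat N * sum_mset (mset zs)" for zs i N'
  proof -
    have low: "N' * zs ! j - C \<le> xs ! j" if "j < n" for j
      using b by (intro sorted_lower_bound[OF zs(1) sorted(1) zs(2) len(1) _ _ that])
        (auto simp: \<mu>_card size_filter zs(2) \<open>N' = of_nat N\<close>)
    have "(\<Sum>j<n. xs ! j) = N' * (\<Sum>j<n. zs ! j)"
      using s zs(2) sum_xs \<open>N' = of_nat N\<close> by (simp add: sum_mset_sum_list sum_list_sum_nth atLeast0LessThan)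
    then have tot: "(\<Sum>j<n. xs ! j - N' * zs ! j + C) = of_nat n * C"
      by (simp add: sum.distrib sum_subtractf sum_distrib_left)
    have "xs ! i - N' * zs ! i + C \<le> (\<Sum>j<n. xs ! j - N' * zs ! j + C)"
      using low zs(3) by (intro member_le_sum) (auto simp: algebra_simps)
    then show ?thesis using low[OF zs(3)] unfolding tot by linarith
  qed
  have "ls ! i = ls' ! i" if i: "i < n" for i
  proof -
    let ?N = "of_nat N :: rat"
    have "?N * ls ! i - C \<le> xs ! i \<and> xs ! i \<le> ?N * ls ! i + of_nat n * C - C"
      using bound sum(1) i by (intro approx[OF refl sorted(2) len(2)]) (auto simp: mset)
    moreover have "?N * ls' ! i - C \<le> xs ! i \<and> xs ! i \<le> ?N * ls' ! i + of_nat n * C - C"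
      using bound' sum(2) i by (intro approx[OF refl sorted(3) len(3)]) (auto simp: mset)
    ultimately have "\<bar>?N * ls ! i - ?N * ls' ! i\<bar> \<le> of_nat n * C" by linarith
    then have close: "?N * \<bar>ls ! i - ls' ! i\<bar> \<le> of_nat n * C"
      by (simp add: right_diff_distrib[symmetric] abs_mult)
    have "ls ! i \<in># \<nu> + \<nu>'" "ls' ! i \<in># \<nu> + \<nu>'"
      using i len mset by (metis nth_mem set_mset_mset union_iff)+
    then obtain s r s' r' where r: "0 < r" "r \<le> n" "ls ! i = of_int s / of_nat r"
      "0 < r'" "r' \<le> n" "ls' ! i = of_int s' / of_nat r'" using den by meson
    have "?N * (\<bar>ls ! i - ls' ! i\<bar> * (of_nat n)\<^sup>2) \<le> of_nat n * C * (of_nat n)\<^sup>2"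
      using mult_right_mono[OF close, of "(of_nat n)\<^sup>2"] by (simp add: mult.assoc)
    also have "\<dots> < ?N * 1" using N by simp
    finally have "\<bar>ls ! i - ls' ! i\<bar> * (of_nat n)\<^sup>2 < 1"
      by (metis mult_less_cancel_left_pos mult_eq_0_iff of_nat_0_le_iff order_less_irrefl mult_zero_left zero_less_mult_iff less_le)
    then show ?thesis using rational_gap[OF r(1,2,4,5)] r(3,6) by simp
  qed
  then have "ls = ls'" using len by (intro nth_equalityI) auto
  then show ?thesis using mset by simp
qed

section \<open>The part of an isocrystal of large slope\<close>

context isocrystal
begin

definition slopes :: "(int \<times> nat) list \<Rightarrow> rat list" where
  "slopes srs = concat (map (\<lambda>(s, r). replicate r (of_int s / of_nat r)) srs)"

lemma length_slopes: "length (slopes srs) = sum_list (map snd srs)"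
  by (induction srs) (auto simp: slopes_def)

abbreviation "steep q \<equiv> \<lambda>c :: int \<times> nat \<times> (nat \<Rightarrow> 'l). q \<le> (of_int (fst c) / of_nat (fst (snd c)) :: rat)"

lemma length_us_filter: "length (us (filter P cs)) \<le> length (us cs)"
  by (induction cs) (auto simp: us_def)

text \<open>The lists \<open>slopes (srs_of cs)\<close> and \<open>us cs\<close> are aligned: each
  chain contributes its slope once per basis vector.\<close>

lemma lincomb_filter:
  assumes "\<And>k. k < length (us cs) \<Longrightarrow> \<not> q \<le> slopes (srs_of cs) ! k \<Longrightarrow> y k = 0"
  shows "lincomb y (us cs) \<in> spc (filter (steep q) cs)"
  using assms
proof (induction cs arbitrary: y)
  case Nil
  then show ?case by (simp add: us_simps lincomb_def)
next
  case (Cons a cs)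
  obtain s r v where a: "a = (s, r, v)" by (cases a)
  let ?x = "\<lambda>i. if i < r then y i else 0"
  have sl: "slopes (srs_of (a # cs)) = replicate r (of_int s / of_nat r) @ slopes (srs_of cs)"
    by (simp add: slopes_def srs_of_def a)
  have len: "length (us (a # cs)) = r + length (us cs)" by (simp add: a us_simps)
  have eq: "lincomb y (us (a # cs)) = h r v ?x + lincomb (\<lambda>i. y (i + r)) (us cs)"
  proof -
    have "lincomb y (map (\<lambda>j. (F ^^ j) v) [0..<r]) = h r v ?x" unfolding h_lincomb by (rule lincomb_cong) simp
    then show ?thesis unfolding a us_simps lincomb_append by simp
  qed
  have IH: "lincomb (\<lambda>i. y (i + r)) (us cs) \<in> spc (filter (steep q) cs)"
  proof (rule Cons.IH)
    fix k assume "k < length (us cs)" "\<not> q \<le> slopes (srs_of cs) ! k"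
    then show "y (k + r) = 0" using Cons.prems[of "k + r"] by (simp add: sl len nth_append)
  qed
  show ?case
  proof (cases "steep q a")
    case True
    moreover have "?x \<in> carr r" by (simp add: carr_def)
    ultimately show ?thesis unfolding eq using IH by (auto simp: a)
  next
    case False
    have "y k = 0" if "k < r" for k
    proof (rule Cons.prems)
      show "k < length (us (a # cs))" using that by (simp add: len)
      show "\<not> q \<le> slopes (srs_of (a # cs)) ! k" unfolding sl using that False by (simp add: nth_append a)
    qed
    then have "h r v ?x = 0" by (simp add: h_def sm_simps)
    then show ?thesis unfolding eq using IH False by simp
  qed
qed

end

section \<open>Existence of the Newton point and its estimate by Hodge points\<close>

context frob_dvr
begin

lemma newton_point_exists:
  assumes b: "b \<in> GL n UNIV"
  shows "\<exists>\<nu>. is_newton_point val \<sigma> b \<nu>"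
proof -
  obtain \<pi> where \<pi>: "\<pi> \<noteq> 0" "val \<pi> = 1" using ex_uniformizer by blast
  have bc: "b \<in> carrier_mat n n" by (rule GL_D[OF b])
  interpret I: isocrystal val \<sigma> "twist b" n \<pi> by (rule isocrystal_twist[OF b \<pi>])
  obtain cs where cs: "\<forall>c\<in>set cs. I.chain c" "I.indc cs" "I.spc cs = carr n" using I.chain_basis by blast
  let ?vs = "I.us cs" and ?srs = "I.srs_of cs"
  let ?g = "cols n ?vs"
  have len: "length ?vs = n" by (rule I.spc_length[OF cs])
  have vs: "set ?vs \<subseteq> carr n" by (rule I.us_carr[OF cs(1)])
  have srs: "\<forall>(s, r)\<in>set ?srs. r > 0 \<and> coprime s (int r)" using cs(1) by (force simp: I.srs_of_def I.chain_def)
  then have srs': "\<forall>(s, r)\<in>set ?srs. r > 0" by blast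
  have eq: "?g * iso_blocks \<pi> ?srs = b * map_mat \<sigma> ?g"
    using intertwine_iff[OF bc vs len srs', of \<pi>] I.steps_us[OF cs(1)] I.length_us[of cs] len by simp
  have gc: "?g \<in> carrier_mat n n" by (simp add: cols_def)
  define e :: "nat \<Rightarrow> nat \<Rightarrow> 'l" where "e j = (\<lambda>i. if i = j then 1 else 0)" for j
  have "\<forall>j\<in>{..<n}. \<exists>c. e j = lincomb c ?vs"
    using cs(3) unfolding I.spc_iff[symmetric] by (simp add: e_def carr_def)
  from bchoice[OF this] obtain c where c: "\<And>j. j < n \<Longrightarrow> e j = lincomb (c j) ?vs" by auto
  \<comment> \<open>The columns of \<open>B\<close> hold the coordinates of the unit vectors in the
    basis of chains.\<close>
  define B where "B = mat n n (\<lambda>(k, j). c j k)"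
  have Bc: "B \<in> carrier_mat n n" by (simp add: B_def)
  have "?g * B = 1\<^sub>m n"
  proof (rule eq_matI)
    fix i j assume "i < dim_row (1\<^sub>m n :: 'l mat)" "j < dim_col (1\<^sub>m n :: 'l mat)"
    then have ij: "i < n" "j < n" by auto
    have "(?g * B) $$ (i, j) = mv ?g (c j) i"
      unfolding index_mult[OF gc Bc ij] using ij by (simp add: mv_def cols_def B_def)
    also have "\<dots> = e j i" using mv_cols[OF vs len] c[OF ij(2)] by simp
    finally show "(?g * B) $$ (i, j) = 1\<^sub>m n $$ (i, j)" using ij by (simp add: e_def)
  qed (use gc Bc in auto)
  then have "?g \<in> GL n UNIV" using gc Bc mat_mult_left_right_inverse[OF gc Bc] by (auto simp: GL_def)
  then show ?thesis unfolding is_newton_point_def using \<pi> srs eq bc by auto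
qed

text \<open>The outer factors of the Smith form and \<open>\<sigma>\<close> preserve the standard
  lattice, and the diagonal factor changes valuations by at most \<open>c\<close>.\<close>

lemma bounded_twist:
  assumes b: "b \<in> GL n UNIV" and \<pi>: "\<pi> \<noteq> 0" "val \<pi> = 1"
    and c: "\<And>x. x \<in># hodge_point val b \<Longrightarrow> \<bar>x\<bar> \<le> c" "0 \<le> c"
  shows "bounded_isocrystal val \<sigma> (twist b) n \<pi> c"
proof -
  interpret I: isocrystal val \<sigma> "twist b" n \<pi> by (rule isocrystal_twist[OF b \<pi>])
  obtain U V t where t: "U \<in> GLO n" "V \<in> GLO n" "\<And>i. i < n \<Longrightarrow> t i \<noteq> 0" "b = U * mat_diag n t * V"
    "hodge_point val b = mset (map (\<lambda>i. val (t i)) [0..<n])"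
    using hodge_point_form[OF GL_D[OF b] GL_UNIV_det[OF b]] by blast
  have tc: "\<bar>val (t i)\<bar> \<le> c" if "i < n" for i using c(1)[of "val (t i)"] that by (simp add: t(5))
  obtain U' V' where U': "Omat n n U" "Omat n n U'" "U' * U = 1\<^sub>m n" and V': "Omat n n V" "Omat n n V'" "V' * V = 1\<^sub>m n"
    using t(1,2) unfolding GLO_iff by blast
  have cc: "U \<in> carrier_mat n n" "U' \<in> carrier_mat n n" "V \<in> carrier_mat n n" "V' \<in> carrier_mat n n" using U' V' by auto
  let ?D = "mv (mat_diag n t)"
  have tw: "twist b x = mv U (?D (mv V (\<lambda>k. \<sigma> (x k))))" for x
    unfolding twist_def t(4) mv_mult[OF mult_carrier_mat[OF cc(1) mat_diag_dim] cc(3)] mv_mult[OF cc(1) mat_diag_dim] ..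
  have sig: "vg s (\<lambda>k. \<sigma> (x k)) \<longleftrightarrow> vg s x" for s x
    using ge_sigk[of _ 1] by (simp add: vg_def)
  show ?thesis
  proof unfold_locales
    show "vg (s - c) (twist b x)" if "vg s x" for s x
    proof -
      have y: "vg s (mv V (\<lambda>k. \<sigma> (x k)))" using that sig vg_mv[OF V'(1)] by blast
      have "ge (s - c) (t i * mv V (\<lambda>k. \<sigma> (x k)) i)" if "i < n" for i
      proof -
        have "ge (- c) (t i)" using tc[OF that] unfolding vge_def by linarith
        moreover have "ge s (mv V (\<lambda>k. \<sigma> (x k)) i)" using y by (simp add: vg_def)
        ultimately show ?thesis by (rule ge_mult') simp
      qed
      then have "vg (s - c) (?D (mv V (\<lambda>k. \<sigma> (x k))))" unfolding vg_def mv_diag by simp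
      then show ?thesis unfolding tw using vg_mv[OF U'(1)] by blast
    qed
    show "vg (s - c) x" if x: "x \<in> carr n" "vg s (twist b x)" for s x
    proof -
      let ?y = "mv V (\<lambda>k. \<sigma> (x k))"
      have "vg s (mv U' (twist b x))" using vg_mv[OF U'(2) x(2)] .
      then have "vg s (?D ?y)"
        unfolding tw mv_mult[OF cc(2,1), symmetric] U'(3) mv_one[OF mv_carr[OF mat_diag_dim]] .
      then have "ge (s - c) (?y i)" if "i < n" for i
        using that t(3)[OF that] tc[OF that] ge_mono[of "s - val (t i)" "?y i" "s - c"]
        by (auto simp: vg_def mv_diag ge_mult_iff split: if_splits)
      moreover have "?y i = 0" if "\<not> i < n" for i using that cc by (simp add: mv_def)
      ultimately have "vg (s - c) ?y" unfolding vg_def by (metis ge_0)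
      then have "vg (s - c) (mv V' ?y)" using vg_mv[OF V'(2)] by blast
      moreover have "(\<lambda>k. \<sigma> (x k)) \<in> carr n" using x(1) by (simp add: carr_def)
      ultimately have "vg (s - c) (\<lambda>k. \<sigma> (x k))"
        unfolding mv_mult[OF cc(4,3), symmetric] V'(3) by (simp only: mv_one)
      then show ?thesis using sig by blast
    qed
  qed fact
qed

lemma newton_estimate:
  fixes c :: int and N :: nat
  assumes b: "b \<in> GL n UNIV" and \<nu>: "is_newton_point val \<sigma> b \<nu>"
    and c: "\<And>x. x \<in># hodge_point val b \<Longrightarrow> \<bar>x\<bar> \<le> c" "0 \<le> c"
  defines "\<mu> \<equiv> hodge_point val (frob_power \<sigma> b N)"
  shows "size \<mu> = n" "size \<nu> = n"
    "\<And>q. q \<in># \<nu> \<Longrightarrow> size {#y \<in># \<nu>. q \<le> y#} \<le> size {#x \<in># \<mu>. of_nat N * q - of_int (2 * int n * c) \<le> of_int x#}"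
    "of_int (sum_mset \<mu>) = of_nat N * sum_mset \<nu>"
    "\<And>q. q \<in># \<nu> \<Longrightarrow> \<exists>s r. 0 < r \<and> r \<le> n \<and> q = of_int s / of_nat r"
proof -
  have bc: "b \<in> carrier_mat n n" by (rule GL_D[OF b])
  have det_b: "det b \<noteq> 0" by (rule GL_UNIV_det[OF b])
  obtain \<pi> srs g where g: "g \<in> GL n UNIV" and \<pi>: "\<pi> \<noteq> 0" "val \<pi> = 1"
    and srs: "\<forall>(s, r)\<in>set srs. r > 0 \<and> coprime s (int r)"
    and eq: "g * iso_blocks \<pi> srs = b * map_mat \<sigma> g"
    and \<nu>': "\<nu> = mset (concat (map (\<lambda>(s, r). replicate r (of_int s / of_nat r)) srs))"
    using \<nu> bc unfolding is_newton_point_def by auto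
  have gc: "g \<in> carrier_mat n n" by (rule GL_D[OF g])
  interpret I: bounded_isocrystal val \<sigma> "twist b" n \<pi> c by (rule bounded_twist[OF b \<pi> c])
  have \<nu>_slopes: "\<nu> = mset (I.slopes srs)" by (simp add: \<nu>' I.slopes_def)
  define vs where "vs = map (\<lambda>j i. if i < n then g $$ (i, j) else 0) [0..<n]"
  have vs: "set vs \<subseteq> carr n" "length vs = n" by (auto simp: vs_def carr_def)
  have g_cols: "g = cols n vs" using gc by (intro eq_matI) (auto simp: cols_def vs_def)
  have total: "sum_list (map snd srs) = n"
    using arg_cong[OF eq, of dim_col] iso_blocks_carrier[of \<pi> srs] gc by simp
  have srs': "\<forall>(s, r)\<in>set srs. r > 0" using srs by blast
  have steps: "steps \<pi> srs vs = map (twist b) vs"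
    using intertwine_iff[OF bc vs srs' total, of \<pi>] eq g_cols by simp
  obtain cs where cs: "I.srs_of cs = srs" "I.us cs = vs" "\<forall>c\<in>set cs. I.chain c"
    using I.chains_of_steps[OF srs vs(1) _ steps] vs(2) total by metis
  obtain A where g': "A \<in> carrier_mat n n" "A * g = 1\<^sub>m n" using g by (auto simp: GL_def)
  have inj: "y k = 0" if y: "lincomb y vs = 0" and k: "k < n" for y k
  proof -
    let ?y = "\<lambda>i. if i < n then y i else 0"
    have "lincomb ?y vs = 0" using y lincomb_cong[of vs ?y y] vs(2) by simp
    then have "mv A (mv g ?y) = 0" using mv_cols[OF vs, of ?y] g_cols by (simp add: mv_0)
    moreover have "?y \<in> carr n" by (simp add: carr_def)
    ultimately have "?y = 0" unfolding mv_mult[OF g'(1) gc, symmetric] g'(2) by (simp only: mv_one)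
    then show ?thesis using fun_cong[of ?y 0 k] k by (simp add: pointwise)
  qed
  define A where "A = frob_power \<sigma> b N"
  have Ac: "A \<in> carrier_mat n n" unfolding A_def by (rule frob_power_carrier[OF bc])
  have det_A: "det A \<noteq> 0" "val (det A) = int N * val (det b)"
    using val_det_frob_power[OF bc det_b, of N] by (auto simp: A_def)
  obtain U V t where t: "U \<in> GLO n" "V \<in> GLO n" "\<And>i. i < n \<Longrightarrow> t i \<noteq> 0" "A = U * mat_diag n t * V"
    and \<mu>_t: "\<mu> = mset (map (\<lambda>i. val (t i)) [0..<n])"
    unfolding \<mu>_def A_def[symmetric] using hodge_point_form[OF Ac det_A(1)] by blast
  show "size \<mu> = n" by (simp add: \<mu>_t)
  show "size \<nu> = n" by (simp add: \<nu>_slopes I.length_slopes total)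
  have mem: "\<exists>s r. (s, r) \<in> set srs \<and> q = of_int s / of_nat r" if "q \<in># \<nu>" for q
    using that by (auto simp: \<nu>')
  show "\<exists>s r. 0 < r \<and> r \<le> n \<and> q = of_int s / of_nat r" if q: "q \<in># \<nu>" for q
  proof -
    obtain s r where sr: "(s, r) \<in> set srs" "q = of_int s / of_nat r" using mem[OF q] by blast
    have "r \<le> sum_list (map snd srs)" using sr(1) by (intro member_le_sum_list) force+
    then show ?thesis using sr srs' total by blast
  qed
  show "of_int (sum_mset \<mu>) = of_nat N * sum_mset \<nu>"
  proof -
    \<comment> \<open>In the determinant of \<open>eq\<close> the contributions of \<open>g\<close>
      and of its image under \<open>\<sigma>\<close> cancel, because \<open>\<sigma>\<close>
      preserves valuations.\<close>
    have Dc: "iso_blocks \<pi> srs \<in> carrier_mat n n" using iso_blocks_carrier[of \<pi> srs] total by simp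
    have mg: "map_mat \<sigma> g \<in> carrier_mat n n" using gc by simp
    have "det g * det (iso_blocks \<pi> srs) = det b * \<sigma> (det g)"
      using arg_cong[OF eq, of det] det_mult[OF gc Dc] det_mult[OF bc mg] map_mat_sig_det[OF gc] by simp
    then have "val (det g * det (iso_blocks \<pi> srs)) = val (det b * \<sigma> (det g))" by simp
    then have db: "val (det b) = sum_list (map fst srs)"
      using val_det_iso_blocks[OF \<pi> srs'] GL_UNIV_det[OF g] det_b by (simp add: val_mult val_sig)
    have "sum_list (I.slopes srs) = of_int (sum_list (map fst srs))"
      using srs' unfolding I.slopes_def by (induction srs) (auto simp: sum_list_replicate)
    then have "sum_mset \<nu> = of_int (val (det b))" unfolding \<nu>_slopes sum_mset_sum_list db .
    moreover have "sum_mset \<mu> = int N * val (det b)"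
      unfolding \<mu>_def A_def[symmetric] hodge_point_sum[OF Ac det_A(1)] by (rule det_A(2))
    ultimately show ?thesis by simp
  qed
  show "size {#y \<in># \<nu>. q \<le> y#} \<le> size {#x \<in># \<mu>. of_nat N * q - of_int (2 * int n * c) \<le> of_int x#}"
    if q: "q \<in># \<nu>" for q
  proof -
    define \<tau> where "\<tau> = \<lceil>of_nat N * q - of_int (2 * int n * c)\<rceil>"
    obtain s r where sr: "(s, r) \<in> set srs" "q = of_int s / of_nat r" using mem[OF q] by blast
    then have r: "r > 0" using srs' by blast
    obtain v where v: "(s, r, v) \<in> set cs" using sr(1) unfolding cs(1)[symmetric] I.srs_of_def by auto
    have "v \<noteq> 0"
    proof
      assume "v = 0"
      have "v \<in> set (I.us cs)" unfolding I.us_def using v r by (force intro!: image_eqI[of _ _ 0])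
      then obtain k where k: "k < n" "vs ! k = 0" using vs(2) \<open>v = 0\<close> unfolding cs(2) by (metis in_set_conv_nth)
      have "lincomb (\<lambda>i. if i = k then 1 else 0) vs = 0"
        unfolding lincomb_def using k(2) by (intro sum.neutral) (auto simp: sm_simps)
      from inj[OF this k(1)] show False by simp
    qed
    then have "\<bar>s\<bar> \<le> int r * c" using I.slope_bound v cs(3) by blast
    then have "\<bar>q\<bar> \<le> of_int c"
    proof -
      have "of_int \<bar>s\<bar> \<le> (of_int (int r * c) :: rat)" using \<open>\<bar>s\<bar> \<le> int r * c\<close> by (simp only: of_int_le_iff)
      then show ?thesis using r by (simp add: sr(2) abs_divide field_simps)
    qed
    let ?I = "{k. k < n \<and> q \<le> I.slopes srs ! k}"
    \<comment> \<open>The \<open>N\<close>-th power of \<open>b\<sigma>\<close> applies the matrix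
      \<open>A\<close> to the conjugate of a vector under \<open>\<sigma> ^^ N\<close>. As
      \<open>minmax\<close> speaks of the matrix alone, the test vectors have to be
      conjugated.\<close>
    define w where "w k = (\<lambda>i. (\<sigma> ^^ N) ((vs ! k) i))" for k
    \<comment> \<open>A combination of the conjugates is the conjugate of a combination, with
      coefficients the preimages of the \<open>z k\<close> under
      \<open>\<sigma> ^^ N\<close>.\<close>
    have sum_w: "\<exists>y. (\<Sum>k\<in>?I. sm (z k) (w k)) = (\<lambda>i. (\<sigma> ^^ N) (lincomb y vs i)) \<and>
        (\<forall>k. k \<notin> ?I \<longrightarrow> y k = 0) \<and> (\<forall>k\<in>?I. (\<sigma> ^^ N) (y k) = z k)" for z
    proof -
      have "\<forall>k. \<exists>x. (\<sigma> ^^ N) x = z k" using sigk_surj by blast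
      from choice[OF this] obtain x where x: "\<And>k. (\<sigma> ^^ N) (x k) = z k" by blast
      let ?y = "\<lambda>k. if k \<in> ?I then x k else 0"
      have "lincomb ?y vs = (\<Sum>k\<in>?I. sm (x k) (vs ! k))"
        unfolding lincomb_def vs(2) by (intro sum.mono_neutral_cong_right) (auto simp: sm_simps)
      then have "(\<sigma> ^^ N) (lincomb ?y vs i) = (\<Sum>k\<in>?I. sm (z k) (w k)) i" for i
        by (simp add: pointwise sigk_sum sigk_mult x w_def)
      then have "(\<Sum>k\<in>?I. sm (z k) (w k)) = (\<lambda>i. (\<sigma> ^^ N) (lincomb ?y vs i))" by auto
      then show ?thesis using x by (intro exI[of _ ?y]) simp
    qed
    have "card ?I \<le> card {i. i < n \<and> \<tau> \<le> val (t i)}"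
    proof (rule minmax[OF t(1,2,4,3), of ?I w])
      show "w k \<in> carr n" if "k \<in> ?I" for k
      proof -
        have "vs ! k \<in> carr n" using that vs by (simp add: subset_iff)
        then show ?thesis by (simp add: w_def carr_def)
      qed
    next
      fix z assume z: "(\<Sum>k\<in>?I. sm (z k) (w k)) = 0"
      obtain y where y: "(\<Sum>k\<in>?I. sm (z k) (w k)) = (\<lambda>i. (\<sigma> ^^ N) (lincomb y vs i))"
        "\<And>k. k \<in> ?I \<Longrightarrow> (\<sigma> ^^ N) (y k) = z k" using sum_w by blast
      have "(\<sigma> ^^ N) (lincomb y vs i) = 0" for i using fun_cong[OF y(1), of i] z by (simp add: pointwise)
      then have "lincomb y vs = 0" by (simp add: fun_eq_iff pointwise)
      then have "y k = 0" if "k < n" for k using inj that by blast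
      then show "\<forall>k\<in>?I. z k = 0" using y(2) by (metis (no_types, lifting) mem_Collect_eq sigk_0)
    next
      fix z assume z: "vg 0 (\<Sum>k\<in>?I. sm (z k) (w k))"
      obtain y where y: "(\<Sum>k\<in>?I. sm (z k) (w k)) = (\<lambda>i. (\<sigma> ^^ N) (lincomb y vs i))"
        "\<And>k. k \<notin> ?I \<Longrightarrow> y k = 0" using sum_w by blast
      let ?u = "lincomb y vs"
      have u0: "vg 0 ?u" using z unfolding y(1) by (simp add: vg_def)
      have "?u \<in> I.spc (filter (I.steep q) cs)"
        using I.lincomb_filter[of cs q y] y(2) vs(2) unfolding cs(1,2) by simp
      moreover have "\<forall>c\<in>set (filter (I.steep q) cs). I.chain c \<and> I.steep q c" using cs(3) by simp
      moreover have "length (I.us (filter (I.steep q) cs)) \<le> n"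
        using I.length_us_filter[of "I.steep q" cs] unfolding cs(2) vs(2) .
      ultimately have "vg \<tau> ((twist b ^^ N) ?u)"
        unfolding \<tau>_def using I.iterate_bound u0 \<open>\<bar>q\<bar> \<le> of_int c\<close> by blast
      also have "(twist b ^^ N) ?u = mv A (\<Sum>k\<in>?I. sm (z k) (w k))"
        unfolding y(1) A_def by (rule twist_power[OF bc lincomb_in[OF carr_subspace vs(1)]])
      finally show "vg \<tau> (mv A (\<Sum>k\<in>?I. sm (z k) (w k)))" .
    qed simp_all
    also have "card {i. i < n \<and> \<tau> \<le> val (t i)} = size {#x \<in># \<mu>. \<tau> \<le> x#}" unfolding \<mu>_t size_filter_map ..
    also have "card ?I = size {#y \<in># \<nu>. q \<le> y#}"
      by (simp only: \<nu>_slopes mset_filter[symmetric] size_mset length_filter_conv_card I.length_slopes total)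
    finally show ?thesis by (simp add: \<tau>_def ceiling_le_iff)
  qed
qed

end

theorem theorem3p17:
  fixes n :: nat and \<mu>1 :: "int multiset"
  assumes "n \<ge> 1" and "\<mu>1 \<in> hodge_points n"
  shows "\<exists>C' :: nat.
    \<forall>(W :: 'l::field_char_0 set) (red :: 'l \<Rightarrow> 'k::{alg_closed_field, field_prime_char})
      (F :: 'l set) (val :: 'l \<Rightarrow> int) (\<sigma> :: 'l \<Rightarrow> 'l).
      frobenius_field W red F val \<sigma> \<longrightarrow>
      (\<forall>N > C'. \<forall>\<mu> :: nat \<Rightarrow> int multiset.
        (\<forall>i\<in>{1..N}. \<mu> i \<in> hodge_points n) \<longrightarrow> \<mu> 1 = \<mu>1 \<longrightarrow>
        (\<forall>b \<in> H_set val \<sigma> n \<mu> N. \<forall>b' \<in> H_set val \<sigma> n \<mu> N.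
          newton_point val \<sigma> b = newton_point val \<sigma> b'))"
proof -
  \<comment> \<open>A bound for all entries of \<open>\<mu>1\<close> in absolute value that is
    defined from \<open>\<mu>1\<close> alone, so that it can be fixed before the field.\<close>
  define c where "c = (\<Sum>x\<in>#\<mu>1. nat \<bar>x\<bar>)"
  have c: "\<bar>x\<bar> \<le> int c" if "x \<in># \<mu>1" for x
  proof -
    obtain M where "\<mu>1 = add_mset x M" using multi_member_split[OF \<open>x \<in># \<mu>1\<close>] by blast
    then have "nat \<bar>x\<bar> \<le> c" by (simp add: c_def)
    then show ?thesis by linarith
  qed
  have "newton_point val \<sigma> b = newton_point val \<sigma> b'"
    if frob: "frobenius_field W red F val \<sigma>" and N: "N > 2 * c * n ^ 4" and \<mu>: "\<mu> 1 = \<mu>1"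
      and b: "b \<in> H_set val \<sigma> n \<mu> N" and b': "b' \<in> H_set val \<sigma> n \<mu> N"
    for W :: "'l set" and red :: "'l \<Rightarrow> 'k" and F val \<sigma> N and \<mu> :: "nat \<Rightarrow> int multiset" and b b' :: "'l mat"
  proof -
    interpret frobenius_field W red F val \<sigma> by (rule frob)
    \<comment> \<open>Only the first and the last entry of the tuple are used.\<close>
    have N1: "1 \<in> {1..N}" "N \<in> {1..N}" using N by auto
    have H: "x \<in> GL n UNIV" "hodge_point val x = \<mu>1" "hodge_point val (frob_power \<sigma> x N) = \<mu> N"
      if "x \<in> H_set val \<sigma> n \<mu> N" for x
    proof -
      show x: "x \<in> GL n UNIV" and "hodge_point val (frob_power \<sigma> x N) = \<mu> N"
        using that N1 by (auto simp: H_set_def)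
      have "\<forall>i\<in>{1..N}. hodge_point val (frob_power \<sigma> x i) = \<mu> i" using that by (simp add: H_set_def)
      from bspec[OF this N1(1)] have "hodge_point val (frob_power \<sigma> x (Suc 0)) = \<mu>1" using \<mu> by simp
      moreover have id: "map_mat (\<sigma> ^^ 0) x = x" by (rule eq_matI) auto
      have "frob_power \<sigma> x (Suc 0) = x" unfolding frob_power.simps id using GL_D[OF x] by simp
      ultimately show "hodge_point val x = \<mu>1" by (simp only:)
    qed
    \<comment> \<open>With \<open>x' = x\<close> this makes the definite description meaningful;
      with two different matrices it is the comparison sought.\<close>
    have unique: "\<nu> = \<nu>'"
      if x: "x \<in> H_set val \<sigma> n \<mu> N" "is_newton_point val \<sigma> x \<nu>"
        and x': "x' \<in> H_set val \<sigma> n \<mu> N" "is_newton_point val \<sigma> x' \<nu>'" for x x' \<nu> \<nu>'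
    proof -
      note E = newton_estimate(1,3,4)[where c = "int c" and N = N, OF H(1)[OF x(1)] x(2), unfolded H[OF x(1)]]
        newton_estimate(2,5)[where c = "int c", OF H(1)[OF x(1)] x(2), unfolded H[OF x(1)]]
      note E' = newton_estimate(1,3,4)[where c = "int c" and N = N, OF H(1)[OF x'(1)] x'(2), unfolded H[OF x'(1)]]
        newton_estimate(2,5)[where c = "int c", OF H(1)[OF x'(1)] x'(2), unfolded H[OF x'(1)]]
      have "of_nat n * of_int (2 * int n * int c) * (of_nat n)\<^sup>2 = (of_nat (2 * c * n ^ 4) :: rat)"
        by (simp add: power2_eq_square power4_eq_xxxx)
      also have "\<dots> < of_nat N" using N by (simp only: of_nat_less_iff)
      finally show ?thesis using E E' c
        by (intro slopes_determined[of "\<mu> N" n \<nu> \<nu>' N "of_int (2 * int n * int c)"]) auto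
    qed
    have newton: "is_newton_point val \<sigma> x (newton_point val \<sigma> x)" if x: "x \<in> H_set val \<sigma> n \<mu> N" for x
    proof -
      obtain \<nu> where \<nu>: "is_newton_point val \<sigma> x \<nu>" using newton_point_exists[OF H(1)[OF x]] by blast
      show ?thesis unfolding newton_point_def
        by (rule theI[of "is_newton_point val \<sigma> x", OF \<nu>]) (rule unique[OF x _ x \<nu>])
    qed
    show ?thesis by (rule unique[OF b newton[OF b] b' newton[OF b']])
  qed
  then show ?thesis by blast
qed

end
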